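(* Let $T>0$ and let $\mu^1_t,\mu^2_t\in\mathcal{C}([0,T);\mathcal{M}(\mathbb{R}^d))$ be two measure-valued (weak) solutions on $[0,T)$ to $$\partial_t\mu_t+\operatorname{div}\bigl(F[\mu_{t-\tau(t)}]\mu_t\bigr)=0,\quad x\in\mathbb{R}^d,\ t>0,$$ with $F$ given by either of the two choices (A) or (B) described in the context (the same choice for both solutions), subject to uniformly compactly supported initial data $g^1_s,g^2_s\in\mathcal{C}([-\tau(0),0];\mathcal{M}(\mathbb{R}^d))$, respectively (i.e. $\mu^i_s=g^i_s$ for $s\in[-\tau(0),0]$). Then there exists a constant $C>0$, depending on $T$, such that $$d_p(\mu^1_t,\mu^2_t)\le C\max_{s\in[-\tau(0),0]}d_p(g^1_s,g^2_s)$$ for all $p\in[1,\infty]$ and $t\in[0,T)$.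
   Context: $\mathcal{M}(\mathbb{R}^d)$ is the set of probability measures on $\mathbb{R}^d$ (continuity of curves of measures is understood with respect to the narrow topology). Initial data $g_s$ are uniformly compactly supported if there is a ball containing $\operatorname{supp} g_s$ for all $s\in[-\tau(0),0]$. For $1\le p<\infty$ the Wasserstein distance is $d_p(\mu,\nu)=\inf_{\pi\in\Pi(\mu,\nu)}\bigl(\int_{\mathbb{R}^d\times\mathbb{R}^d}|x-y|^p\,d\pi(x,y)\bigr)^{1/p}$, and $d_\infty(\mu,\nu)=\inf_{\pi\in\Pi(\mu,\nu)}\sup_{(x,y)\in\operatorname{supp}\pi}|x-y|$, where $\Pi(\mu,\nu)$ is the set of probability measures on $\mathbb{R}^{2d}$ with marginals $\mu$ and $\nu$. (If the maximum over $s$ is not attained it is understood as a supremum.) The function $\psi:[0,+\infty)\to(0,+\infty)$ is non-increasing and Lipschitz continuous with $\psi(0)=1$. The velocity field is either (A) $F[\mu_{t-\tau(t)}](x)=\int_{\mathbb{R}^d}\psi(|x-y|)(y-x)\,d\mu_{t-\tau(t)}(y)$, or (B) $F[\mu_{t-\tau(t)}](x)=\dfrac{\int_{\mathbb{R}^d}\psi(|x-y|)(y-x)\,d\mu_{t-\tau(t)}(y)}{\int_{\mathbb{R}^d}\psi(|x-y|)\,d\mu_{t-\tau(t)}(y)}$. The time delay $\tau\in W^{1,\infty}_{loc}(0,+\infty)$ satisfies $0<\tau^*\le\tau(t)\le\overline\tau$ for all $t\ge0$ and $\tau'(t)\le c$ for all $t>0$ (a.e.), with constants $\tau^*,\overline\tau>0$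 and $c\in(0,1)$; $\tau(0)$ is the value at $0$ by continuity. A measure-valued solution on $[0,T)$ with initial datum $g_s$ is a curve $\mu_t\in\mathcal{C}([0,T);\mathcal{M}(\mathbb{R}^d))$, extended by $\mu_s=g_s$ for $s\in[-\tau(0),0]$, such that for all $\phi\in\mathcal{C}_c^\infty(\mathbb{R}^d\times[0,T))$ $$\int_0^T\int_{\mathbb{R}^d}\bigl(\partial_t\phi+F[\mu_{t-\tau(t)}](x)\cdot\nabla_x\phi\bigr)\,d\mu_t(x)\,dt+\int_{\mathbb{R}^d}\phi(x,0)\,dg_0(x)=0.$$ *)

theory Defs
  imports "HOL-Probability.Probability"
begin

section \<open>Probability measures and narrow topology\<close>

definition prob_measures :: "'a::topological_space measure set" where
  "prob_measures = {\<mu>. prob_space \<mu> \<and> sets \<mu> = sets borel}"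

definition narrowly_continuous_on :: "real set \<Rightarrow> (real \<Rightarrow> 'a::topological_space measure) \<Rightarrow> bool" where
  "narrowly_continuous_on I \<mu> \<longleftrightarrow>
     (\<forall>f :: 'a \<Rightarrow> real. continuous_on UNIV f \<and> bounded (range f) \<longrightarrow>
        continuous_on I (\<lambda>t. \<integral>x. f x \<partial>\<mu> t))"

definition measure_curve_on :: "real set \<Rightarrow> (real \<Rightarrow> 'a::topological_space measure) \<Rightarrow> bool" where
  "measure_curve_on I \<mu> \<longleftrightarrow> (\<forall>t\<in>I. \<mu> t \<in> prob_measures) \<and> narrowly_continuous_on I \<mu>"

definition measure_support :: "'a::topological_space measure \<Rightarrow> 'a set" where
  "measure_support \<mu> = {x. \<forall>U. open U \<and> x \<in> U \<longrightarrow> emeasure \<mu> U > 0}"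


section \<open>Wasserstein distances\<close>

definition couplings :: "'a::topological_space measure \<Rightarrow> 'a measure \<Rightarrow> ('a \<times> 'a) measure set" where
  "couplings \<mu> \<nu> =
     {\<pi> \<in> prob_measures. distr \<pi> borel fst = \<mu> \<and> distr \<pi> borel snd = \<nu>}"

definition ennreal_root :: "real \<Rightarrow> ennreal \<Rightarrow> ennreal" where
  "ennreal_root p x = (if x = \<infinity> then \<infinity> else ennreal (enn2real x powr (1 / p)))"

text \<open>
  The exponent ranges over the extended interval from 1 to \<open>\<infinity>\<close>.  The distance is valued in
  the extended nonnegative reals, so that an infinite transport cost is not conflated with a
  finite one.
\<close>
definition wasserstein :: "ennreal \<Rightarrow> 'a::metric_space measure \<Rightarrow> 'a measure \<Rightarrow> ennreal" where
  "wasserstein p \<mu> \<nu> =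
     (if p = \<infinity>
      then INF \<pi>\<in>couplings \<mu> \<nu>. SUP (x, y)\<in>measure_support \<pi>. ennreal (dist x y)
      else INF \<pi>\<in>couplings \<mu> \<nu>.
             ennreal_root (enn2real p) (\<integral>\<^sup>+(x, y). ennreal (dist x y powr enn2real p) \<partial>\<pi>))"


section \<open>Test functions and weak derivatives\<close>

primrec C_k :: "nat \<Rightarrow> ('a::real_normed_vector \<Rightarrow> real) \<Rightarrow> bool" where
  "C_k 0 f \<longleftrightarrow> continuous_on UNIV f"
| "C_k (Suc k) f \<longleftrightarrow>
     (\<forall>x. f differentiable (at x)) \<and> (\<forall>v. C_k k (\<lambda>x. frechet_derivative f (at x) v))"

definition test_function :: "'a::real_normed_vector set \<Rightarrow> ('a \<Rightarrow> real) \<Rightarrow> bool" where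
  "test_function S \<phi> \<longleftrightarrow>
     (\<forall>k. C_k k \<phi>) \<and> compact (closure {x. \<phi> x \<noteq> 0}) \<and> closure {x. \<phi> x \<noteq> 0} \<subseteq> S"

definition gradient :: "('a::euclidean_space \<Rightarrow> real) \<Rightarrow> 'a \<Rightarrow> 'a" where
  "gradient f x = (\<Sum>b\<in>Basis. frechet_derivative f (at x) b *\<^sub>R b)"

definition Linf_loc :: "real set \<Rightarrow> (real \<Rightarrow> real) \<Rightarrow> bool" where
  "Linf_loc S f \<longleftrightarrow> f \<in> borel_measurable (lebesgue_on S) \<and>
     (\<forall>K. compact K \<and> K \<subseteq> S \<longrightarrow> (\<exists>B. AE x in lebesgue_on K. \<bar>f x\<bar> \<le> B))"

text \<open>\<open>f\<close> belongs to \<open>W\<^sup>1\<^sup>,\<^sup>\<infinity>\<close> locally on the open set \<open>S\<close>, with weak derivative \<open>f'\<close>.\<close>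
definition W1inf_loc :: "real set \<Rightarrow> (real \<Rightarrow> real) \<Rightarrow> (real \<Rightarrow> real) \<Rightarrow> bool" where
  "W1inf_loc S f f' \<longleftrightarrow> Linf_loc S f \<and> Linf_loc S f' \<and>
     (\<forall>\<phi>. test_function S \<phi> \<longrightarrow>
        (LINT t:S|lebesgue. f t * deriv \<phi> t) = - (LINT t:S|lebesgue. f' t * \<phi> t))"


section \<open>Velocity fields and measure-valued solutions\<close>

definition velocity_A :: "(real \<Rightarrow> real) \<Rightarrow> 'a::euclidean_space measure \<Rightarrow> 'a \<Rightarrow> 'a" where
  "velocity_A \<psi> \<mu> x = (\<integral>y. \<psi> (norm (x - y)) *\<^sub>R (y - x) \<partial>\<mu>)"

definition velocity_B :: "(real \<Rightarrow> real) \<Rightarrow> 'a::euclidean_space measure \<Rightarrow> 'a \<Rightarrow> 'a" where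
  "velocity_B \<psi> \<mu> x =
     (\<integral>y. \<psi> (norm (x - y)) *\<^sub>R (y - x) \<partial>\<mu>) /\<^sub>R (\<integral>y. \<psi> (norm (x - y)) \<partial>\<mu>)"

text \<open>
  Test functions on \<open>\<real>\<^sup>d \<times> [0,T)\<close> are the restrictions of smooth functions on the whole
  space-time whose compact support lies in \<open>\<real>\<^sup>d \<times> (-\<infinity>,T)\<close>; they need not vanish at time 0.
\<close>
definition weak_solution ::
  "('a measure \<Rightarrow> 'a \<Rightarrow> 'a) \<Rightarrow> (real \<Rightarrow> real) \<Rightarrow> real \<Rightarrow>
   (real \<Rightarrow> 'a::euclidean_space measure) \<Rightarrow> (real \<Rightarrow> 'a measure) \<Rightarrow> bool" where
  "weak_solution F \<tau> T g \<mu> \<longleftrightarrow>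
     measure_curve_on {0..<T} \<mu> \<and>
     (\<forall>s\<in>{-\<tau> 0..0}. \<mu> s = g s) \<and>
     (\<forall>\<phi>. test_function (UNIV \<times> {..<T}) \<phi> \<longrightarrow>
        (LINT t:{0..<T}|lborel. \<integral>x. deriv (\<lambda>s. \<phi> (x, s)) t
             + F (\<mu> (t - \<tau> t)) x \<bullet> gradient (\<lambda>y. \<phi> (y, t)) x \<partial>\<mu> t)
        + (\<integral>x. \<phi> (x, 0) \<partial>g 0) = 0)"

end

theory Submission
  imports Defs
begin

text \<open>The proof is by the method of characteristics. As long as the delayed measures are known, the velocity field is a given
  time-dependent field, continuous in time and Lipschitz in space on bounded sets, and the equation is a linear continuity
  equation. Its weak solution is the image of the initial measure under the flow of the field
  (\<open>weak_solution_eq_pushforward\<close>). Given two solutions and a coupling of their initial measures, the pair of flows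
  transports it to a coupling at time \<open>t\<close>. Two flow lines drift apart at most exponentially (\<open>flow_stability\<close>), with an
  additional term proportional to the distance of the two fields, and this is controlled by the Wasserstein distance of the
  delayed measures (\<open>velocity_wasserstein_stability\<close>). Since the delay is bounded below by \<open>\<tau>min\<close>, finitely many steps of
  this length cover \<open>[0, T)\<close>, and each multiplies the estimate by a fixed factor (\<open>stability_by_delay_steps\<close>). Flow lines
  are compared pointwise, and the remaining estimates hold with constants that do not involve the exponent; therefore the
  final constant depends neither on \<open>p\<close> nor on the solutions.

  The main difficulty is the representation of weak solutions by the flow for a field that is merely Lipschitz in space.
  Solving the dual transport equation would require smooth dependence of the flow on its initial point. Instead, smooth
  functions that increase along the field are built from squared distances to flow lines; testing with them shows that the
  mass starting in a union of small balls is found later near the transported centres (\<open>transported_balls_mass\<close>). This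
  one-sided comparison on closed sets already identifies two probability measures.

  Three facts make the induction work. Mass concentrated on a ball stays there, because the field points inwards outside the
  ball (\<open>velocity_inward\<close>), so the local Lipschitz constants suffice. The delayed time never leaves the range of the
  initial data (\<open>delayed_time_ge\<close>); this is where the bound on the weak derivative of the delay is used. Finally the mean
  transport distance is bounded by twice any transport cost (\<open>mean_distance_le_cost\<close>).\<close>

section \<open>Smooth functions and a smooth step\<close>

definition smooth :: "('a::real_normed_vector \<Rightarrow> real) \<Rightarrow> bool" where
  "smooth f \<longleftrightarrow> (\<forall>k. C_k k f)"

lemma C_k_Suc_imp: "C_k (Suc k) f \<Longrightarrow> C_k k f"
proof (induction k arbitrary: f)
  case 0
  then have "\<forall>x. f differentiable (at x)" by simp
  then show ?case
    by (simp add: continuous_on_eq_continuous_at differentiable_imp_continuous_within)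
next
  case (Suc k)
  then show ?case by (metis C_k.simps(2))
qed

lemma C_k_has_derivativeI:
  assumes "\<And>x. (f has_derivative f' x) (at x)" "\<And>v. C_k k (\<lambda>x. f' x v)"
  shows "C_k (Suc k) f"
proof -
  have "frechet_derivative f (at x) = f' x" for x
    using frechet_derivative_at[OF assms(1)] by simp
  then show ?thesis using assms by (auto simp: differentiable_def)
qed

lemma C_k_const: "C_k k (\<lambda>x. c)"
proof (induction k arbitrary: c)
  case (Suc k)
  show ?case by (rule C_k_has_derivativeI[where f'="\<lambda>x v. 0"]) (auto intro: Suc)
qed auto

lemma C_k_bounded_linear: "bounded_linear f \<Longrightarrow> C_k k f"
proof (cases k)
  case 0
  assume "bounded_linear f" then show ?thesis using 0
    by (simp add: bounded_linear.linear linear_continuous_on)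
next
  case (Suc k')
  assume "bounded_linear f" then show ?thesis unfolding Suc
    by (intro C_k_has_derivativeI[where f'="\<lambda>x. f"])
       (auto simp: bounded_linear_imp_has_derivative C_k_const)
qed

lemma C_k_SucD:
  assumes "C_k (Suc k) f"
  shows "(f has_derivative frechet_derivative f (at x)) (at x)"
    "C_k k (\<lambda>x. frechet_derivative f (at x) v)"
  using assms by (auto simp: frechet_derivative_works)

lemma C_k_add: "C_k k f \<Longrightarrow> C_k k g \<Longrightarrow> C_k k (\<lambda>x. f x + g x)"
proof (induction k arbitrary: f g)
  case (Suc k)
  show ?case
    by (rule C_k_has_derivativeI[OF has_derivative_add[OF C_k_SucD(1)[OF Suc(2)] C_k_SucD(1)[OF Suc(3)]]])
       (intro Suc.IH C_k_SucD(2) Suc.prems)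
qed (auto intro: continuous_intros)

lemma C_k_mult: "C_k k f \<Longrightarrow> C_k k g \<Longrightarrow> C_k k (\<lambda>x. f x * g x)"
proof (induction k arbitrary: f g)
  case (Suc k)
  show ?case
    by (rule C_k_has_derivativeI[OF has_derivative_mult[OF C_k_SucD(1)[OF Suc(2)] C_k_SucD(1)[OF Suc(3)]]])
       (intro Suc.IH C_k_add C_k_SucD(2) Suc.prems C_k_Suc_imp[OF Suc.prems(1)] C_k_Suc_imp[OF Suc.prems(2)])
qed (auto intro: continuous_intros)

lemma C_k_compose:
  fixes h :: "real \<Rightarrow> real"
  shows "C_k k h \<Longrightarrow> C_k k f \<Longrightarrow> C_k k (\<lambda>x. h (f x))"
proof (induction k arbitrary: f h)
  case 0
  then show ?case by (auto intro: continuous_on_compose2)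
next
  case (Suc k)
  have lin: "frechet_derivative h (at y) v = v * frechet_derivative h (at y) 1" for y v
    using linear.scaleR[OF has_derivative_linear[OF C_k_SucD(1)[OF Suc(2)]], of y v 1] by simp
  have D: "((\<lambda>x. h (f x)) has_derivative
      (\<lambda>v. frechet_derivative f (at x) v * frechet_derivative h (at (f x)) 1)) (at x)" for x
    using has_derivative_compose[OF C_k_SucD(1)[OF Suc(3)] C_k_SucD(1)[OF Suc(2)], of x]
    by (subst (asm) lin)
  have 1: "C_k k (\<lambda>x. frechet_derivative h (at (f x)) 1)"
    by (rule Suc.IH[OF C_k_SucD(2)[OF Suc.prems(1)] C_k_Suc_imp[OF Suc.prems(2)]])
  show ?case
    by (rule C_k_has_derivativeI[OF D], rule C_k_mult[OF C_k_SucD(2)[OF Suc.prems(2)] 1])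
qed

lemma C_k_inverse:
  "C_k k f \<Longrightarrow> (\<And>x. f x \<noteq> 0) \<Longrightarrow> C_k k (\<lambda>x. inverse (f x))"
proof (induction k arbitrary: f)
  case 0
  then show ?case by (auto intro: continuous_intros)
next
  case (Suc k)
  have D: "((\<lambda>x. inverse (f x)) has_derivative
      (\<lambda>h. - 1 * (inverse (f x) * frechet_derivative f (at x) h * inverse (f x)))) (at x)" for x
    using Deriv.has_derivative_inverse[OF Suc.prems(2) C_k_SucD(1)[OF Suc.prems(1)]] by simp
  show ?case
    by (rule C_k_has_derivativeI[OF D])
       (intro C_k_mult C_k_const C_k_SucD(2) Suc.prems Suc.IH C_k_Suc_imp[OF Suc.prems(1)])
qed

lemma smooth_const: "smooth (\<lambda>x. c)"
  by (simp add: smooth_def C_k_const)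

lemma smooth_bounded_linear: "bounded_linear f \<Longrightarrow> smooth f"
  by (simp add: smooth_def C_k_bounded_linear)

lemma smooth_add: "smooth f \<Longrightarrow> smooth g \<Longrightarrow> smooth (\<lambda>x. f x + g x)"
  by (simp add: smooth_def C_k_add)

lemma smooth_mult: "smooth f \<Longrightarrow> smooth g \<Longrightarrow> smooth (\<lambda>x. f x * g x)"
  by (simp add: smooth_def C_k_mult)

lemma smooth_compose:
  fixes h :: "real \<Rightarrow> real"
  shows "smooth h \<Longrightarrow> smooth f \<Longrightarrow> smooth (\<lambda>x. h (f x))"
  by (simp add: smooth_def C_k_compose)

lemma smooth_diff: "smooth f \<Longrightarrow> smooth g \<Longrightarrow> smooth (\<lambda>x. f x - g x)"
  using smooth_add[of f "\<lambda>x. (-1) * g x"] smooth_mult[OF smooth_const[of "-1"], of g] by simp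

lemma smooth_power: "smooth f \<Longrightarrow> smooth (\<lambda>x. f x ^ n)"
  by (induction n) (auto intro: smooth_const smooth_mult)

lemma smooth_sum: "(\<And>i. i \<in> I \<Longrightarrow> smooth (f i)) \<Longrightarrow> smooth (\<lambda>x. \<Sum>i\<in>I. f i x)"
  by (induction I rule: infinite_finite_induct) (auto intro: smooth_const smooth_add)

lemma smooth_continuous_on: "smooth f \<Longrightarrow> continuous_on A f"
  unfolding smooth_def by (metis C_k.simps(1) continuous_on_subset top_greatest)

lemma smooth_has_derivative: "smooth f \<Longrightarrow> (f has_derivative frechet_derivative f (at x)) (at x)"
  unfolding smooth_def using C_k_SucD(1) by blast

lemma smooth_frechet: "smooth f \<Longrightarrow> smooth (\<lambda>x. frechet_derivative f (at x) v)"
  unfolding smooth_def using C_k_SucD(2) by blast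

text \<open>For functions whose derivatives of all orders have a closed form.\<close>

lemma smooth_realI:
  fixes f :: "nat \<Rightarrow> real \<Rightarrow> real"
  assumes "\<And>n x. (f n has_real_derivative f (Suc n) x) (at x)"
  shows "smooth (f n)"
proof -
  have "C_k k (f n)" for k n
  proof (induction k arbitrary: n)
    case 0
    show ?case using assms DERIV_continuous_on[of UNIV "f n" "f (Suc n)"] by simp
  next
    case (Suc k)
    have "C_k k (\<lambda>x. f (Suc n) x * v)" for v by (intro C_k_mult C_k_const Suc)
    then show ?case
      by (intro C_k_has_derivativeI[OF assms[unfolded has_field_derivative_def]]) auto
  qed
  then show ?thesis by (simp add: smooth_def)
qed

lemma smooth_exp: "smooth (exp :: real \<Rightarrow> real)"
  using smooth_realI[of "\<lambda>n. exp"] DERIV_exp by blast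

text \<open>For \<open>P = 1\<close> this is Cauchy's flat function \<open>exp (- 1 / x)\<close>. The polynomial factor makes the family
  closed under differentiation, so that smoothness of all its members follows from a single computation
  of a derivative.\<close>

definition flat_poly_exp :: "real poly \<Rightarrow> real \<Rightarrow> real" where
  "flat_poly_exp P x = (if x \<le> 0 then 0 else poly P (1 / x) * exp (- (1 / x)))"

lemma poly_times_exp_minus_at_top: "((\<lambda>y. poly P y * exp (- y)) \<longlongrightarrow> 0) at_top" for P :: "real poly"
proof (induction P)
  case 0
  then show ?case by simp
next
  case (pCons a P)
  have 1: "((\<lambda>y::real. a * exp (- y)) \<longlongrightarrow> 0) at_top"
    using tendsto_mult_right_zero[OF tendsto_power_div_exp_0[of 0]]
    by (simp add: exp_minus divide_inverse)
  have "((\<lambda>y::real. y ^ n / exp y) \<longlongrightarrow> 0) at_top" for n by (rule tendsto_power_div_exp_0)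
  then have "((\<lambda>y. \<Sum>i\<le>degree P. coeff P i * (y ^ Suc i / exp y)) \<longlongrightarrow> (\<Sum>i\<le>degree P. coeff P i * 0)) at_top"
    by (intro tendsto_sum tendsto_mult tendsto_const) blast
  then have 2: "((\<lambda>y. y * poly P y * exp (- y)) \<longlongrightarrow> 0) at_top"
    by (simp add: poly_altdef sum_distrib_left sum_distrib_right exp_minus divide_inverse mult_ac)
  show ?case using tendsto_add[OF 1 2] by (simp add: algebra_simps)
qed

text \<open>Only the origin is delicate: there the difference quotient is \<open>y P(y) exp (- y)\<close> with \<open>y = 1 / x\<close>,
  which vanishes as \<open>y\<close> tends to infinity.\<close>

lemma flat_poly_exp_deriv:
  "(flat_poly_exp P has_real_derivative flat_poly_exp (monom 1 2 * (P - pderiv P)) x) (at x)"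
proof -
  consider "x < 0" | "x = 0" | "x > 0" by linarith
  then show ?thesis
  proof cases
    case 1
    have "((\<lambda>x. 0) has_real_derivative 0) (at x)" by simp
    then have "(flat_poly_exp P has_real_derivative 0) (at x)"
      by (rule has_field_derivative_transform_within_open[of _ _ _ "{..<0}"])
         (use 1 in \<open>auto simp: flat_poly_exp_def\<close>)
    then show ?thesis using 1 by (simp add: flat_poly_exp_def)
  next
    case 3
    have 1: "((\<lambda>x::real. 1 / x) has_real_derivative - (1 / x)\<^sup>2) (at x)"
      using DERIV_inverse[of x UNIV] 3 by (simp add: inverse_eq_divide power2_eq_square)
    have 2: "((\<lambda>x. exp (- (1 / x))) has_real_derivative exp (- (1 / x)) * - (- (1 / x)\<^sup>2)) (at x)"
      by (rule DERIV_chain2[OF DERIV_exp DERIV_minus[OF 1]])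
    have "((\<lambda>x. poly P (1 / x) * exp (- (1 / x))) has_real_derivative
         poly (monom 1 2 * (P - pderiv P)) (1 / x) * exp (- (1 / x))) (at x)"
      using DERIV_mult[OF DERIV_chain2[OF poly_DERIV[of P] 1] 2]
      by (simp only: poly_monom poly_mult poly_diff) (simp add: algebra_simps)
    then have "(flat_poly_exp P has_real_derivative
         poly (monom 1 2 * (P - pderiv P)) (1 / x) * exp (- (1 / x))) (at x)"
      by (rule has_field_derivative_transform_within_open[of _ _ _ "{0<..}"])
         (use 3 in \<open>auto simp: flat_poly_exp_def\<close>)
    then show ?thesis using 3 by (simp add: flat_poly_exp_def)
  next
    case 2
    have "((\<lambda>h. poly (pCons 0 P) (inverse h) * exp (- inverse h)) \<longlongrightarrow> 0) (at_right (0::real))"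
      by (rule filterlim_compose[OF poly_times_exp_minus_at_top filterlim_inverse_at_top_right])
    then have "((\<lambda>h. flat_poly_exp P h / h) \<longlongrightarrow> 0) (at_right (0::real))"
      by (rule Lim_transform_eventually)
         (auto simp: eventually_at_filter flat_poly_exp_def field_simps)
    moreover have "((\<lambda>h. flat_poly_exp P h / h) \<longlongrightarrow> 0) (at_left (0::real))"
      by (rule Lim_transform_eventually[OF tendsto_const])
         (auto simp: eventually_at_filter flat_poly_exp_def)
    ultimately have "((\<lambda>h. flat_poly_exp P h / h) \<longlongrightarrow> 0) (at 0)"
      by (simp add: filterlim_at_split)
    then show ?thesis using 2 by (simp add: DERIV_def flat_poly_exp_def)
  qed
qed

lemma smooth_flat_poly_exp: "smooth (flat_poly_exp P)"
  using smooth_realI[of "\<lambda>n. flat_poly_exp (((\<lambda>Q. monom 1 2 * (Q - pderiv Q)) ^^ n) P)" 0]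
    flat_poly_exp_deriv by simp

definition smooth_step :: "real \<Rightarrow> real" where
  "smooth_step x = flat_poly_exp 1 x / (flat_poly_exp 1 x + flat_poly_exp 1 (1 - x))"

lemma flat_denom_pos: "flat_poly_exp 1 x + flat_poly_exp 1 (1 - x) > 0"
  by (auto simp: flat_poly_exp_def intro: add_pos_pos)

lemma smooth_step_smooth: "smooth smooth_step"
proof -
  have 1: "smooth (\<lambda>x. flat_poly_exp 1 x + flat_poly_exp 1 (1 - x))"
    by (rule smooth_add[OF smooth_flat_poly_exp smooth_compose[OF smooth_flat_poly_exp
        smooth_diff[OF smooth_const smooth_bounded_linear[OF bounded_linear_ident]]]])
  have "smooth (\<lambda>x. inverse (flat_poly_exp 1 x + flat_poly_exp 1 (1 - x)))"
    using C_k_inverse[of _ "\<lambda>x. flat_poly_exp 1 x + flat_poly_exp 1 (1 - x)"] 1 flat_denom_pos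
    unfolding smooth_def by (simp add: less_imp_neq[THEN not_sym])
  from smooth_mult[OF smooth_flat_poly_exp[of 1] this] show ?thesis
    by (simp add: smooth_step_def[abs_def] divide_inverse)
qed

lemma smooth_step_0: "x \<le> 0 \<Longrightarrow> smooth_step x = 0"
  by (simp add: smooth_step_def flat_poly_exp_def)

lemma smooth_step_1: "x \<ge> 1 \<Longrightarrow> smooth_step x = 1"
  using flat_denom_pos[of x] by (simp add: smooth_step_def flat_poly_exp_def)

lemma flat_mono: "x \<le> y \<Longrightarrow> flat_poly_exp 1 x \<le> flat_poly_exp 1 y"
  by (auto simp: flat_poly_exp_def field_simps)

lemma flat_nonneg: "flat_poly_exp 1 x \<ge> 0"
  by (auto simp: flat_poly_exp_def)

text \<open>After clearing denominators this is the product of two monotonicity statements for the flat function.\<close>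

lemma smooth_step_mono: "x \<le> y \<Longrightarrow> smooth_step x \<le> smooth_step y"
proof -
  assume xy: "x \<le> y"
  have "flat_poly_exp 1 x * flat_poly_exp 1 (1 - y) \<le> flat_poly_exp 1 y * flat_poly_exp 1 (1 - x)"
    using xy by (intro mult_mono flat_mono flat_nonneg) auto
  moreover have "a / (a + b) \<le> c / (c + d)" if "a * d \<le> c * b" "a + b > 0" "c + d > 0" for a b c d :: real
  proof -
    have "a * (c + d) - c * (a + b) \<le> 0" using that(1) by (simp add: algebra_simps)
    then have "(a * (c + d) - c * (a + b)) / ((a + b) * (c + d)) \<le> 0"
      using that by (intro divide_nonpos_pos mult_pos_pos)
    then show ?thesis using frac_le_eq[of "a + b" "c + d" a c] that by auto
  qed
  ultimately show ?thesis unfolding smooth_step_def using flat_denom_pos by blast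
qed

lemma smooth_step_bounds: "0 \<le> smooth_step x" "smooth_step x \<le> 1"
  using flat_denom_pos[of x] flat_nonneg[of x] flat_nonneg[of "1 - x"]
  by (auto simp: smooth_step_def)

definition smooth_step' :: "real \<Rightarrow> real" where
  "smooth_step' x = deriv smooth_step x"

lemma smooth_DERIV: "smooth f \<Longrightarrow> (f has_real_derivative deriv f x) (at x)"
  for f :: "real \<Rightarrow> real"
  by (metis smooth_has_derivative DERIV_deriv_iff_real_differentiable differentiable_def)

lemma smooth_step_DERIV: "(smooth_step has_real_derivative smooth_step' x) (at x)"
  unfolding smooth_step'_def by (rule smooth_DERIV[OF smooth_step_smooth])

lemma smooth_deriv: "smooth f \<Longrightarrow> smooth (deriv f)" for f :: "real \<Rightarrow> real"
proof -
  assume f: "smooth f"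
  have "frechet_derivative f (at x) 1 = deriv f x" for x
    using frechet_derivative_at[OF smooth_DERIV[OF f, of x, unfolded has_field_derivative_def]]
    by (metis mult.right_neutral)
  then show ?thesis using smooth_frechet[OF f, of 1] by simp
qed

lemma smooth_step'_continuous: "continuous_on A smooth_step'"
  unfolding smooth_step'_def[abs_def] by (rule smooth_continuous_on[OF smooth_deriv[OF smooth_step_smooth]])

lemma smooth_step'_nonneg: "smooth_step' x \<ge> 0"
proof (rule ccontr)
  assume "\<not> smooth_step' x \<ge> 0"
  then obtain d where "d > 0" "\<forall>h>0. h < d \<longrightarrow> smooth_step (x + h) < smooth_step x"
    using DERIV_neg_dec_right[OF smooth_step_DERIV[of x]] by (meson not_le)
  then have "smooth_step (x + d / 2) < smooth_step x" by simp
  then show False using smooth_step_mono[of x "x + d / 2"] \<open>d > 0\<close> by simp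
qed

text \<open>Outside the open unit interval the step attains its extreme values.\<close>

lemma smooth_step'_zero: "x \<le> 0 \<or> x \<ge> 1 \<Longrightarrow> smooth_step' x = 0"
proof (elim disjE)
  assume "x \<le> 0" then show ?thesis
    using smooth_step_0[of x] smooth_step_bounds
    by (intro DERIV_local_min[OF smooth_step_DERIV, of 1]) auto
next
  assume "x \<ge> 1" then show ?thesis
    using smooth_step_1[of x] smooth_step_bounds
    by (intro DERIV_local_max[OF smooth_step_DERIV, of 1]) auto
qed

lemma smooth_scaled_step: "smooth (\<lambda>s. smooth_step ((s - x) / \<eta>))"
proof -
  have "smooth (\<lambda>s::real. (s - x) * (1 / \<eta>))"
    by (rule smooth_mult[OF smooth_diff[OF smooth_bounded_linear[OF bounded_linear_ident] smooth_const] smooth_const])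
  then show ?thesis using smooth_compose[OF smooth_step_smooth] by simp
qed

text \<open>The derivative of the smooth step rescaled to the interval \<open>[x, x + \<eta>]\<close>: an approximate unit mass at \<open>x\<close>.\<close>

definition step_density :: "real \<Rightarrow> real \<Rightarrow> real \<Rightarrow> real" where
  "step_density \<eta> x s = smooth_step' ((s - x) / \<eta>) / \<eta>"

lemma scaled_step_DERIV:
  "((\<lambda>s. smooth_step ((s - x) / \<eta>)) has_real_derivative step_density \<eta> x s) (at s)"
proof -
  have "((\<lambda>s. (s - x) / \<eta>) has_real_derivative 1 / \<eta>) (at s)"
    using DERIV_cdivide[OF DERIV_diff[OF DERIV_ident DERIV_const], of x \<eta>] by simp
  from DERIV_chain2[OF smooth_step_DERIV this] show ?thesis by (simp add: step_density_def)
qed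

context
  fixes \<eta> :: real
  assumes \<eta>: "\<eta> > 0"
begin

lemma step_density_continuous: "continuous_on A (step_density \<eta> x)"
  unfolding step_density_def using \<eta>
  by (intro continuous_intros continuous_on_compose2[OF smooth_step'_continuous[of UNIV]]) auto

lemma step_density_nonneg: "step_density \<eta> x s \<ge> 0"
  using \<eta> smooth_step'_nonneg by (simp add: step_density_def)

lemma step_density_zero: "s \<notin> {x..x + \<eta>} \<Longrightarrow> step_density \<eta> x s = 0"
  using \<eta> smooth_step'_zero[of "(s - x) / \<eta>"] by (auto simp: step_density_def field_simps)

lemma step_density_has_integral:
  assumes "a \<le> x" "x + \<eta> \<le> b"
  shows "(step_density \<eta> x has_integral 1) {a..b}"
proof -
  have "(step_density \<eta> x has_integral (smooth_step ((b - x) / \<eta>) - smooth_step ((a - x) / \<eta>))) {a..b}"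
    using assms \<eta> scaled_step_DERIV by (intro fundamental_theorem_of_calculus)
      (auto simp: has_real_derivative_iff_has_vector_derivative[symmetric] intro: DERIV_subset)
  moreover have "smooth_step ((b - x) / \<eta>) = 1" "smooth_step ((a - x) / \<eta>) = 0"
    using assms \<eta> by (auto simp: smooth_step_0 smooth_step_1 field_simps)
  ultimately show ?thesis by simp
qed

end

section \<open>Weak bounds on the derivative of the delay\<close>

text \<open>Passage from the Lebesgue integrals of the weak formulation to integrals over a compact interval,
  where the fundamental theorem of calculus is available.\<close>

lemma integral_compact_support:
  fixes f :: "real \<Rightarrow> real"
  assumes cont: "continuous_on {0<..} f" and zero: "\<And>x. x \<notin> {a..b} \<Longrightarrow> f x = 0" and "0 < a"
  shows "integrable (lebesgue_on {0<..}) f"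
    and "integral\<^sup>L (lebesgue_on {0<..}) f = integral {a..b} f"
    and "f integrable_on {a..b}"
proof -
  have sub: "{a..b} \<subseteq> {0<..}" using \<open>0 < a\<close> by auto
  have contab: "continuous_on {a..b} f" using cont sub by (rule continuous_on_subset)
  then have "bounded (f ` {a..b})" by (intro compact_imp_bounded compact_continuous_image) auto
  then obtain B where B: "\<And>x. x \<in> {a..b} \<Longrightarrow> norm (f x) \<le> B" unfolding bounded_iff by blast
  show int: "integrable (lebesgue_on {0<..}) f"
  proof (rule integrableI_bounded_set[where A="{a..b}" and B=B])
    show "{a..b} \<in> sets (lebesgue_on {0<..})"
      using sub by (auto simp: sets_restrict_space_iff)
    show "f \<in> borel_measurable (lebesgue_on {0<..})"
      using cont by (intro continuous_imp_measurable_on_sets_lebesgue) auto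
    show "emeasure (lebesgue_on {0<..}) {a..b} < \<infinity>"
      using sub by (subst emeasure_restrict_space) (auto simp: emeasure_lborel_Icc_eq)
  qed (use B zero in \<open>auto intro!: AE_I2\<close>)
  show i: "f integrable_on {a..b}" using contab by (rule integrable_continuous_real)
  have "integral\<^sup>L (lebesgue_on {0<..}) f = integral {0<..} f"
    using int by (rule lebesgue_integral_eq_integral) auto
  also have "\<dots> = integral {a..b} f"
    using has_integral_on_superset[OF integrable_integral[OF i] zero sub] by (rule integral_unique)
  finally show "integral\<^sup>L (lebesgue_on {0<..}) f = integral {a..b} f" .
qed

text \<open>The weak derivative is tested against a smoothed indicator \<open>\<phi>\<close> of \<open>[a, b]\<close>. Its derivative is an approximate
  unit mass at \<open>a\<close> minus one at \<open>b\<close>, and \<open>\<integral> \<phi> = - \<integral> s \<phi>'(s) ds\<close>; so for \<open>k s = \<tau> s - c s\<close> the bound on the weak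
  derivative says \<open>\<integral> k \<phi>' \<ge> 0\<close>, which in the limit is \<open>k a \<ge> k b\<close>. Continuity of \<open>k\<close> replaces the limit by a
  sufficiently small width \<open>\<eta>\<close>.\<close>

lemma weak_derivative_bound_imp_increment_bound:
  fixes \<tau> \<tau>' :: "real \<Rightarrow> real"
  assumes W: "W1inf_loc {0<..} \<tau> \<tau>'" and cont: "continuous_on {0..} \<tau>"
    and le: "AE t in lebesgue_on {0<..}. \<tau>' t \<le> c" and ab: "0 < a" "a < b"
  shows "\<tau> b - c * b \<le> \<tau> a - c * a"
proof (rule ccontr)
  define k where "k s = \<tau> s - c * s" for s
  define \<kappa> where "\<kappa> = k b - k a"
  assume "\<not> ?thesis"
  then have \<kappa>: "\<kappa> > 0" by (simp add: \<kappa>_def k_def)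
  have contk: "continuous_on {0<..} k" "continuous_on {0<..} \<tau>"
    unfolding k_def by (auto intro!: continuous_intros continuous_on_subset[OF cont])
  have "\<exists>d>0. \<forall>s. \<bar>s - x\<bar> < d \<longrightarrow> \<bar>k s - k x\<bar> < \<kappa> / 3" if "x > 0" for x
  proof -
    have "isCont k x" using contk(1) that by (simp add: continuous_on_eq_continuous_at)
    then show ?thesis using \<kappa> unfolding continuous_at_eps_delta dist_real_def by (meson divide_pos_pos zero_less_numeral)
  qed
  from this[of a] this[of b] obtain d1 d2 where d: "d1 > 0" "d2 > 0"
    "\<And>s. \<bar>s - a\<bar> < d1 \<Longrightarrow> \<bar>k s - k a\<bar> < \<kappa> / 3" "\<And>s. \<bar>s - b\<bar> < d2 \<Longrightarrow> \<bar>k s - k b\<bar> < \<kappa> / 3"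
    using ab by force
  define \<eta> where "\<eta> = min d1 d2 / 2"
  have \<eta>: "\<eta> > 0" "\<eta> < d1" "\<eta> < d2" using d(1,2) by (auto simp: \<eta>_def min_def)
  define \<phi> where "\<phi> s = smooth_step ((s - a) / \<eta>) - smooth_step ((s - b) / \<eta>)" for s
  define p where "p = step_density \<eta>"
  note p_nonneg = step_density_nonneg[OF \<eta>(1), folded p_def]
    and p_zero = step_density_zero[OF \<eta>(1), folded p_def]
    and contp = step_density_continuous[OF \<eta>(1), folded p_def]
  have smooth\<phi>: "smooth \<phi>" unfolding \<phi>_def by (rule smooth_diff[OF smooth_scaled_step smooth_scaled_step])
  have D\<phi>: "(\<phi> has_real_derivative p a s - p b s) (at s)" for s
    unfolding \<phi>_def p_def by (intro DERIV_diff scaled_step_DERIV)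
  have deriv\<phi>: "deriv \<phi> s = p a s - p b s" for s using D\<phi> by (rule DERIV_imp_deriv)
  define e where "e = b + \<eta>"
  have \<phi>_zero: "\<phi> s = 0" if "s \<notin> {a..e}" for s
    using that \<eta>(1) ab by (auto simp: \<phi>_def e_def smooth_step_0 smooth_step_1 field_simps)
  have \<phi>_nonneg: "\<phi> s \<ge> 0" for s
    using \<eta>(1) ab by (auto simp: \<phi>_def intro!: smooth_step_mono divide_right_mono)
  have clos: "closure {x. \<phi> x \<noteq> 0} \<subseteq> {a..e}" 
  proof (rule closure_minimal)
    show "{x. \<phi> x \<noteq> 0} \<subseteq> {a..e}" using \<phi>_zero by blast
  qed simp
  have test: "test_function {0<..} \<phi>"
    unfolding test_function_def
  proof (intro conjI)
    show "\<forall>k. C_k k \<phi>" using smooth\<phi> by (simp add: smooth_def)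
    show "compact (closure {x. \<phi> x \<noteq> 0})"
      using clos bounded_subset[OF bounded_closed_interval] by (auto simp: compact_eq_bounded_closed)
    show "closure {x. \<phi> x \<noteq> 0} \<subseteq> {0<..}" using clos ab by force
  qed
  have dz: "p a s - p b s = 0" if "s \<notin> {a..e}" for s
    using that p_zero[of s a] p_zero[of s b] ab by (auto simp: e_def)
  note cont\<phi> = smooth_continuous_on[OF smooth\<phi>]
  have ct: "continuous_on {0<..} (\<lambda>s. \<tau> s * (p a s - p b s))" "continuous_on {0<..} (\<lambda>s. c * \<phi> s)"
    using contk(2) by (auto intro!: continuous_intros contp cont\<phi>)
  have i\<tau>: "integral\<^sup>L (lebesgue_on {0<..}) (\<lambda>t. \<tau> t * deriv \<phi> t) = integral {a..e} (\<lambda>s. \<tau> s * (p a s - p b s))"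
    "(\<lambda>s. \<tau> s * (p a s - p b s)) integrable_on {a..e}"
    unfolding deriv\<phi> by (rule integral_compact_support[OF ct(1)]; use ab dz in simp)+
  have i\<phi>: "integrable (lebesgue_on {0<..}) (\<lambda>t. c * \<phi> t)"
    "integral\<^sup>L (lebesgue_on {0<..}) (\<lambda>t. c * \<phi> t) = integral {a..e} (\<lambda>s. c * \<phi> s)"
    using integral_compact_support[OF ct(2), of a e] ab \<phi>_zero by auto
  have "integrable (lebesgue_on {0<..}) (\<lambda>t. \<tau>' t * \<phi> t)"
  proof -
    have L: "Linf_loc {0<..} \<tau>'" using W by (simp add: W1inf_loc_def)
    have "compact {a..e}" "{a..e} \<subseteq> {0<..}" using ab by auto
    with L obtain B where B: "AE x in lebesgue_on {a..e}. \<bar>\<tau>' x\<bar> \<le> B"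
      unfolding Linf_loc_def by blast
    show ?thesis
    proof (rule integrableI_bounded_set[where A="{a..e}" and B="\<bar>B\<bar> * 1"])
      show "{a..e} \<in> sets (lebesgue_on {0<..})"
        using \<open>{a..e} \<subseteq> {0<..}\<close> by (auto simp: sets_restrict_space_iff)
      show "emeasure (lebesgue_on {0<..}) {a..e} < \<infinity>"
        using \<open>{a..e} \<subseteq> {0<..}\<close> by (subst emeasure_restrict_space) (auto simp: emeasure_lborel_Icc_eq)
      have "\<phi> \<in> borel_measurable (lebesgue_on {0<..})"
        using cont\<phi> by (intro continuous_imp_measurable_on_sets_lebesgue) auto
      then show "(\<lambda>t. \<tau>' t * \<phi> t) \<in> borel_measurable (lebesgue_on {0<..})"
        using L by (intro borel_measurable_times) (auto simp: Linf_loc_def)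
      have "AE x in lebesgue. x \<in> {a..e} \<longrightarrow> \<bar>\<tau>' x\<bar> \<le> B"
        using B by (subst (asm) AE_restrict_space_iff) auto
      then have "AE x in lebesgue_on {0<..}. x \<in> {a..e} \<longrightarrow> \<bar>\<tau>' x\<bar> \<le> B"
        by (subst AE_restrict_space_iff) auto
      then show "AE x in lebesgue_on {0<..}. x \<in> {a..e} \<longrightarrow> norm (\<tau>' x * \<phi> x) \<le> \<bar>B\<bar> * 1"
      proof (eventually_elim, intro impI)
        fix x assume "x \<in> {a..e} \<longrightarrow> \<bar>\<tau>' x\<bar> \<le> B" "x \<in> {a..e}"
        moreover have "\<bar>\<phi> x\<bar> \<le> 1"
          using \<phi>_nonneg[of x] smooth_step_bounds(2)[of "(x - a) / \<eta>"] smooth_step_bounds(1)[of "(x - b) / \<eta>"]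
          unfolding \<phi>_def by linarith
        ultimately show "norm (\<tau>' x * \<phi> x) \<le> \<bar>B\<bar> * 1"
          unfolding real_norm_def abs_mult by (intro mult_mono) auto
      qed
    qed (use \<phi>_zero in \<open>auto intro!: AE_I2\<close>)
  qed
  moreover have "AE t in lebesgue_on {0<..}. \<tau>' t * \<phi> t \<le> c * \<phi> t"
    using le by eventually_elim (intro mult_right_mono \<phi>_nonneg)
  ultimately have "integral\<^sup>L (lebesgue_on {0<..}) (\<lambda>t. \<tau>' t * \<phi> t) \<le> integral\<^sup>L (lebesgue_on {0<..}) (\<lambda>t. c * \<phi> t)"
    using i\<phi>(1) by (intro integral_mono_AE)
  moreover have "integral\<^sup>L (lebesgue_on {0<..}) (\<lambda>t. \<tau> t * deriv \<phi> t)
      = - integral\<^sup>L (lebesgue_on {0<..}) (\<lambda>t. \<tau>' t * \<phi> t)"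
    using W test by (simp add: W1inf_loc_def set_lebesgue_integral_def integral_restrict_space)
  ultimately have 1: "integral {a..e} (\<lambda>s. \<tau> s * (p a s - p b s)) + integral {a..e} (\<lambda>s. c * \<phi> s) \<ge> 0"
    using i\<tau>(1) i\<phi>(2) by linarith
  have ae: "a \<le> e" using ab \<eta> by (simp add: e_def)
  \<comment> \<open>The integrand is the derivative of \<open>c s \<phi>(s)\<close>: this is the integration by parts for \<open>\<integral> c \<phi>\<close>.\<close>
  have "((\<lambda>s. c * \<phi> s + c * s * (p a s - p b s)) has_integral (c * e * \<phi> e - c * a * \<phi> a)) {a..e}"
    using D\<phi> by (intro fundamental_theorem_of_calculus[OF ae])
      (auto intro!: derivative_eq_intros DERIV_subset[OF D\<phi>] simp: has_real_derivative_iff_has_vector_derivative[symmetric])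
  moreover have "\<phi> e = 0" "\<phi> a = 0"
    using \<eta>(1) ab by (auto simp: \<phi>_def e_def smooth_step_0 smooth_step_1 field_simps)
  ultimately have 2: "((\<lambda>s. c * \<phi> s + c * s * (p a s - p b s)) has_integral 0) {a..e}" by simp
  have ic: "(\<lambda>s. c * \<phi> s) integrable_on {a..e}"
    by (intro integrable_continuous_real continuous_intros cont\<phi>)
  have "((\<lambda>s. \<tau> s * (p a s - p b s) + c * \<phi> s - (c * \<phi> s + c * s * (p a s - p b s))) has_integral
    (integral {a..e} (\<lambda>s. \<tau> s * (p a s - p b s)) + integral {a..e} (\<lambda>s. c * \<phi> s) - 0)) {a..e}"
    by (intro has_integral_diff has_integral_add integrable_integral i\<tau>(2) ic 2)
  then have 3: "((\<lambda>s. k s * (p a s - p b s)) has_integral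
    (integral {a..e} (\<lambda>s. \<tau> s * (p a s - p b s)) + integral {a..e} (\<lambda>s. c * \<phi> s))) {a..e}"
    by (simp add: k_def algebra_simps)
  have Ip: "(p x has_integral 1) {a..e}" if "x = a \<or> x = b" for x
    unfolding p_def using that ab \<eta>(1) by (intro step_density_has_integral) (auto simp: e_def)
  have 4: "((\<lambda>s. (k a + \<kappa> / 3) * p a s - (k b - \<kappa> / 3) * p b s) has_integral
      ((k a + \<kappa> / 3) * 1 - (k b - \<kappa> / 3) * 1)) {a..e}"
    by (intro has_integral_diff has_integral_mult_right Ip) auto
  have "k s * (p a s - p b s) \<le> (k a + \<kappa> / 3) * p a s - (k b - \<kappa> / 3) * p b s" for s
  proof -
    have "k s \<le> k a + \<kappa> / 3" if "s \<in> {a..a + \<eta>}"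
      using d(3)[of s] that \<eta> unfolding atLeastAtMost_iff by arith
    then have "k s * p a s \<le> (k a + \<kappa> / 3) * p a s"
      using p_zero[of s a] p_nonneg[of a s] \<eta>
      by (cases "s \<in> {a..a + \<eta>}") (auto intro!: mult_right_mono)
    moreover have "k s \<ge> k b - \<kappa> / 3" if "s \<in> {b..b + \<eta>}"
      using d(4)[of s] that \<eta> unfolding atLeastAtMost_iff by arith
    then have "k s * p b s \<ge> (k b - \<kappa> / 3) * p b s"
      using p_zero[of s b] p_nonneg[of b s] \<eta>
      by (cases "s \<in> {b..b + \<eta>}") (auto intro!: mult_right_mono)
    ultimately show ?thesis by (simp add: algebra_simps)
  qed
  from order_trans[OF 1 has_integral_le[OF 3 4 this]] have "0 \<le> 2 * \<kappa> / 3 - \<kappa>"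
    by (simp add: \<kappa>_def field_simps)
  then show False using \<kappa> by simp
qed

text \<open>Since \<open>c < 1\<close>, the delayed time never falls below the beginning of the initial interval; otherwise the
  velocity field would depend on values of the curve about which the initial data say nothing.\<close>

lemma delayed_time_ge:
  assumes W: "W1inf_loc {0<..} \<tau> \<tau>'" and cont: "continuous_on {0..} \<tau>"
    and le: "AE t in lebesgue_on {0<..}. \<tau>' t \<le> c" and c: "c < 1" and t: "t \<ge> 0"
  shows "t - \<tau> t \<ge> - \<tau> 0"
proof (cases "t = 0")
  case False
  have "((\<lambda>a. \<tau> a - c * a) \<longlongrightarrow> \<tau> 0 - c * 0) (at 0 within {0..})"
    using cont by (intro tendsto_intros) (auto simp: continuous_on_def)
  then have "((\<lambda>a. \<tau> a - c * a) \<longlongrightarrow> \<tau> 0 - c * 0) (at_right 0)"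
    by (rule filterlim_mono) (auto intro: at_le)
  moreover have "\<forall>\<^sub>F a in at_right 0. a < t" using False t by (intro eventually_at_rightI[of 0 t]) auto
  then have "\<forall>\<^sub>F a in at_right 0. \<tau> t - c * t \<le> \<tau> a - c * a"
    using eventually_at_right_less[of 0]
    by eventually_elim (rule weak_derivative_bound_imp_increment_bound[OF W cont le])
  ultimately have "\<tau> t - c * t \<le> \<tau> 0 - c * 0"
    by (rule tendsto_lowerbound) simp
  moreover have "c * t \<le> 1 * t" using c t by (intro mult_right_mono) auto
  ultimately show ?thesis by simp
qed simp

section \<open>Flows of Lipschitz velocity fields\<close>

text \<open>Picard iteration converges on the whole interval at once in the weighted supremum norm
  \<open>sup exp (- K t) |X t|\<close> with \<open>K > 2 L\<close>. The fixed point \<open>u\<close> below is \<open>exp (- K t) X(t)\<close>, so that the weight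
  disappears from the norm of the function space; outside \<open>[0, T]\<close> it is extended by its boundary values.\<close>

lemma picard_lindelof:
  fixes w :: "real \<Rightarrow> 'a::euclidean_space \<Rightarrow> 'a"
  assumes T: "0 \<le> T" and cont: "continuous_on ({0..T} \<times> UNIV) (\<lambda>(t, x). w t x)"
    and lip: "\<And>t x y. t \<in> {0..T} \<Longrightarrow> norm (w t x - w t y) \<le> L * norm (x - y)"
  obtains X where "X 0 = z"
    "\<And>t. t \<in> {0..T} \<Longrightarrow> (X has_vector_derivative w t (X t)) (at t within {0..T})"
proof -
  define K where "K = 2 * (\<bar>L\<bar> + 1)"
  have K: "K > 0" "\<bar>L\<bar> / K \<le> 1 / 2" by (auto simp: K_def field_simps)
  define J where "J u r = w r (exp (K * r) *\<^sub>R apply_bcontfun u r)" for u :: "real \<Rightarrow>\<^sub>C 'a" and r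
  define I where "I u t = z + integral {0..t} (J u)" for u t
  have contJ: "continuous_on {0..T} (J u)" for u
  proof -
    have "continuous_on {0..T} (\<lambda>r. (r, exp (K * r) *\<^sub>R apply_bcontfun u r))"
      by (intro continuous_intros) auto
    from continuous_on_compose2[OF cont this] show ?thesis by (simp add: J_def[abs_def] image_subset_iff)
  qed
  have intJ: "J u integrable_on {0..t}" if "t \<in> {0..T}" for u t
    using that by (intro integrable_continuous_real continuous_on_subset[OF contJ]) auto
  have derivI: "(I u has_vector_derivative J u t) (at t within {0..T})" if "t \<in> {0..T}" for u t
    unfolding I_def using integral_has_vector_derivative[OF contJ that, of u]
    by (auto intro!: derivative_eq_intros)
  have contI: "continuous_on {0..T} (I u)" for u
    using derivI by (intro continuous_on_vector_derivative) auto
  have "\<exists>g. \<forall>s. apply_bcontfun g s = exp (- K * clamp 0 T s) *\<^sub>R I u (clamp 0 T s)" for u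
  proof -
    have "continuous_on (cbox 0 T) (\<lambda>s. exp (- K * s) *\<^sub>R I u s)"
      unfolding cbox_interval by (rule continuous_on_scaleR[OF _ contI]) (intro continuous_intros)
    then show ?thesis by (rule continuous_on_cbox_bcontfunE) (rule exI, rule allI)
  qed
  then obtain \<Phi> where \<Phi>: "\<And>u s. apply_bcontfun (\<Phi> u) s = exp (- K * clamp 0 T s) *\<^sub>R I u (clamp 0 T s)"
    by metis
  have contr: "dist (\<Phi> u) (\<Phi> v) \<le> 1 / 2 * dist u v" for u v
  proof (rule dist_bound)
    fix s0 :: real
    define s where "s = clamp 0 T s0"
    have s: "s \<in> {0..T}" using clamp_in_interval[of 0 T s0] T by (auto simp: s_def)
    define D where "D = dist u v"
    have "((\<lambda>r. \<bar>L\<bar> * D * exp (K * r)) has_integral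
        (\<bar>L\<bar> * D / K * exp (K * s) - \<bar>L\<bar> * D / K * exp (K * 0))) {0..s}"
      using s K by (intro fundamental_theorem_of_calculus)
        (auto intro!: derivative_eq_intros simp: has_real_derivative_iff_has_vector_derivative[symmetric])
    then have hi: "((\<lambda>r. \<bar>L\<bar> * D * exp (K * r)) has_integral (\<bar>L\<bar> * D / K * (exp (K * s) - 1))) {0..s}"
      by (simp add: right_diff_distrib)
    have "norm (I u s - I v s) = norm (integral {0..s} (\<lambda>r. J u r - J v r))"
      using intJ[OF s] by (simp add: I_def Henstock_Kurzweil_Integration.integral_diff)
    also have "\<dots> \<le> integral {0..s} (\<lambda>r. \<bar>L\<bar> * D * exp (K * r))"
    proof (rule integral_norm_bound_integral)
      show "(\<lambda>r. J u r - J v r) integrable_on {0..s}"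
        using intJ[OF s] by (intro Henstock_Kurzweil_Integration.integrable_diff)
      show "(\<lambda>r. \<bar>L\<bar> * D * exp (K * r)) integrable_on {0..s}" using hi by blast
      fix r assume r: "r \<in> {0..s}"
      have "norm (J u r - J v r) \<le> L * norm (exp (K * r) *\<^sub>R (apply_bcontfun u r - apply_bcontfun v r))"
        unfolding J_def scaleR_diff_right using r s by (intro lip) auto
      also have "\<dots> \<le> \<bar>L\<bar> * (exp (K * r) * D)"
        using dist_bounded[of u r v]
        by (intro mult_mono) (auto simp: dist_norm D_def)
      finally show "norm (J u r - J v r) \<le> \<bar>L\<bar> * D * exp (K * r)" by (simp add: mult_ac)
    qed
    also have "\<dots> = \<bar>L\<bar> * D / K * (exp (K * s) - 1)" using hi by (rule integral_unique)
    also have "\<dots> \<le> \<bar>L\<bar> * D / K * exp (K * s)"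
      using K by (intro mult_left_mono) (auto simp: D_def)
    finally have "exp (- K * s) * norm (I u s - I v s) \<le> exp (- K * s) * (\<bar>L\<bar> * D / K * exp (K * s))"
      by (intro mult_left_mono) auto
    also have "\<dots> = \<bar>L\<bar> / K * D" by (simp add: exp_minus field_simps)
    also have "\<dots> \<le> 1 / 2 * D" using K by (intro mult_right_mono) (auto simp: D_def)
    finally show "dist (apply_bcontfun (\<Phi> u) s0) (apply_bcontfun (\<Phi> v) s0) \<le> 1 / 2 * dist u v"
      by (simp add: \<Phi> dist_norm s_def[symmetric] D_def scaleR_diff_right[symmetric])
  qed
  obtain u where u: "\<Phi> u = u"
    using banach_fix_type[of "1/2" \<Phi>] contr by auto
  have "exp (K * t) *\<^sub>R apply_bcontfun u t = I u t" if "t \<in> {0..T}" for t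
  proof -
    have "apply_bcontfun u t = exp (- K * t) *\<^sub>R I u t"
      using \<Phi>[of u t] u that by simp
    then show ?thesis by (simp add: exp_minus)
  qed
  then have "J u t = w t (I u t)" if "t \<in> {0..T}" for t
    using that by (simp add: J_def)
  then show thesis using derivI[of _ u] by (intro that[of "I u"]) (auto simp: I_def)
qed

lemma nonincreasing_of_deriv_within:
  fixes f :: "real \<Rightarrow> real"
  assumes "\<And>t. t \<in> {0..T} \<Longrightarrow> (f has_real_derivative f' t) (at t within {0..T})"
    and "\<And>t. t \<in> {0..T} \<Longrightarrow> f' t \<le> 0" and t: "t \<in> {0..T}"
  shows "f t \<le> f 0"
proof (rule DERIV_nonpos_imp_decreasing_open[of 0 t f])
  show "0 \<le> t" using t by simp
  fix x assume "0 < x" "x < t"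
  then show "\<exists>y. (f has_real_derivative y) (at x) \<and> y \<le> 0"
    using assms(1)[of x] assms(2)[of x] t by (auto simp: at_within_Icc_at)
next
  have "continuous_on {0..T} f" using assms(1) by (rule DERIV_continuous_on)
  then show "continuous_on {0..t} f" by (rule continuous_on_subset) (use t in auto)
qed

lemma DERIV_norm_square:
  fixes X :: "real \<Rightarrow> 'a::real_inner"
  assumes "(X has_vector_derivative X') (at t within S)"
  shows "((\<lambda>t. (norm (X t))\<^sup>2) has_real_derivative 2 * (X t \<bullet> X')) (at t within S)"
proof -
  have "((\<lambda>t. X t \<bullet> X t) has_derivative (\<lambda>h. X t \<bullet> (h *\<^sub>R X') + (h *\<^sub>R X') \<bullet> X t)) (at t within S)"
    using assms unfolding has_vector_derivative_def by (intro has_derivative_inner)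
  moreover have "(\<lambda>h. X t \<bullet> (h *\<^sub>R X') + (h *\<^sub>R X') \<bullet> X t) = (*) (2 * (X t \<bullet> X'))"
    by (auto simp: fun_eq_iff inner_commute)
  ultimately show ?thesis
    by (simp add: has_field_derivative_def power2_norm_eq_inner)
qed

text \<open>Gronwall's inequality for \<open>|X - Y|\<^sup>2 + \<delta>\<^sup>2\<close>: unlike the distance itself it is differentiable, and including \<open>\<delta>\<^sup>2\<close>
  makes the differential inequality homogeneous.\<close>

lemma flow_stability:
  fixes X Y :: "real \<Rightarrow> 'a::real_inner"
  assumes X: "\<And>t. t \<in> {0..T} \<Longrightarrow> (X has_vector_derivative X' t) (at t within {0..T})"
    and Y: "\<And>t. t \<in> {0..T} \<Longrightarrow> (Y has_vector_derivative Y' t) (at t within {0..T})"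
    and le: "\<And>t. t \<in> {0..T} \<Longrightarrow> norm (X' t - Y' t) \<le> L * norm (X t - Y t) + \<delta>"
    and "L \<ge> 0" "\<delta> \<ge> 0" and t: "t \<in> {0..T}"
  shows "norm (X t - Y t) \<le> exp ((2 * L + 1) * T) * (norm (X 0 - Y 0) + \<delta>)"
proof -
  define M where "M = 2 * L + 1"
  define q where "q t = (norm (X t - Y t))\<^sup>2 + \<delta>\<^sup>2" for t
  have q: "(q has_real_derivative 2 * ((X t - Y t) \<bullet> (X' t - Y' t))) (at t within {0..T})" if "t \<in> {0..T}" for t
    unfolding q_def using DERIV_norm_square[OF has_vector_derivative_diff[OF X[OF that] Y[OF that]]]
    using DERIV_add[OF _ DERIV_const] by fastforce
  have q': "2 * ((X t - Y t) \<bullet> (X' t - Y' t)) \<le> M * q t" if "t \<in> {0..T}" for t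
  proof -
    define d where "d = norm (X t - Y t)"
    have "(X t - Y t) \<bullet> (X' t - Y' t) \<le> d * norm (X' t - Y' t)"
      unfolding d_def by (rule norm_cauchy_schwarz)
    also have "\<dots> \<le> d * (L * d + \<delta>)" using le[OF that] by (intro mult_left_mono) (auto simp: d_def)
    finally have "2 * ((X t - Y t) \<bullet> (X' t - Y' t)) \<le> 2 * L * d\<^sup>2 + 2 * d * \<delta>"
      by (simp add: algebra_simps power2_eq_square)
    also have "2 * d * \<delta> \<le> d\<^sup>2 + \<delta>\<^sup>2" by (rule sum_squares_bound)
    also have "2 * L * d\<^sup>2 + (d\<^sup>2 + \<delta>\<^sup>2) \<le> M * (d\<^sup>2 + \<delta>\<^sup>2)"
      using \<open>L \<ge> 0\<close> by (simp add: M_def algebra_simps)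
    finally show ?thesis by (simp add: q_def d_def)
  qed
  have "exp (- M * t) * q t \<le> exp (- M * 0) * q 0"
  proof (rule nonincreasing_of_deriv_within[where f="\<lambda>t. exp (- M * t) * q t", OF _ _ t])
    fix s assume s: "s \<in> {0..T}"
    show "((\<lambda>t. exp (- M * t) * q t) has_real_derivative
        exp (- M * s) * (2 * ((X s - Y s) \<bullet> (X' s - Y' s)) - M * q s)) (at s within {0..T})"
      by (rule derivative_eq_intros q[OF s] refl | simp)+ (simp add: algebra_simps)
    show "exp (- M * s) * (2 * ((X s - Y s) \<bullet> (X' s - Y' s)) - M * q s) \<le> 0"
      using q'[OF s] by (intro mult_nonneg_nonpos) auto
  qed
  then have "exp (M * t) * (exp (- M * t) * q t) \<le> exp (M * t) * q 0" by (intro mult_left_mono) auto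
  then have "q t \<le> exp (M * t) * q 0"
    by (subst (asm) mult.assoc[symmetric]) (simp only: exp_add[symmetric], simp)
  also have "\<dots> \<le> exp (M * T) * q 0"
    using t \<open>L \<ge> 0\<close> by (intro mult_right_mono) (auto simp: M_def q_def)
  also have "\<dots> \<le> (exp (M * T))\<^sup>2 * (norm (X 0 - Y 0) + \<delta>)\<^sup>2"
  proof (rule mult_mono)
    have "exp (M * T) \<ge> 1" using t \<open>L \<ge> 0\<close> by (simp add: M_def)
    then show "exp (M * T) \<le> (exp (M * T))\<^sup>2" by (simp add: power2_eq_square)
    show "q 0 \<le> (norm (X 0 - Y 0) + \<delta>)\<^sup>2"
      using \<open>\<delta> \<ge> 0\<close> by (simp add: q_def power2_sum)
  qed (auto simp: q_def)
  finally have "(norm (X t - Y t))\<^sup>2 \<le> (exp (M * T) * (norm (X 0 - Y 0) + \<delta>))\<^sup>2"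
    unfolding q_def power_mult_distrib using zero_le_power2[of \<delta>] by linarith
  then show ?thesis unfolding M_def
    by (rule power2_le_imp_le) (use \<open>\<delta> \<ge> 0\<close> in auto)
qed

lemma DERIV_pos_part_square: "((\<lambda>r. (max 0 r)\<^sup>2) has_real_derivative 2 * max 0 r) (at (r::real))"
proof -
  consider "r < 0" | "r = 0" | "r > 0" by linarith
  then show ?thesis
  proof cases
    case 1
    have "((\<lambda>r. (max 0 r)\<^sup>2) has_real_derivative 0) (at r)"
      by (rule has_field_derivative_transform_within_open[of "\<lambda>r. 0" _ _ "{..<0}"]) (use 1 in auto)
    then show ?thesis using 1 by simp
  next
    case 3
    have "((\<lambda>r::real. r\<^sup>2) has_real_derivative 2 * r) (at r)" by (auto intro!: derivative_eq_intros)
    then have "((\<lambda>r. (max 0 r)\<^sup>2) has_real_derivative 2 * r) (at r)"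
      by (rule has_field_derivative_transform_within_open[of _ _ _ "{0<..}"]) (use 3 in auto)
    then show ?thesis using 3 by simp
  next
    case 2
    have "((\<lambda>h::real. (max 0 h)\<^sup>2 / h) \<longlongrightarrow> 0) (at 0)"
    proof (rule Lim_null_comparison)
      show "\<forall>\<^sub>F h in at 0. norm ((max 0 h)\<^sup>2 / h) \<le> \<bar>h::real\<bar>"
        by (auto simp: eventually_at_filter max_def power2_eq_square)
      show "((\<lambda>h::real. \<bar>h\<bar>) \<longlongrightarrow> 0) (at 0)"
        using tendsto_rabs_zero[OF tendsto_ident_at] by simp
    qed
    then show ?thesis using 2 by (simp add: DERIV_def)
  qed
qed

text \<open>The squared positive part of \<open>|X - x\<^sub>0|\<^sup>2 - R\<^sup>2\<close> is continuously differentiable, starts at zero and cannot increase,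
  because outside the ball the velocity does not point outwards.\<close>

lemma inward_field_ball_invariant:
  fixes X :: "real \<Rightarrow> 'a::real_inner"
  assumes X: "\<And>t. t \<in> {0..T} \<Longrightarrow> (X has_vector_derivative X' t) (at t within {0..T})"
    and inward: "\<And>t. t \<in> {0..T} \<Longrightarrow> norm (X t - x0) \<ge> R \<Longrightarrow> (X t - x0) \<bullet> X' t \<le> 0"
    and start: "X 0 \<in> cball x0 R" and t: "t \<in> {0..T}" and R: "R \<ge> 0"
  shows "X t \<in> cball x0 R"
proof -
  define m where "m t = (norm (X t - x0))\<^sup>2 - R\<^sup>2" for t
  have "(max 0 (m t))\<^sup>2 \<le> (max 0 (m 0))\<^sup>2"
  proof (rule nonincreasing_of_deriv_within[where f="\<lambda>t. (max 0 (m t))\<^sup>2", OF _ _ t])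
    fix s assume s: "s \<in> {0..T}"
    have "(m has_real_derivative 2 * ((X s - x0) \<bullet> X' s)) (at s within {0..T})"
      unfolding m_def
      using DERIV_norm_square[OF has_vector_derivative_diff[OF X[OF s] has_vector_derivative_const[of x0]]]
      using DERIV_diff[OF _ DERIV_const[of "R\<^sup>2"]] by fastforce
    then show "((\<lambda>t. (max 0 (m t))\<^sup>2) has_real_derivative 2 * max 0 (m s) * (2 * ((X s - x0) \<bullet> X' s)))
        (at s within {0..T})"
      by (rule DERIV_chain2[OF DERIV_pos_part_square])
    show "2 * max 0 (m s) * (2 * ((X s - x0) \<bullet> X' s)) \<le> 0"
    proof (cases "norm (X s - x0) \<ge> R")
      case True
      then show ?thesis using inward[OF s] by (intro mult_nonneg_nonpos) auto
    next
      case False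
      then have "(norm (X s - x0))\<^sup>2 \<le> R\<^sup>2" by (intro power_mono) auto
      then show ?thesis by (simp add: m_def)
    qed
  qed
  also have "m 0 \<le> 0" using start R by (simp add: m_def dist_norm norm_minus_commute power_mono)
  finally have "max 0 (m t) = 0" by simp
  then have "(norm (X t - x0))\<^sup>2 \<le> R\<^sup>2" by (simp add: m_def max_def split: if_splits)
  then show ?thesis using R by (simp add: dist_norm norm_minus_commute)
qed

lemma closest_point_cball_radial:
  fixes x x0 :: "'a::euclidean_space"
  assumes "R > 0" "norm (x - x0) \<ge> R"
  shows "closest_point (cball x0 R) x = x0 + (R / norm (x - x0)) *\<^sub>R (x - x0)"
proof (rule closest_point_unique[symmetric])
  define p where "p = x0 + (R / norm (x - x0)) *\<^sub>R (x - x0)"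
  have n0: "norm (x - x0) > 0" using assms by linarith
  show "x0 + (R / norm (x - x0)) *\<^sub>R (x - x0) \<in> cball x0 R"
    using assms n0 by (simp add: dist_norm)
  have "x - p = (1 - R / norm (x - x0)) *\<^sub>R (x - x0)" by (simp add: p_def algebra_simps)
  then have "dist x p = norm (x - x0) - R"
    using assms n0 by (simp add: dist_norm abs_if left_diff_distrib)
  moreover have "dist x z \<ge> norm (x - x0) - R" if "z \<in> cball x0 R" for z
    using that norm_triangle_ineq2[of "x - x0" "z - x0"] by (simp add: dist_norm norm_minus_commute)
  ultimately show "\<forall>z\<in>cball x0 R. dist x (x0 + (R / norm (x - x0)) *\<^sub>R (x - x0)) \<le> dist x z"
    by (simp add: p_def)
qed auto

section \<open>Transport costs\<close>

text \<open>The quantity minimised in the Wasserstein distance, for finite and infinite exponents alike.\<close>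

definition transport_cost :: "ennreal \<Rightarrow> ('a::metric_space \<times> 'a) measure \<Rightarrow> ennreal" where
  "transport_cost p \<pi> =
     (if p = \<infinity> then SUP (x, y)\<in>measure_support \<pi>. ennreal (dist x y)
      else ennreal_root (enn2real p) (\<integral>\<^sup>+(x, y). ennreal (dist x y powr enn2real p) \<partial>\<pi>))"

lemma transport_cost_finite_exponent:
  assumes "p \<ge> 1" "p \<noteq> \<infinity>"
  obtains q where "q \<ge> 1" "\<And>\<pi> :: ('a::metric_space \<times> 'a) measure. transport_cost p \<pi>
    = ennreal_root q (\<integral>\<^sup>+w. ennreal (dist (fst w) (snd w) powr q) \<partial>\<pi>)"
proof (rule that[of "enn2real p"])
  show "enn2real p \<ge> 1" using assms
    by (metis enn2real_1 enn2real_mono infinity_ennreal_def top.not_eq_extremum)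
qed (use assms(2) in \<open>simp add: transport_cost_def case_prod_unfold\<close>)

lemma wasserstein_eq_INF_cost: "wasserstein p \<mu> \<nu> = (INF \<pi>\<in>couplings \<mu> \<nu>. transport_cost p \<pi>)"
  by (simp add: wasserstein_def transport_cost_def)

lemma prob_measuresD:
  assumes "\<mu> \<in> prob_measures"
  shows "prob_space \<mu>" "sets \<mu> = sets borel" "space \<mu> = UNIV"
  using assms sets_eq_imp_space_eq[of \<mu> borel] by (auto simp: prob_measures_def)

lemma measurable_continuous:
  assumes "\<mu> \<in> prob_measures" "continuous_on UNIV f" shows "f \<in> \<mu> \<rightarrow>\<^sub>M borel"
  using borel_measurable_continuous_onI[OF assms(2)] prob_measuresD(2)[OF assms(1)]
  by (simp cong: measurable_cong_sets)

text \<open>In a second countable space the complement of the support is a countable union of basic open null sets.\<close>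

lemma AE_measure_support:
  fixes \<mu> :: "'a::second_countable_topology measure"
  assumes "\<mu> \<in> prob_measures"
  shows "AE x in \<mu>. x \<in> measure_support \<mu>"
proof -
  obtain B :: "'a set set" where B: "countable B" "topological_basis B"
    using ex_countable_basis by blast
  define N where "N = {U\<in>B. emeasure \<mu> U = 0}"
  have "\<Union>N \<in> null_sets \<mu>"
  proof (rule null_sets_UN'[of N "\<lambda>U. U", simplified])
    show "countable N" using B(1) by (auto simp: N_def)
    show "U \<in> null_sets \<mu>" if "U \<in> N" for U
      using that prob_measuresD(2)[OF assms] topological_basis_open[OF B(2)]
      by (auto simp: N_def null_sets_def)
  qed
  moreover have "{x\<in>space \<mu>. x \<notin> measure_support \<mu>} \<subseteq> \<Union>N"
  proof safe
    fix x assume "x \<notin> measure_support \<mu>"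
    then obtain U where U: "open U" "x \<in> U" "emeasure \<mu> U = 0"
      by (auto simp: measure_support_def)
    obtain V where V: "V \<in> B" "x \<in> V" "V \<subseteq> U"
      using topological_basisE[OF B(2) U(1,2)] by blast
    have "emeasure \<mu> V \<le> emeasure \<mu> U"
      using V U prob_measuresD(2)[OF assms] by (intro emeasure_mono) auto
    then show "x \<in> \<Union>N" using V U by (auto simp: N_def)
  qed
  ultimately show ?thesis using AE_I[of \<mu> "\<lambda>x. x \<in> measure_support \<mu>" "\<Union>N"] by (auto simp: null_sets_def)
qed

lemma measure_support_AE_closed:
  assumes "\<mu> \<in> prob_measures" "closed C" "AE x in \<mu>. x \<in> C"
  shows "measure_support \<mu> \<subseteq> C"
proof
  fix x assume x: "x \<in> measure_support \<mu>"
  show "x \<in> C"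
  proof (rule ccontr)
    assume "x \<notin> C"
    then have "emeasure \<mu> (- C) > 0" using x assms(2) by (auto simp: measure_support_def open_closed)
    moreover have "emeasure \<mu> (- C) = 0"
      using assms(2,3) prob_measuresD[OF assms(1)]
      by (subst (asm) AE_iff_measurable[of "- C"]) auto
    ultimately show False by simp
  qed
qed

lemma ennreal_root_le:
  assumes "x \<le> ennreal (r powr p)" "p \<ge> 1" "r \<ge> 0"
  shows "ennreal_root p x \<le> ennreal r"
proof -
  have "x < \<infinity>" using assms(1) by (rule order.strict_trans1) simp
  then obtain a where a: "x = ennreal a" "a \<ge> 0" by (cases x) auto
  have "a powr (1 / p) \<le> (r powr p) powr (1 / p)"
    using assms a by (intro powr_mono2) (auto simp: ennreal_le_iff)
  then show ?thesis using assms a by (simp add: ennreal_root_def powr_powr ennreal_leI)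
qed

lemma powr_superadditive:
  fixes u v q :: real
  assumes "u \<ge> 0" "v \<ge> 0" "q \<ge> 1"
  shows "u powr q + v powr q \<le> (u + v) powr q"
proof (cases "u = 0 \<or> v = 0")
  case False
  have *: "x powr q = x * x powr (q - 1)" if "x > 0" for x :: real
    using powr_add[of x 1 "q - 1"] that by simp
  have "u powr q + v powr q \<le> u * (u + v) powr (q - 1) + v * (u + v) powr (q - 1)"
    using False assms by (subst (1 2) *) (auto intro!: add_mono mult_left_mono powr_mono2)
  also have "\<dots> = (u + v) powr q" using False assms by (subst *[of "u + v"]) (auto simp: algebra_simps)
  finally show ?thesis .
qed (use assms in auto)

text \<open>For finite exponents, splitting at a threshold \<open>s\<close> gives \<open>a \<le> s + a\<^sup>p / s\<^sup>p\<^sup>-\<^sup>1\<close> for \<open>a \<ge> 0\<close>; integrated with \<open>s\<close> equal to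
  the cost, both terms on the right become the cost. If the cost vanishes, \<open>s\<close> is arbitrarily small instead.\<close>

lemma mean_distance_le_cost:
  fixes \<pi> :: "('a::{metric_space,second_countable_topology} \<times> 'a) measure"
  assumes \<pi>: "\<pi> \<in> prob_measures" and p: "p \<ge> 1"
  shows "(\<integral>\<^sup>+w. ennreal (dist (fst w) (snd w)) \<partial>\<pi>) \<le> 2 * transport_cost p \<pi>"
proof (cases "p = \<infinity>")
  case True
  interpret prob_space \<pi> using \<pi> by (rule prob_measuresD)
  have "AE w in \<pi>. ennreal (dist (fst w) (snd w)) \<le> transport_cost p \<pi>"
    using AE_measure_support[OF \<pi>]
  proof eventually_elim
    case (elim w)
    then show ?case using True
      by (auto simp: transport_cost_def case_prod_unfold intro!: SUP_upper2[of w])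
  qed
  then have "(\<integral>\<^sup>+w. ennreal (dist (fst w) (snd w)) \<partial>\<pi>) \<le> (\<integral>\<^sup>+w. transport_cost p \<pi> \<partial>\<pi>)"
    by (rule nn_integral_mono_AE)
  also have "\<dots> = transport_cost p \<pi>" by (simp add: emeasure_space_1)
  also have "\<dots> \<le> 2 * transport_cost p \<pi>"
    using mult_right_mono[of 1 2 "transport_cost p \<pi>"] by simp
  finally show ?thesis .
next
  case False
  interpret prob_space \<pi> using \<pi> by (rule prob_measuresD)
  have [measurable_cong]: "sets \<pi> = sets (borel \<Otimes>\<^sub>M borel)" using prob_measuresD(2)[OF \<pi>] by (simp only: borel_prod)
  obtain q where q: "q \<ge> 1" and cost_q: "\<And>\<pi> :: ('a \<times> 'a) measure. transport_cost p \<pi>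
      = ennreal_root q (\<integral>\<^sup>+w. ennreal (dist (fst w) (snd w) powr q) \<partial>\<pi>)"
    using transport_cost_finite_exponent[OF p False] by metis
  define A where "A = (\<integral>\<^sup>+w. ennreal (dist (fst w) (snd w) powr q) \<partial>\<pi>)"
  have cost: "transport_cost p \<pi> = ennreal_root q A" by (simp add: cost_q A_def)
  show ?thesis
  proof (cases "A = \<infinity>")
    case True
    then show ?thesis using cost by (simp add: ennreal_root_def ennreal_mult_top)
  next
    case False
    then obtain a where a: "A = ennreal a" "a \<ge> 0" by (cases A) auto
    have bound: "(\<integral>\<^sup>+w. ennreal (dist (fst w) (snd w)) \<partial>\<pi>) \<le> ennreal (s + s powr (1 - q) * a)" if s: "s > 0" for s
    proof -
      have "(\<integral>\<^sup>+w. ennreal (dist (fst w) (snd w)) \<partial>\<pi>)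
          \<le> (\<integral>\<^sup>+w. ennreal s + ennreal (s powr (1 - q)) * ennreal (dist (fst w) (snd w) powr q) \<partial>\<pi>)"
      proof (rule nn_integral_mono)
        fix w
        define d where "d = dist (fst w) (snd w)"
        have "d \<le> s + s powr (1 - q) * d powr q"
        proof (cases "d \<le> s")
          case False
          then have "d = d powr (1 - q) * d powr q" using s powr_add[of d "1 - q" q] by simp
          also have "\<dots> \<le> s powr (1 - q) * d powr q"
            using False s q by (intro mult_right_mono powr_mono2') auto
          finally show ?thesis using s by simp
        qed (simp add: add_increasing2)
        then show "ennreal (dist (fst w) (snd w)) \<le> ennreal s + ennreal (s powr (1 - q)) * ennreal (dist (fst w) (snd w) powr q)"
          using s by (simp add: d_def ennreal_mult[symmetric] ennreal_plus[symmetric] ennreal_leI del: ennreal_plus)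
      qed
      also have "\<dots> = ennreal s + ennreal (s powr (1 - q)) * A"
        by (subst nn_integral_add) (auto simp: nn_integral_cmult A_def emeasure_space_1)
      also have "\<dots> = ennreal (s + s powr (1 - q) * a)"
        using a s by (simp add: ennreal_mult)
      finally show ?thesis .
    qed
    show ?thesis
    proof (cases "a = 0")
      case True
      have "(\<integral>\<^sup>+w. ennreal (dist (fst w) (snd w)) \<partial>\<pi>) \<le> 0"
      proof (rule ennreal_le_epsilon)
        fix e :: real assume "e > 0"
        then show "(\<integral>\<^sup>+w. ennreal (dist (fst w) (snd w)) \<partial>\<pi>) \<le> 0 + ennreal e"
          using bound[of e] True by simp
      qed
      then show ?thesis by simp
    next
      case False
      define s where "s = a powr (1 / q)"
      have s: "s > 0" using False a by (simp add: s_def)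
      have "s powr (1 - q) * a = s powr (1 - q) * s powr q"
        using q a False by (simp add: s_def powr_powr)
      also have "\<dots> = s" using s by (simp add: powr_add[symmetric])
      finally have "(\<integral>\<^sup>+w. ennreal (dist (fst w) (snd w)) \<partial>\<pi>) \<le> ennreal (s + s)"
        using bound[OF s] by simp
      also have "\<dots> = 2 * transport_cost p \<pi>"
        using s a by (simp add: cost ennreal_root_def s_def[symmetric] mult_2[symmetric] ennreal_mult)
      finally show ?thesis .
    qed
  qed
qed

text \<open>The estimate behind the theorem: if both points of a coupled pair are moved by flows that expand distances by a
  factor \<open>E\<close> and drift apart by \<open>E \<delta>\<close>, every transport cost obeys the same estimate up to a factor 2. The factor comes
  from \<open>(d + \<delta>)\<^sup>q \<le> 2\<^sup>q (d\<^sup>q + \<delta>\<^sup>q)\<close>; after taking the \<open>q\<close>-th root it no longer depends on \<open>q\<close>, which is what makes the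
  final constant uniform in the exponent.\<close>

lemma cost_of_pushforward:
  fixes \<pi> :: "('a::{metric_space,second_countable_topology} \<times> 'a) measure" and G :: "'a \<times> 'a \<Rightarrow> 'a \<times> 'a"
  assumes \<pi>: "\<pi> \<in> prob_measures" and p: "p \<ge> 1" and G: "G \<in> borel_measurable borel"
    and E: "E > 0" and \<delta>: "\<delta> \<ge> 0"
    and le: "AE w in \<pi>. dist (fst (G w)) (snd (G w)) \<le> E * (dist (fst w) (snd w) + \<delta>)"
  shows "transport_cost p (distr \<pi> borel G) \<le> ennreal (2 * E) * (transport_cost p \<pi> + ennreal \<delta>)"
proof -
  interpret prob_space \<pi> using \<pi> by (rule prob_measuresD)
  have sets: "sets \<pi> = sets borel" using \<pi> by (simp add: prob_measuresD)
  have [measurable_cong]: "sets \<pi> = sets (borel \<Otimes>\<^sub>M borel)" using prob_measuresD(2)[OF \<pi>] by (simp only: borel_prod)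
  have [measurable]: "G \<in> borel \<Otimes>\<^sub>M borel \<rightarrow>\<^sub>M borel \<Otimes>\<^sub>M borel" using G by (simp add: borel_prod)
  have G': "G \<in> \<pi> \<rightarrow>\<^sub>M borel" using G sets by (simp cong: measurable_cong_sets)
  have D: "distr \<pi> borel G \<in> prob_measures"
    by (simp add: prob_measures_def prob_space_distr[OF G'])
  show ?thesis
  proof (cases "transport_cost p \<pi> = \<infinity>")
    case True
    then show ?thesis using E by (simp add: ennreal_mult_top)
  next
    case fin: False
    then obtain r where r: "transport_cost p \<pi> = ennreal r" "r \<ge> 0" by (cases "transport_cost p \<pi>") auto
    have goal: ?thesis if "transport_cost p (distr \<pi> borel G) \<le> ennreal (2 * E * (r + \<delta>))"
      using that E r \<delta> by (simp add: ennreal_mult)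
    show ?thesis
    proof (cases "p = \<infinity>")
      case True
      have "AE w in \<pi>. dist (fst (G w)) (snd (G w)) \<le> E * (r + \<delta>)"
        using le AE_measure_support[OF \<pi>]
      proof eventually_elim
        case (elim w)
        have "ennreal (dist (fst w) (snd w)) \<le> ennreal r"
          using elim(2) True unfolding r(1)[symmetric]
          by (auto simp: transport_cost_def case_prod_unfold intro!: SUP_upper2[of w])
        then have "dist (fst w) (snd w) \<le> r" using r by simp
        then have "E * (dist (fst w) (snd w) + \<delta>) \<le> E * (r + \<delta>)" using E by (intro mult_left_mono) auto
        then show ?case using elim(1) by simp
      qed
      then have "AE w in distr \<pi> borel G. dist (fst w) (snd w) \<le> E * (r + \<delta>)"
        by (subst AE_distr_iff[OF G']) (auto simp: borel_prod[symmetric])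
      then have "measure_support (distr \<pi> borel G) \<subseteq> {w. dist (fst w) (snd w) \<le> E * (r + \<delta>)}"
        by (intro measure_support_AE_closed[OF D]) (auto intro!: closed_Collect_le continuous_intros)
      then have "transport_cost p (distr \<pi> borel G) \<le> ennreal (E * (r + \<delta>))"
        using True by (force simp: transport_cost_def intro!: SUP_least ennreal_leI)
      also have "\<dots> \<le> ennreal (2 * E * (r + \<delta>))" using E r \<delta> by (intro ennreal_leI) simp
      finally show ?thesis by (rule goal)
    next
      case False
      obtain q where q: "q \<ge> 1" and cost_q: "\<And>\<pi> :: ('a \<times> 'a) measure. transport_cost p \<pi>
          = ennreal_root q (\<integral>\<^sup>+w. ennreal (dist (fst w) (snd w) powr q) \<partial>\<pi>)"
        using transport_cost_finite_exponent[OF p False] by metis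
      define A where "A = (\<integral>\<^sup>+w. ennreal (dist (fst w) (snd w) powr q) \<partial>\<pi>)"
      have cost: "transport_cost p \<pi> = ennreal_root q A" by (simp add: cost_q A_def)
      then have "A \<noteq> \<infinity>" using fin by (auto simp: ennreal_root_def)
      then obtain a where a: "A = ennreal a" "a \<ge> 0" by (cases A) auto
      have ra: "r = a powr (1 / q)" using r cost a by (simp add: ennreal_root_def)
      have "transport_cost p (distr \<pi> borel G)
          = ennreal_root q (\<integral>\<^sup>+w. ennreal (dist (fst (G w)) (snd (G w)) powr q) \<partial>\<pi>)"
        unfolding cost_q by (subst nn_integral_distr[OF G']) (auto simp: borel_prod[symmetric])
      also have "\<dots> \<le> ennreal (2 * E * (r + \<delta>))"
      proof (rule ennreal_root_le[OF _ q])
        have "(\<integral>\<^sup>+w. ennreal (dist (fst (G w)) (snd (G w)) powr q) \<partial>\<pi>)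
            \<le> (\<integral>\<^sup>+w. ennreal ((2 * E) powr q) * (ennreal (dist (fst w) (snd w) powr q) + ennreal (\<delta> powr q)) \<partial>\<pi>)"
        proof (rule nn_integral_mono_AE)
          show "AE w in \<pi>. ennreal (dist (fst (G w)) (snd (G w)) powr q)
            \<le> ennreal ((2 * E) powr q) * (ennreal (dist (fst w) (snd w) powr q) + ennreal (\<delta> powr q))"
            using le
          proof eventually_elim
            case (elim w)
            define d where "d = dist (fst w) (snd w)"
            have "E * (d + \<delta>) \<le> 2 * E * max d \<delta>" using E by simp
            then have "dist (fst (G w)) (snd (G w)) powr q \<le> (2 * E * max d \<delta>) powr q"
              using elim q by (intro powr_mono2) (auto simp: d_def)
            also have "\<dots> = (2 * E) powr q * max d \<delta> powr q"
              using E \<delta> by (intro powr_mult)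
            also have "max d \<delta> powr q \<le> d powr q + \<delta> powr q" by (simp add: max_def)
            finally have "dist (fst (G w)) (snd (G w)) powr q \<le> (2 * E) powr q * (d powr q + \<delta> powr q)"
              by (simp add: mult_left_mono)
            then show ?case
              by (simp add: d_def ennreal_mult[symmetric] ennreal_plus[symmetric] ennreal_leI del: ennreal_plus)
          qed
        qed
        also have "\<dots> = ennreal ((2 * E) powr q) * (A + ennreal (\<delta> powr q))"
          by (subst nn_integral_cmult) (auto simp: nn_integral_add A_def emeasure_space_1)
        also have "\<dots> = ennreal ((2 * E) powr q * (r powr q + \<delta> powr q))"
          using a q by (simp add: ra powr_powr ennreal_mult)
        also have "\<dots> \<le> ennreal ((2 * E) powr q * (r + \<delta>) powr q)"
          using powr_superadditive[OF r(2) \<delta> q] by (intro ennreal_leI mult_left_mono) auto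
        also have "\<dots> = ennreal ((2 * E * (r + \<delta>)) powr q)"
          using E r \<delta> by (simp add: powr_mult)
        finally show "(\<integral>\<^sup>+w. ennreal (dist (fst (G w)) (snd (G w)) powr q) \<partial>\<pi>) \<le> ennreal ((2 * E * (r + \<delta>)) powr q)" .
      qed (use E r \<delta> in auto)
      finally show ?thesis by (rule goal)
    qed
  qed
qed

lemma couplingsD:
  fixes \<mu> \<nu> :: "'a::second_countable_topology measure"
  assumes "\<pi> \<in> couplings \<mu> \<nu>"
  shows "\<pi> \<in> prob_measures" "distr \<pi> borel fst = \<mu>" "distr \<pi> borel snd = \<nu>"
    "fst \<in> \<pi> \<rightarrow>\<^sub>M borel" "snd \<in> \<pi> \<rightarrow>\<^sub>M borel"
proof -
  show \<pi>: "\<pi> \<in> prob_measures" and "distr \<pi> borel fst = \<mu>" "distr \<pi> borel snd = \<nu>"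
    using assms by (auto simp: couplings_def)
  have "sets \<pi> = sets (borel \<Otimes>\<^sub>M borel)" using prob_measuresD(2)[OF \<pi>] by (simp only: borel_prod)
  then show "fst \<in> \<pi> \<rightarrow>\<^sub>M borel" "snd \<in> \<pi> \<rightarrow>\<^sub>M borel" by (simp_all cong: measurable_cong_sets)
qed

lemma couplings_AE:
  fixes \<mu> \<nu> :: "'a::second_countable_topology measure"
  assumes "\<pi> \<in> couplings \<mu> \<nu>" "closed C" "AE x in \<mu>. x \<in> C" "AE x in \<nu>. x \<in> C"
  shows "AE w in \<pi>. fst w \<in> C \<and> snd w \<in> C"
proof -
  have "AE w in \<pi>. fst w \<in> C" using assms(2,3) couplingsD[OF assms(1)]
    by (subst (asm) couplingsD(2)[OF assms(1), symmetric]) (simp add: AE_distr_iff)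
  moreover have "AE w in \<pi>. snd w \<in> C" using assms(2,4) couplingsD[OF assms(1)]
    by (subst (asm) couplingsD(3)[OF assms(1), symmetric]) (simp add: AE_distr_iff)
  ultimately show ?thesis by eventually_elim simp
qed

text \<open>Transfers an estimate valid for every coupling to the infimum over all couplings; division by \<open>c\<close> is legitimate
  because \<open>c\<close> is positive and finite.\<close>

lemma le_mult_INF_ennreal:
  fixes c :: real and f :: "'i \<Rightarrow> ennreal"
  assumes "c > 0" "\<And>i. i \<in> I \<Longrightarrow> x \<le> ennreal c * f i"
  shows "x \<le> ennreal c * (INF i\<in>I. f i)"
proof -
  have c: "ennreal (inverse c) * ennreal c = 1" using assms(1) by (simp add: ennreal_mult[symmetric])
  have "ennreal (inverse c) * x \<le> f i" if "i \<in> I" for i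
    using mult_left_mono[OF assms(2)[OF that], of "ennreal (inverse c)"] c
    by (simp add: mult.assoc[symmetric])
  then have "ennreal (inverse c) * x \<le> (INF i\<in>I. f i)" by (rule INF_greatest)
  then have "ennreal c * (ennreal (inverse c) * x) \<le> ennreal c * (INF i\<in>I. f i)" by (rule mult_left_mono) simp
  moreover have "ennreal c * (ennreal (inverse c) * x) = x"
    using c by (simp add: mult.assoc[symmetric] mult.commute[of "ennreal c"])
  ultimately show ?thesis by simp
qed

text \<open>Averages of a Lipschitz kernel differ by at most the Lipschitz constant times the mean transport distance of any
  coupling, hence are stable in every Wasserstein distance, with a constant that does not depend on the exponent.\<close>

lemma lipschitz_average_stability:
  fixes k :: "'a::euclidean_space \<Rightarrow> 'b::euclidean_space"
  assumes \<mu>: "\<mu> \<in> prob_measures" "AE x in \<mu>. x \<in> C" and \<nu>: "\<nu> \<in> prob_measures" "AE x in \<nu>. x \<in> C"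
    and C: "compact C" and k: "continuous_on UNIV k"
    and lip: "\<And>x y. x \<in> C \<Longrightarrow> y \<in> C \<Longrightarrow> norm (k x - k y) \<le> L * dist x y" and L: "L > 0" and p: "p \<ge> 1"
  shows "ennreal (norm ((\<integral>x. k x \<partial>\<mu>) - (\<integral>x. k x \<partial>\<nu>))) \<le> ennreal (2 * L) * wasserstein p \<mu> \<nu>"
  unfolding wasserstein_eq_INF_cost
proof (rule le_mult_INF_ennreal)
  fix \<pi> assume \<pi>: "\<pi> \<in> couplings \<mu> \<nu>"
  note [measurable] = couplingsD(4,5)[OF \<pi>]
  have kb[measurable]: "k \<in> borel_measurable borel" using k by (rule borel_measurable_continuous_onI)
  interpret prob_space \<pi> using couplingsD(1)[OF \<pi>] by (rule prob_measuresD)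
  have AE: "AE w in \<pi>. fst w \<in> C \<and> snd w \<in> C"
    by (rule couplings_AE[OF \<pi> compact_imp_closed[OF C] \<mu>(2) \<nu>(2)])
  have "bounded (k ` C)" by (intro compact_imp_bounded compact_continuous_image C continuous_on_subset[OF k]) auto
  then obtain B where B: "\<And>x. x \<in> C \<Longrightarrow> norm (k x) \<le> B" unfolding bounded_iff by blast
  have "AE w in \<pi>. norm (k (fst w)) \<le> B" "AE w in \<pi>. norm (k (snd w)) \<le> B"
    using AE by (eventually_elim, simp add: B)+
  then have int: "integrable \<pi> (\<lambda>w. k (fst w))" "integrable \<pi> (\<lambda>w. k (snd w))"
    by (auto intro!: integrable_const_bound[where B=B])
  have "(\<integral>x. k x \<partial>\<mu>) = (\<integral>w. k (fst w) \<partial>\<pi>)"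
    by (subst couplingsD(2)[OF \<pi>, symmetric], rule integral_distr) auto
  moreover have "(\<integral>x. k x \<partial>\<nu>) = (\<integral>w. k (snd w) \<partial>\<pi>)"
    by (subst couplingsD(3)[OF \<pi>, symmetric], rule integral_distr) auto
  ultimately have "ennreal (norm ((\<integral>x. k x \<partial>\<mu>) - (\<integral>x. k x \<partial>\<nu>))) = ennreal (norm (\<integral>w. k (fst w) - k (snd w) \<partial>\<pi>))"
    using int by simp
  also have "\<dots> \<le> (\<integral>\<^sup>+w. ennreal (norm (k (fst w) - k (snd w))) \<partial>\<pi>)"
    by (rule integral_norm_bound_ennreal) (use int in auto)
  also have "\<dots> \<le> (\<integral>\<^sup>+w. ennreal L * ennreal (dist (fst w) (snd w)) \<partial>\<pi>)"
    using AE by (intro nn_integral_mono_AE, elim eventually_mono)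
      (use L in \<open>auto simp: ennreal_mult[symmetric] intro!: ennreal_leI lip\<close>)
  also have "\<dots> = ennreal L * (\<integral>\<^sup>+w. ennreal (dist (fst w) (snd w)) \<partial>\<pi>)"
    by (rule nn_integral_cmult) measurable
  also have "\<dots> \<le> ennreal L * (2 * transport_cost p \<pi>)"
    by (intro mult_left_mono mean_distance_le_cost[OF couplingsD(1)[OF \<pi>] p]) auto
  also have "\<dots> = ennreal (2 * L) * transport_cost p \<pi>"
    using L by (simp add: ennreal_mult mult_ac)
  finally show "ennreal (norm ((\<integral>x. k x \<partial>\<mu>) - (\<integral>x. k x \<partial>\<nu>))) \<le> ennreal (2 * L) * transport_cost p \<pi>" .
qed (use L in auto)

section \<open>Weak solutions tested with functions increasing along the field\<close>

lemma integrable_bounded_continuous: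
  fixes f :: "'a::euclidean_space \<Rightarrow> real"
  assumes \<mu>: "\<mu> \<in> prob_measures" and f: "continuous_on UNIV f" "\<And>x. \<bar>f x\<bar> \<le> B"
  shows "integrable \<mu> f"
proof -
  interpret prob_space \<mu> using \<mu> by (rule prob_measuresD)
  show ?thesis using f(2) measurable_continuous[OF \<mu> f(1)] by (intro integrable_const_bound[where B=B]) auto
qed

lemma compact_support_bounded:
  fixes f :: "'a::euclidean_space \<Rightarrow> real"
  assumes "continuous_on UNIV f" "compact K" "\<And>x. x \<notin> K \<Longrightarrow> f x = 0"
  obtains B where "\<And>x. \<bar>f x\<bar> \<le> B"
proof -
  have "bounded (f ` K)" using assms by (intro compact_imp_bounded compact_continuous_image continuous_on_subset[OF assms(1)]) auto
  then obtain B where B: "\<And>x. x \<in> K \<Longrightarrow> \<bar>f x\<bar> \<le> B" unfolding bounded_iff by auto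
  have "\<bar>f x\<bar> \<le> max B 0" for x using B[of x] assms(3)[of x] by (cases "x \<in> K") auto
  then show thesis by (rule that)
qed

text \<open>Uniform continuity of \<open>h\<close> on a compact set controls the change of the integrand, narrow continuity the change of the
  measure.\<close>

lemma continuous_integral_along_curve:
  fixes m :: "real \<Rightarrow> 'a::euclidean_space measure" and h :: "real \<Rightarrow> 'a \<Rightarrow> real"
  assumes m: "measure_curve_on {0..T} m"
    and cont: "continuous_on ({0..T} \<times> UNIV) (\<lambda>(t, x). h t x)"
    and K: "compact K" and zero: "\<And>t x. t \<in> {0..T} \<Longrightarrow> x \<notin> K \<Longrightarrow> h t x = 0"
  shows "continuous_on {0..T} (\<lambda>t. \<integral>x. h t x \<partial>m t)"
  unfolding continuous_on_iff
proof (intro ballI allI impI)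
  fix s e :: real assume s: "s \<in> {0..T}" and e: "e > 0"
  have prob: "m t \<in> prob_measures" if "t \<in> {0..T}" for t using m that by (simp add: measure_curve_on_def)
  have conth: "continuous_on UNIV (h t)" if "t \<in> {0..T}" for t
  proof -
    have "continuous_on UNIV (\<lambda>x. (case (t, x) of (t, x) \<Rightarrow> h t x))"
      by (rule continuous_on_compose2[OF cont]) (use that in \<open>auto intro!: continuous_intros\<close>)
    then show ?thesis by simp
  qed
  have int: "integrable (m t) (h t')" if "t \<in> {0..T}" "t' \<in> {0..T}" for t t'
    using compact_support_bounded[OF conth[OF that(2)] K zero[OF that(2)]]
      integrable_bounded_continuous[OF prob[OF that(1)] conth[OF that(2)]] by blast
  have "uniformly_continuous_on ({0..T} \<times> K) (\<lambda>(t, x). h t x)"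
    by (intro compact_uniformly_continuous compact_Times K continuous_on_subset[OF cont]) auto
  then obtain d1 where d1: "d1 > 0" "\<And>w w'. w \<in> {0..T} \<times> K \<Longrightarrow> w' \<in> {0..T} \<times> K \<Longrightarrow> dist w' w < d1 \<Longrightarrow>
      dist (case w' of (t, x) \<Rightarrow> h t x) (case w of (t, x) \<Rightarrow> h t x) < e / 2"
    unfolding uniformly_continuous_on_def using e by (meson half_gt_zero)
  have bnd: "bounded (range (h s))"
    using compact_support_bounded[OF conth[OF s] K zero[OF s]] unfolding bounded_iff by (metis rangeE real_norm_def)
  then have "continuous_on {0..T} (\<lambda>t. \<integral>x. h s x \<partial>m t)"
    using m conth[OF s] unfolding measure_curve_on_def narrowly_continuous_on_def by blast
  then obtain d2 where d2: "d2 > 0"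
    "\<And>t. t \<in> {0..T} \<Longrightarrow> dist t s < d2 \<Longrightarrow> dist (\<integral>x. h s x \<partial>m t) (\<integral>x. h s x \<partial>m s) < e / 2"
    unfolding continuous_on_iff using e s by (meson half_gt_zero)
  show "\<exists>d>0. \<forall>t\<in>{0..T}. dist t s < d \<longrightarrow> dist (\<integral>x. h t x \<partial>m t) (\<integral>x. h s x \<partial>m s) < e"
  proof (intro exI[of _ "min d1 d2"] conjI ballI impI)
    fix t assume t: "t \<in> {0..T}" "dist t s < min d1 d2"
    interpret prob_space "m t" using prob[OF t(1)] by (rule prob_measuresD)
    have "\<bar>h t x - h s x\<bar> \<le> e / 2" for x
      using d1(2)[of "(s, x)" "(t, x)"] s t zero[OF t(1), of x] zero[OF s, of x] e
      by (cases "x \<in> K") (auto simp: dist_real_def dist_Pair_Pair less_imp_le)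
    then have "(\<integral>x. \<bar>h t x - h s x\<bar> \<partial>m t) \<le> (\<integral>x. e / 2 \<partial>m t)"
      using int[OF t(1) t(1)] int[OF t(1) s] by (intro integral_mono) auto
    also have "\<dots> = e / 2" by (simp add: prob_space)
    finally have "\<bar>\<integral>x. h t x - h s x \<partial>m t\<bar> \<le> e / 2"
      by (rule order_trans[OF integral_abs_bound])
    then have "dist (\<integral>x. h t x \<partial>m t) (\<integral>x. h s x \<partial>m t) \<le> e / 2"
      using int[OF t(1) t(1)] int[OF t(1) s] by (simp add: dist_real_def)
    moreover have "dist (\<integral>x. h s x \<partial>m t) (\<integral>x. h s x \<partial>m s) < e / 2" using d2(2) t by simp
    ultimately show "dist (\<integral>x. h t x \<partial>m t) (\<integral>x. h s x \<partial>m s) < e"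
      by (simp add: dist_triangle_lt[of _ "\<integral>x. h s x \<partial>m t"] order_le_less_trans[OF dist_triangle[of _ _ "\<integral>x. h s x \<partial>m t"]])
  qed (use d1 d2 in auto)
qed

lemma gradient_inner:
  fixes f :: "'a::euclidean_space \<Rightarrow> real"
  assumes "(f has_derivative f') (at x)"
  shows "v \<bullet> gradient f x = f' v"
proof -
  have "frechet_derivative f (at x) = f'" using frechet_derivative_at[OF assms] by simp
  moreover have "f' v = (\<Sum>b\<in>Basis. (v \<bullet> b) * f' b)"
    using Linear_Algebra.linear_componentwise[OF has_derivative_linear[OF assms], of v 1] by simp
  ultimately show ?thesis by (simp add: gradient_def inner_sum_right mult.commute)
qed

abbreviation weak_integrand :: "'a \<Rightarrow> ('a::euclidean_space \<times> real \<Rightarrow> real) \<Rightarrow> 'a \<Rightarrow> real \<Rightarrow> real" where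
  "weak_integrand w \<phi> x t \<equiv> deriv (\<lambda>s. \<phi> (x, s)) t + w \<bullet> gradient (\<lambda>y. \<phi> (y, t)) x"

text \<open>The integrand of the weak formulation is the derivative of the test function in the space-time direction \<open>(v, 1)\<close>.\<close>

lemma deriv_plus_gradient:
  fixes \<phi> :: "'a::euclidean_space \<times> real \<Rightarrow> real"
  assumes "(\<phi> has_derivative \<phi>') (at (x, t))"
  shows "weak_integrand v \<phi> x t = \<phi>' (v, 1)"
proof -
  have "((\<lambda>s. \<phi> (x, s)) has_derivative (\<lambda>h. \<phi>' (0, h))) (at t)"
    by (rule has_derivative_compose[of "\<lambda>s. (x, s)" "\<lambda>h. (0, h)", OF _ assms])
       (auto intro!: derivative_eq_intros)
  moreover have "(\<lambda>h. \<phi>' (0, h)) = (*) (\<phi>' (0, 1))"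
  proof
    fix h show "\<phi>' (0, h) = \<phi>' (0, 1) * h"
      using linear.scaleR[OF has_derivative_linear[OF assms], of h "(0, 1)"] by simp
  qed
  ultimately have "((\<lambda>s. \<phi> (x, s)) has_real_derivative \<phi>' (0, 1)) (at t)" by (simp add: has_field_derivative_def)
  then have 1: "deriv (\<lambda>s. \<phi> (x, s)) t = \<phi>' (0, 1)" by (rule DERIV_imp_deriv)
  have "((\<lambda>y. \<phi> (y, t)) has_derivative (\<lambda>h. \<phi>' (h, 0))) (at x)"
    by (rule has_derivative_compose[of "\<lambda>y. (y, t)" "\<lambda>h. (h, 0)", OF _ assms])
       (auto intro!: derivative_eq_intros)
  from gradient_inner[OF this, of v] 1 show ?thesis
    using linear_add[OF has_derivative_linear[OF assms], of "(0, 1)" "(v, 0)"] by simp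
qed

text \<open>With coefficients depending on \<open>v\<close> separated from derivatives in fixed directions, joint continuity becomes evident.\<close>

lemma frechet_split:
  fixes \<Theta> :: "'a::euclidean_space \<times> real \<Rightarrow> real"
  assumes "smooth \<Theta>"
  shows "frechet_derivative \<Theta> (at w) (v, c)
     = (\<Sum>b\<in>Basis. (v \<bullet> b) * frechet_derivative \<Theta> (at w) (b, 0)) + c * frechet_derivative \<Theta> (at w) (0, 1)"
proof -
  have lin: "linear (frechet_derivative \<Theta> (at w))"
    using smooth_has_derivative[OF assms] by (rule has_derivative_linear)
  have "(v, c) = (\<Sum>b\<in>Basis. (v \<bullet> b) *\<^sub>R (b, 0)) + c *\<^sub>R (0, 1)"
    by (simp add: prod_eq_iff fst_sum snd_sum euclidean_representation)
  then show ?thesis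
    by (simp only: linear_add[OF lin] linear_sum[OF lin] linear.scaleR[OF lin] real_scaleR_def)
qed

text \<open>The weak formulation of the continuity equation, tested only with functions that live in \<open>C\<close> at times in \<open>[0, T]\<close>;
  for closed \<open>C\<close> it involves only the values of the field on \<open>C\<close>.\<close>

definition weakly_transported ::
  "real \<Rightarrow> 'a set \<Rightarrow> (real \<Rightarrow> 'a \<Rightarrow> 'a) \<Rightarrow> (real \<Rightarrow> 'a::euclidean_space measure) \<Rightarrow> bool" where
  "weakly_transported T C v m \<longleftrightarrow>
     (\<forall>\<phi>. test_function (UNIV \<times> {..<T}) \<phi> \<longrightarrow> (\<forall>t\<in>{0..T}. \<forall>x. \<phi> (x, t) \<noteq> 0 \<longrightarrow> x \<in> C) \<longrightarrow>
       (LINT t:{0..T}|lborel. \<integral>x. weak_integrand (v t x) \<phi> x t \<partial>m t) + (\<integral>x. \<phi> (x, 0) \<partial>m 0) = 0)"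

text \<open>Formally the derivative of \<open>\<integral> \<Theta>(x, t) dm\<^sub>t\<close> is the integral of the derivative of \<open>\<Theta>\<close> along the field, which is nonnegative
  by assumption. The weak formulation is tested with \<open>b(t) \<Theta>(x, t)\<close>, where \<open>b\<close> drops from 1 to 0 in the interval
  \<open>[t, t + \<eta>]\<close>: if the mass \<open>H\<close> were smaller at time \<open>t\<close> than at time 0, it would still be smaller on this interval for small
  \<open>\<eta>\<close>, and this contradicts the identity. The compact
  set \<open>K\<close> also covers the negative times at which a test function has to be cut off.\<close>

lemma weak_subsolution_mass_nondecreasing:
  fixes m :: "real \<Rightarrow> 'a::euclidean_space measure" and v :: "real \<Rightarrow> 'a \<Rightarrow> 'a"
    and \<Theta> :: "'a \<times> real \<Rightarrow> real"
  assumes m: "measure_curve_on {0..T} m"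
    and v: "continuous_on ({0..T} \<times> UNIV) (\<lambda>(t, x). v t x)"
    and weak: "weakly_transported T C v m"
    and \<Theta>: "smooth \<Theta>"
    and D: "\<And>x t. t \<in> {0..T} \<Longrightarrow> frechet_derivative \<Theta> (at (x, t)) (v t x, 1) \<ge> 0"
    and K: "compact K" "\<And>x t. t \<in> {-2..T} \<Longrightarrow> x \<notin> K \<Longrightarrow> \<Theta> (x, t) = 0"
    and C: "\<And>x t. t \<in> {0..T} \<Longrightarrow> \<Theta> (x, t) \<noteq> 0 \<Longrightarrow> x \<in> C"
    and t: "0 \<le> t" "t < T"
  shows "(\<integral>x. \<Theta> (x, 0) \<partial>m 0) \<le> (\<integral>x. \<Theta> (x, t) \<partial>m t)"
proof (rule ccontr)
  define H where "H s = (\<integral>x. \<Theta> (x, s) \<partial>m s)" for s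
  assume "\<not> ?thesis"
  then have less: "H t < H 0" by (simp add: H_def)
  have T: "0 < T" using t by simp
  have prob: "m s \<in> prob_measures" if "s \<in> {0..T}" for s using m that by (simp add: measure_curve_on_def)
  define D\<Theta> where "D\<Theta> s x = frechet_derivative \<Theta> (at (x, s)) (v s x, 1)" for s x
  have cont\<Theta>: "continuous_on A \<Theta>" for A using \<Theta> by (rule smooth_continuous_on)
  have cont\<Theta>': "continuous_on A (\<lambda>(s, x). \<Theta> (x, s))" for A
    unfolding case_prod_unfold by (rule continuous_on_compose2[OF cont\<Theta>[of UNIV]]) (auto intro!: continuous_intros)
  have contD: "continuous_on ({0..T} \<times> UNIV) (\<lambda>(s, x). D\<Theta> s x)"
  proof -
    have "continuous_on A (\<lambda>w. frechet_derivative \<Theta> (at (snd w, fst w)) u)" for A u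
      by (rule continuous_on_compose2[OF smooth_continuous_on[OF smooth_frechet[OF \<Theta>], of UNIV]])
         (auto intro!: continuous_intros)
    moreover have "continuous_on ({0..T} \<times> UNIV) (\<lambda>w. v (fst w) (snd w) \<bullet> b)" for b
      using v unfolding case_prod_unfold by (intro continuous_intros)
    ultimately have "continuous_on ({0..T} \<times> UNIV) (\<lambda>w.
        (\<Sum>b\<in>Basis. (v (fst w) (snd w) \<bullet> b) * frechet_derivative \<Theta> (at (snd w, fst w)) (b, 0))
        + 1 * frechet_derivative \<Theta> (at (snd w, fst w)) (0, 1))"
      by (intro continuous_on_add continuous_on_sum continuous_on_mult continuous_on_const; simp)
    then show ?thesis
      unfolding D\<Theta>_def case_prod_unfold frechet_split[OF \<Theta>, of _ "v _ _" 1] .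
  qed
  have \<Theta>_zero: "\<Theta> (x, s) = 0" if "s \<in> {0..T}" "x \<notin> K" for s x using K(2)[of s x] that by auto
  have D\<Theta>_zero: "D\<Theta> s x = 0" if "s \<in> {0..<T}" "x \<notin> K" for s x
  proof -
    have "(\<Theta> has_derivative (\<lambda>h. 0)) (at (x, s))"
    proof (rule has_derivative_transform_within_open[of "\<lambda>_. 0" "\<lambda>h. 0" _ _ "(- K) \<times> {-2<..<T}"])
      show "open ((- K) \<times> {-2<..<T})" using K(1) by (intro open_Times) (auto simp: compact_imp_closed)
    qed (use that K(2) in auto)
    from fun_cong[OF frechet_derivative_at[OF this], of "(v s x, 1)"] show ?thesis by (simp add: D\<Theta>_def)
  qed
  have contH: "continuous_on {0..T} H"
    unfolding H_def by (rule continuous_integral_along_curve[OF m cont\<Theta>' K(1) \<Theta>_zero])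
  obtain d where d: "d > 0" "\<And>s. s \<in> {0..T} \<Longrightarrow> dist s t < d \<Longrightarrow> dist (H s) (H t) < (H 0 - H t) / 2"
    using contH[unfolded continuous_on_iff, rule_format, of t "(H 0 - H t) / 2"] less t by auto
  obtain \<eta> where "\<eta> > 0" "\<eta> < d" "\<eta> < T - t"
    using field_lbound_gt_zero[of d "T - t"] d t by auto
  then have \<eta>: "\<eta> > 0" "\<eta> < d" "t + \<eta> < T" by auto
  have H_le: "H s \<le> (H 0 + H t) / 2" if "s \<in> {t..t + \<eta>}" for s
  proof -
    have "dist (H s) (H t) < (H 0 - H t) / 2" using that t \<eta> by (intro d(2)) (auto simp: dist_real_def)
    then show ?thesis using abs_ge_self[of "H s - H t"] by (simp add: dist_real_def field_simps)
  qed
  \<comment> \<open>The second factor equals 1 for \<open>s \<ge> - 1\<close>; it only makes the support compact in the past.\<close>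
  define b where "b s = (1 - smooth_step ((s - t) / \<eta>)) * smooth_step (s + 2)" for s
  define p where "p = step_density \<eta> t"
  note p_deriv = scaled_step_DERIV[of t \<eta>, folded p_def]
    and p_nonneg = step_density_nonneg[OF \<eta>(1), of t, folded p_def]
    and p_zero = step_density_zero[OF \<eta>(1), of _ t, folded p_def]
    and p_cont = step_density_continuous[OF \<eta>(1), of _ t, folded p_def]
  have smooth_b: "smooth b"
  proof -
    have "smooth (\<lambda>s::real. s + 2)"
      by (rule smooth_add[OF smooth_bounded_linear[OF bounded_linear_ident] smooth_const])
    from smooth_compose[OF smooth_step_smooth this]
    show ?thesis unfolding b_def
      by (rule smooth_mult[OF smooth_diff[OF smooth_const smooth_scaled_step]])
  qed
  have b_range: "b s \<ge> 0" for s using smooth_step_bounds by (simp add: b_def)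
  have b0: "b 0 = 1" using t \<eta> by (simp add: b_def smooth_step_0 smooth_step_1 field_simps)
  have b_zero: "b s = 0" if "s \<notin> {-2..t + \<eta>}" for s
    using that \<eta> by (auto simp: b_def smooth_step_0 smooth_step_1 field_simps)
  have b_deriv: "(b has_real_derivative - p s) (at s)" if "s \<in> {0..T}" for s
  proof -
    have "((\<lambda>s. 1 - smooth_step ((s - t) / \<eta>)) has_real_derivative - p s) (at s)"
      using DERIV_diff[OF DERIV_const p_deriv] by simp
    then show ?thesis
      by (rule has_field_derivative_transform_within_open[of _ _ _ "{-1<..}"])
         (use that in \<open>auto simp: b_def smooth_step_1\<close>)
  qed
  define \<phi> where "\<phi> w = b (snd w) * \<Theta> w" for w
  have smooth\<phi>: "smooth \<phi>"
    unfolding \<phi>_def by (intro smooth_mult \<Theta> smooth_compose[OF smooth_b smooth_bounded_linear[OF bounded_linear_snd]])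
  have supp: "closure {w. \<phi> w \<noteq> 0} \<subseteq> K \<times> {-2..t + \<eta>}"
  proof (rule closure_minimal)
    show "{w. \<phi> w \<noteq> 0} \<subseteq> K \<times> {-2..t + \<eta>}"
    proof
      fix w assume w: "w \<in> {w. \<phi> w \<noteq> 0}"
      then have 1: "snd w \<in> {-2..t + \<eta>}" using b_zero[of "snd w"] by (auto simp: \<phi>_def)
      then have "fst w \<in> K" using w K(2)[of "snd w" "fst w"] \<eta> by (auto simp: \<phi>_def)
      with 1 show "w \<in> K \<times> {-2..t + \<eta>}" by (simp add: mem_Times_iff)
    qed
    show "closed (K \<times> {-2..t + \<eta>})" using K(1) by (intro closed_Times compact_imp_closed) auto
  qed
  have test: "test_function (UNIV \<times> {..<T}) \<phi>"
    unfolding test_function_def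
  proof (intro conjI)
    show "\<forall>k. C_k k \<phi>" using smooth\<phi> by (simp add: smooth_def)
    have "compact (K \<times> {-2..t + \<eta>})" using K(1) by (intro compact_Times) auto
    from compact_Int_closed[OF this closed_closure] supp
    show "compact (closure {w. \<phi> w \<noteq> 0})" by (metis inf.absorb2)
    show "closure {w. \<phi> w \<noteq> 0} \<subseteq> UNIV \<times> {..<T}" using supp \<eta> by auto
  qed
  \<comment> \<open>The integrand of the weak formulation for \<open>\<phi>\<close> at nonnegative times.\<close>
  define J where "J s x = - p s * \<Theta> (x, s) + b s * D\<Theta> s x" for s x
  have integrand: "weak_integrand (v s x) \<phi> x s = J s x" if s: "s \<in> {0..T}" for s x
  proof -
    have "((\<lambda>w::'a \<times> real. b (snd w)) has_derivative (\<lambda>h. snd h * - p s)) (at (x, s))"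
    proof -
      have "(b has_derivative (\<lambda>h. h * - p s)) (at (snd (x, s)))"
      proof -
        have "(*) (- p s) = (\<lambda>h. h * - p s)" by auto
        then show ?thesis using b_deriv[OF s] by (simp only: has_field_derivative_def snd_conv)
      qed
      from has_derivative_compose[OF bounded_linear_imp_has_derivative[OF bounded_linear_snd] this]
      show ?thesis .
    qed
    from has_derivative_mult[OF this smooth_has_derivative[OF \<Theta>]]
    have "(\<phi> has_derivative (\<lambda>h. b s * frechet_derivative \<Theta> (at (x, s)) h + snd h * - p s * \<Theta> (x, s))) (at (x, s))"
      by (simp add: \<phi>_def[abs_def])
    from deriv_plus_gradient[OF this, of "v s x"] show ?thesis by (simp add: J_def D\<Theta>_def)
  qed
  have J_zero: "J s x = 0" if "s \<in> {0..T}" "x \<notin> K" for s x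
  proof (cases "s < T")
    case True
    then show ?thesis using that \<Theta>_zero[OF that] D\<Theta>_zero[of s x] by (simp add: J_def)
  next
    case False
    then have "b s = 0" using \<eta> by (intro b_zero) auto
    then show ?thesis using \<Theta>_zero[OF that] by (simp add: J_def)
  qed
  have contJ: "continuous_on ({0..T} \<times> UNIV) (\<lambda>(s, x). J s x)"
  proof -
    have "continuous_on ({0..T} \<times> UNIV) (\<lambda>w. p (fst w))" "continuous_on ({0..T} \<times> UNIV) (\<lambda>w. b (fst w))"
      by (rule continuous_on_compose2[OF p_cont[of UNIV]] continuous_on_compose2[OF smooth_continuous_on[OF smooth_b, of UNIV]];
          auto intro!: continuous_intros)+
    with contD cont\<Theta>'[of "{0..T} \<times> UNIV"] show ?thesis
      unfolding J_def case_prod_unfold by (intro continuous_intros)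
  qed
  define I where "I s = (\<integral>x. J s x \<partial>m s)" for s
  have contI: "continuous_on {0..T} I"
    unfolding I_def by (rule continuous_integral_along_curve[OF m contJ K(1) J_zero])
  have "(LINT s:{0..T}|lborel. \<integral>x. weak_integrand (v s x) \<phi> x s \<partial>m s)
      + (\<integral>x. \<phi> (x, 0) \<partial>m 0) = 0"
    using weak test C by (auto simp: weakly_transported_def \<phi>_def)
  moreover have "(LINT s:{0..T}|lborel. \<integral>x. weak_integrand (v s x) \<phi> x s \<partial>m s)
      = (LINT s:{0..T}|lborel. I s)"
    by (rule set_lebesgue_integral_cong) (auto simp: I_def integrand)
  moreover have "(LINT s:{0..T}|lborel. I s) = integral {0..T} I"
    by (rule set_borel_integral_eq_integral(2)) (rule borel_integrable_atLeastAtMost'[OF contI])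
  ultimately have eq: "integral {0..T} I + H 0 = 0" by (simp add: \<phi>_def b0 H_def)
  have ge: "- (p s * ((H 0 + H t) / 2)) \<le> I s" if s: "s \<in> {0..T}" for s
  proof (cases "s < T")
    case False
    then have "b s = 0" "p s = 0" using \<eta> by (auto intro!: b_zero p_zero)
    then show ?thesis by (simp add: I_def J_def)
  next
    case True
    have c1: "continuous_on UNIV (\<lambda>x. \<Theta> (x, s))"
      by (rule continuous_on_compose2[OF cont\<Theta>[of UNIV]]) (auto intro!: continuous_intros)
    have c2: "continuous_on UNIV (D\<Theta> s)"
    proof -
      have "continuous_on UNIV (\<lambda>x. (case (s, x) of (s, x) \<Rightarrow> D\<Theta> s x))"
        by (rule continuous_on_compose2[OF contD]) (use s in \<open>auto intro!: continuous_intros\<close>)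
      then show ?thesis by simp
    qed
    obtain B1 where "\<And>x. \<bar>\<Theta> (x, s)\<bar> \<le> B1" using compact_support_bounded[OF c1 K(1) \<Theta>_zero[OF s]] by blast
    then have i1: "integrable (m s) (\<lambda>x. \<Theta> (x, s))" by (rule integrable_bounded_continuous[OF prob[OF s] c1])
    have "D\<Theta> s x = 0" if "x \<notin> K" for x using D\<Theta>_zero[of s x] that True s by auto
    then obtain B2 where "\<And>x. \<bar>D\<Theta> s x\<bar> \<le> B2" using compact_support_bounded[OF c2 K(1)] by blast
    then have i2: "integrable (m s) (D\<Theta> s)" by (rule integrable_bounded_continuous[OF prob[OF s] c2])
    have "I s = - p s * H s + b s * (\<integral>x. D\<Theta> s x \<partial>m s)"
      unfolding I_def J_def H_def using i1 i2 by simp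
    moreover have "(\<integral>x. D\<Theta> s x \<partial>m s) \<ge> 0"
      using D[OF s] by (intro Bochner_Integration.integral_nonneg) (simp add: D\<Theta>_def)
    then have "b s * (\<integral>x. D\<Theta> s x \<partial>m s) \<ge> 0" using b_range by simp
    moreover have "p s * H s \<le> p s * ((H 0 + H t) / 2)"
    proof (cases "s \<in> {t..t + \<eta>}")
      case True
      show ?thesis by (rule mult_left_mono[OF H_le[OF True] p_nonneg])
    qed (simp add: p_zero)
    ultimately show ?thesis by simp
  qed
  have "(p has_integral 1) {0..T}"
    unfolding p_def using t \<eta> by (intro step_density_has_integral) auto
  from has_integral_neg[OF has_integral_mult_left[OF this, of "(H 0 + H t) / 2"]]
  have "((\<lambda>s. - (p s * ((H 0 + H t) / 2))) has_integral - ((H 0 + H t) / 2)) {0..T}" by simp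
  from has_integral_le[OF this integrable_integral[OF integrable_continuous_real[OF contI]] ge]
  have "- ((H 0 + H t) / 2) \<le> integral {0..T} I" by blast
  moreover have "integral {0..T} I = - H 0" using eq by simp
  ultimately show False using less by (simp add: field_simps)
qed

section \<open>Representation of weak solutions by the flow\<close>

text \<open>Flow lines are only once continuously differentiable in time, whereas test functions must be smooth. Integrating a
  polynomial approximation of the velocity gives a smooth curve that is close to the flow line together with its
  derivative.\<close>

lemma smooth_polynomial_curve:
  fixes X X' :: "real \<Rightarrow> 'a::euclidean_space"
  assumes X: "\<And>t. t \<in> {0..T} \<Longrightarrow> (X has_vector_derivative X' t) (at t within {0..T})"
    and X': "continuous_on {0..T} X'" and \<kappa>: "\<kappa> > 0"
  obtains Y Y' where "\<And>b. smooth (\<lambda>s. Y s \<bullet> b)" "Y 0 = X 0"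
    "\<And>s. (Y has_vector_derivative Y' s) (at s)"
    "\<And>s. s \<in> {0..T} \<Longrightarrow> norm (X' s - Y' s) \<le> \<kappa>"
    "\<And>s. s \<in> {0..T} \<Longrightarrow> norm (X s - Y s) \<le> \<kappa> * T"
proof -
  obtain Y' where Y': "polynomial_function Y'" "\<And>s. s \<in> {0..T} \<Longrightarrow> norm (X' s - Y' s) < \<kappa>"
    using Stone_Weierstrass_polynomial_function[OF compact_Icc X' \<kappa>] by blast
  have "\<exists>a n. \<forall>s. Y' s \<bullet> b = (\<Sum>i\<le>(n::nat). a i * s ^ i)" if "b \<in> Basis" for b
  proof -
    have "real_polynomial_function (\<lambda>s. Y' s \<bullet> b)"
      using Y'(1) that by (simp add: polynomial_function_iff_Basis_inner)
    then show ?thesis unfolding real_polynomial_function_iff_sum by metis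
  qed
  then obtain a n where an: "\<And>b s. b \<in> Basis \<Longrightarrow> Y' s \<bullet> b = (\<Sum>i\<le>(n b::nat). a b i * s ^ i)"
    by metis
  define q where "q b s = (\<Sum>i\<le>n b. a b i / real (Suc i) * s ^ Suc i)" for b s
  have q: "(q b has_real_derivative Y' s \<bullet> b) (at s)" if "b \<in> Basis" for b s
  proof -
    have "((\<lambda>s. a b i / real (Suc i) * s ^ Suc i) has_real_derivative a b i * s ^ i) (at s)" for i
      using DERIV_cmult[OF DERIV_pow[of "Suc i" s], of "a b i / real (Suc i)"] by (simp del: of_nat_Suc power_Suc)
    then show ?thesis unfolding q_def an[OF that] by (intro DERIV_sum)
  qed
  have smooth_q: "smooth (q b)" for b
    unfolding q_def
    by (intro smooth_sum smooth_mult smooth_const smooth_power smooth_bounded_linear bounded_linear_ident)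
  define Y where "Y s = X 0 + (\<Sum>b\<in>Basis. q b s *\<^sub>R b)" for s
  have Y_deriv: "(Y has_vector_derivative Y' s) (at s)" for s
  proof -
    have "((\<lambda>s. q b s *\<^sub>R b) has_vector_derivative (Y' s \<bullet> b) *\<^sub>R b) (at s)" if "b \<in> Basis" for b
      using has_vector_derivative_scaleR[OF q[OF that] has_vector_derivative_const[of b]] by simp
    then have "((\<lambda>s. \<Sum>b\<in>Basis. q b s *\<^sub>R b) has_vector_derivative (\<Sum>b\<in>Basis. (Y' s \<bullet> b) *\<^sub>R b)) (at s)"
      by (rule has_vector_derivative_sum)
    from has_vector_derivative_add[OF has_vector_derivative_const[of "X 0"] this]
    show ?thesis by (simp add: Y_def[abs_def] euclidean_representation)
  qed
  show thesis
  proof (rule that[of Y Y'])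
    show "smooth (\<lambda>s. Y s \<bullet> b)" for b
      unfolding Y_def inner_add_left inner_sum_left inner_scaleR_left
      by (intro smooth_add smooth_sum smooth_mult smooth_const smooth_q)
    show "Y 0 = X 0" by (simp add: Y_def q_def)
    show "(Y has_vector_derivative Y' s) (at s)" for s by (rule Y_deriv)
    show "norm (X' s - Y' s) \<le> \<kappa>" if "s \<in> {0..T}" for s using Y'(2)[OF that] by simp
    show "norm (X s - Y s) \<le> \<kappa> * T" if s: "s \<in> {0..T}" for s
    proof -
      have "norm ((X s - Y s) - (X 0 - Y 0)) \<le> \<kappa> * norm (s - 0)"
      proof (rule differentiable_bound[where f="\<lambda>s. X s - Y s" and S="{0..T}" and f'="\<lambda>s h. h *\<^sub>R (X' s - Y' s)"])
        fix t assume t: "t \<in> {0..T}"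
        have "((\<lambda>s. X s - Y s) has_vector_derivative X' t - Y' t) (at t within {0..T})"
          by (intro has_vector_derivative_diff X[OF t] has_vector_derivative_at_within[OF Y_deriv])
        then show "((\<lambda>s. X s - Y s) has_derivative (\<lambda>h. h *\<^sub>R (X' t - Y' t))) (at t within {0..T})"
          by (simp add: has_vector_derivative_def)
        show "onorm (\<lambda>h. h *\<^sub>R (X' t - Y' t)) \<le> \<kappa>"
        proof (rule onorm_le)
          fix h :: real
          have "\<bar>h\<bar> * norm (X' t - Y' t) \<le> \<bar>h\<bar> * \<kappa>" using Y'(2)[OF t] by (intro mult_left_mono) auto
          then show "norm (h *\<^sub>R (X' t - Y' t)) \<le> \<kappa> * norm h" by (simp add: mult.commute)
        qed
      qed (use s in auto)
      also have "\<dots> \<le> \<kappa> * T" using s \<kappa> by simp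
      finally show ?thesis by (simp add: Y_def q_def)
    qed
  qed
qed

lemma frechet_derivative_along_line:
  fixes \<Theta> :: "'a::euclidean_space \<times> real \<Rightarrow> real"
  assumes "smooth \<Theta>" "((\<lambda>h. \<Theta> (x + h *\<^sub>R v, s + h)) has_real_derivative d) (at 0)"
  shows "frechet_derivative \<Theta> (at (x, s)) (v, 1) = d"
proof -
  have g: "((\<lambda>h::real. (x + h *\<^sub>R v, s + h)) has_derivative (\<lambda>h. (h *\<^sub>R v, h))) (at 0)"
    by (auto intro!: derivative_eq_intros)
  have "((\<lambda>h. \<Theta> (x + h *\<^sub>R v, s + h)) has_derivative (\<lambda>h. frechet_derivative \<Theta> (at (x, s)) (h *\<^sub>R v, h))) (at 0)"
    using has_derivative_compose[OF g, of \<Theta> "frechet_derivative \<Theta> (at (x, s))"] smooth_has_derivative[OF assms(1)] by simp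
  moreover have "(\<lambda>h. frechet_derivative \<Theta> (at (x, s)) (h *\<^sub>R v, h)) = (*) (frechet_derivative \<Theta> (at (x, s)) (v, 1))"
  proof
    fix h
    show "frechet_derivative \<Theta> (at (x, s)) (h *\<^sub>R v, h) = frechet_derivative \<Theta> (at (x, s)) (v, 1) * h"
      using linear.scaleR[OF has_derivative_linear[OF smooth_has_derivative[OF assms(1)]], of "(x, s)" h "(v, 1)"]
      by simp
  qed
  ultimately have "((\<lambda>h. \<Theta> (x + h *\<^sub>R v, s + h)) has_real_derivative frechet_derivative \<Theta> (at (x, s)) (v, 1)) (at 0)"
    by (simp add: has_field_derivative_def)
  then show ?thesis using assms(2) by (rule DERIV_unique)
qed

text \<open>The squared distance to the curve \<open>Y\<close>, rescaled by the rate at which a field with Lipschitz constant below \<open>M\<close> can expand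
  it. If \<open>Y\<close> is a flow line, it does not increase along any other flow line.\<close>

definition barrier_radius :: "real \<Rightarrow> (real \<Rightarrow> 'a::euclidean_space) \<Rightarrow> 'a \<times> real \<Rightarrow> real" where
  "barrier_radius M Y w = exp (- 2 * M * snd w) * (norm (fst w - Y (snd w)))\<^sup>2"

lemma smooth_barrier_radius:
  assumes "\<And>b. smooth (\<lambda>s. Y s \<bullet> b)"
  shows "smooth (barrier_radius M Y)"
proof -
  have s1: "smooth (\<lambda>w::'a \<times> real. fst w \<bullet> b - Y (snd w) \<bullet> b)" for b
    by (rule smooth_diff[OF smooth_bounded_linear[OF bounded_linear_compose[OF bounded_linear_inner_left bounded_linear_fst]]
        smooth_compose[OF assms smooth_bounded_linear[OF bounded_linear_snd]]])
  have s2: "smooth (\<lambda>w::'a \<times> real. exp (- 2 * M * snd w))"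
    by (rule smooth_compose[OF smooth_exp smooth_mult[OF smooth_const smooth_bounded_linear[OF bounded_linear_snd]]])
  have "barrier_radius M Y = (\<lambda>w. exp (- 2 * M * snd w) * (\<Sum>b\<in>Basis. (fst w \<bullet> b - Y (snd w) \<bullet> b) ^ 2))"
  proof
    fix w
    show "barrier_radius M Y w = exp (- 2 * M * snd w) * (\<Sum>b\<in>Basis. (fst w \<bullet> b - Y (snd w) \<bullet> b) ^ 2)"
      unfolding barrier_radius_def power2_norm_eq_inner euclidean_inner[of "fst w - Y (snd w)" "fst w - Y (snd w)"]
      by (simp add: inner_diff_left power2_eq_square)
  qed
  then show ?thesis by (simp only:) (intro smooth_mult[OF s2] smooth_sum smooth_power s1)
qed

lemma barrier_radius_deriv:
  fixes Y :: "real \<Rightarrow> 'a::euclidean_space"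
  assumes "(Y has_vector_derivative Y') (at s)"
  shows "((\<lambda>h. barrier_radius M Y (x + h *\<^sub>R v, s + h)) has_real_derivative
     exp (- 2 * M * s) * (2 * ((x - Y s) \<bullet> (v - Y')) - 2 * M * (norm (x - Y s))\<^sup>2)) (at 0)"
proof -
  have "((\<lambda>h. Y (s + h)) has_vector_derivative 1 *\<^sub>R Y') (at 0)"
    using vector_diff_chain_at[OF has_vector_derivative_add[OF has_vector_derivative_const has_vector_derivative_id],
        of Y Y' s 0] assms by (simp add: o_def)
  then have "((\<lambda>h. (x + h *\<^sub>R v) - Y (s + h)) has_vector_derivative v - Y') (at 0)"
    by (auto intro!: derivative_eq_intros)
  from DERIV_norm_square[OF this]
  have 1: "((\<lambda>h. (norm (x + h *\<^sub>R v - Y (s + h)))\<^sup>2) has_real_derivative 2 * ((x - Y s) \<bullet> (v - Y'))) (at 0)"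
    by simp
  have 2: "((\<lambda>h. exp (- 2 * M * (s + h))) has_real_derivative exp (- 2 * M * s) * (- 2 * M)) (at 0)"
    by (auto intro!: derivative_eq_intros)
  show ?thesis
    unfolding barrier_radius_def fst_conv snd_conv
    using DERIV_mult[OF 2 1] by (simp add: algebra_simps)
qed

text \<open>The key step: the mass that starts in a union of small balls is found at time \<open>t\<close> in the union of slightly larger
  balls around the transported centres. The test function is \<open>S(\<Sum>\<^sub>z (1 - S(u\<^sub>z / r\<^sup>2 - 1)))\<close> with the smooth step \<open>S\<close> and the
  barrier radii \<open>u\<^sub>z\<close>. Each summand is nondecreasing along the field because \<open>u\<^sub>z\<close> is nonincreasing, and the outer step turns
  a sum of indicators into the indicator of a union. Since the flow lines are replaced by nearby curves \<open>Y\<^sub>z\<close>, the radius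
  \<open>u\<^sub>z\<close> is known to decrease only at distance at least \<open>r\<close> from \<open>Y\<^sub>z\<close>; but nearer to \<open>Y\<^sub>z\<close> the step is flat.\<close>

lemma transported_balls_mass:
  fixes m :: "real \<Rightarrow> 'a::euclidean_space measure" and v :: "real \<Rightarrow> 'a \<Rightarrow> 'a" and X :: "real \<Rightarrow> 'a \<Rightarrow> 'a"
  assumes m: "measure_curve_on {0..T} m"
    and v: "continuous_on ({0..T} \<times> UNIV) (\<lambda>(t, x). v t x)"
    and lip: "\<And>t x y. t \<in> {0..T} \<Longrightarrow> norm (v t x - v t y) \<le> L * norm (x - y)" and L: "L \<ge> 0"
    and weak: "weakly_transported T (cball x0 (R + 1 / 2)) v m"
    and X0: "\<And>z. z \<in> Z \<Longrightarrow> X 0 z = z"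
    and X: "\<And>z t. z \<in> Z \<Longrightarrow> t \<in> {0..T} \<Longrightarrow> ((\<lambda>s. X s z) has_vector_derivative v t (X t z)) (at t within {0..T})"
    and XR: "\<And>z t. z \<in> Z \<Longrightarrow> t \<in> {0..T} \<Longrightarrow> X t z \<in> cball x0 R"
    and Z: "finite Z" and r: "r > 0" "2 * r * exp ((L + 1) * T) \<le> 1 / 2"
    and t: "0 \<le> t" "t < T"
  shows "measure (m 0) (\<Union>z\<in>Z. ball z r) \<le> measure (m t) (\<Union>z\<in>Z. cball (X t z) (2 * r * exp ((L + 1) * T)))"
proof -
  have T: "T > 0" using t by simp
  define M where "M = L + 1"
  define \<rho> where "\<rho> = 2 * r * exp (M * T)"
  \<comment> \<open>An approximation so good that \<open>Y\<^sub>z\<close> stays within \<open>r / 2\<close> of the flow line and violates its equation by at most \<open>r\<close>.\<close>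
  define \<kappa> where "\<kappa> = r / 2 / ((1 + L) * (1 + T))"
  have \<kappa>: "\<kappa> > 0" using r L T by (simp add: \<kappa>_def)
  have \<kappa>T: "\<kappa> * T \<le> r / 2" "L * (\<kappa> * T) + \<kappa> \<le> r"
  proof -
    have e: "\<kappa> * ((1 + L) * (1 + T)) = r / 2" using L T by (simp add: \<kappa>_def)
    have "T \<le> (1 + L) * (1 + T)" "L * T + 1 \<le> (1 + L) * (1 + T)" using L T by (simp_all add: algebra_simps)
    from this[THEN mult_left_mono, of \<kappa>] \<kappa> e r
    show "\<kappa> * T \<le> r / 2" "L * (\<kappa> * T) + \<kappa> \<le> r" by (auto simp: algebra_simps)
  qed
  define approx where "approx z Y Y' \<longleftrightarrow> (\<forall>b. smooth (\<lambda>s. Y s \<bullet> b)) \<and> Y 0 = z \<and>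
      (\<forall>s. (Y has_vector_derivative Y' s) (at s)) \<and>
      (\<forall>s\<in>{0..T}. norm (v s (X s z) - Y' s) \<le> \<kappa>) \<and> (\<forall>s\<in>{0..T}. norm (X s z - Y s) \<le> \<kappa> * T)" for z Y Y'
  have "\<exists>Y Y'. approx z Y Y'" if z: "z \<in> Z" for z
  proof -
    have "continuous_on {0..T} (\<lambda>s. X s z)" using X[OF z] by (rule continuous_on_vector_derivative)
    then have "continuous_on {0..T} (\<lambda>s. (s, X s z))" by (intro continuous_intros)
    from continuous_on_compose2[OF v this] have cvX: "continuous_on {0..T} (\<lambda>s. v s (X s z))" by auto
    obtain Yz Yz' where "\<And>b. smooth (\<lambda>s. Yz s \<bullet> b)" "Yz 0 = X 0 z"
      "\<And>s. (Yz has_vector_derivative Yz' s) (at s)"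
      "\<And>s. s \<in> {0..T} \<Longrightarrow> norm (v s (X s z) - Yz' s) \<le> \<kappa>"
      "\<And>s. s \<in> {0..T} \<Longrightarrow> norm (X s z - Yz s) \<le> \<kappa> * T"
      using smooth_polynomial_curve[OF X[OF z] cvX \<kappa>] by blast
    then show ?thesis using X0[OF z] unfolding approx_def by (intro exI[of _ Yz] exI[of _ Yz'] conjI) simp_all
  qed
  then obtain Y Y' where YY: "\<And>z. z \<in> Z \<Longrightarrow> approx z (Y z) (Y' z)" by metis
  have Y: "\<And>z b. z \<in> Z \<Longrightarrow> smooth (\<lambda>s. Y z s \<bullet> b)" "\<And>z. z \<in> Z \<Longrightarrow> Y z 0 = z"
    "\<And>z s. z \<in> Z \<Longrightarrow> (Y z has_vector_derivative Y' z s) (at s)"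
    "\<And>z s. z \<in> Z \<Longrightarrow> s \<in> {0..T} \<Longrightarrow> norm (v s (X s z) - Y' z s) \<le> \<kappa>"
    "\<And>z s. z \<in> Z \<Longrightarrow> s \<in> {0..T} \<Longrightarrow> norm (X s z - Y z s) \<le> \<kappa> * T"
    using YY unfolding approx_def by blast+
  define u where "u z = barrier_radius M (Y z)" for z
  define g where "g z w = 1 - smooth_step (u z w / r\<^sup>2 - 1)" for z w
  define \<Theta> where "\<Theta> w = smooth_step (\<Sum>z\<in>Z. g z w)" for w
  have smooth_u: "smooth (u z)" if "z \<in> Z" for z
    unfolding u_def using Y(1)[OF that] by (rule smooth_barrier_radius)
  have smooth_g: "smooth (g z)" if "z \<in> Z" for z
  proof -
    have "smooth (\<lambda>w. u z w * (1 / r\<^sup>2) - 1)"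
      by (intro smooth_diff smooth_mult smooth_u[OF that] smooth_const)
    from smooth_diff[OF smooth_const smooth_compose[OF smooth_step_smooth this]]
    show ?thesis by (simp add: g_def[abs_def])
  qed
  have smooth_\<Theta>: "smooth \<Theta>"
    unfolding \<Theta>_def by (rule smooth_compose[OF smooth_step_smooth smooth_sum[OF smooth_g]])
  have g_range: "0 \<le> g z w" "g z w \<le> 1" for z w using smooth_step_bounds by (auto simp: g_def)
  have \<Theta>_range: "0 \<le> \<Theta> w" "\<Theta> w \<le> 1" for w using smooth_step_bounds by (auto simp: \<Theta>_def)
  have near: "\<exists>z\<in>Z. norm (x - Y z s) \<le> 3 / 2 * r * exp (M * s)" if "\<Theta> (x, s) \<noteq> 0" for x s
  proof -
    have "(\<Sum>z\<in>Z. g z (x, s)) > 0" using that smooth_step_0[of "\<Sum>z\<in>Z. g z (x, s)"] by (force simp: \<Theta>_def)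
    then obtain z where z: "z \<in> Z" "g z (x, s) > 0"
      by (metis not_le sum_nonpos)
    then have "u z (x, s) / r\<^sup>2 - 1 < 1" using smooth_step_1[of "u z (x, s) / r\<^sup>2 - 1"] by (force simp: g_def)
    then have "u z (x, s) < 2 * r\<^sup>2" using r by (simp add: field_simps)
    then have lt: "exp (2 * M * s) * u z (x, s) < exp (2 * M * s) * (2 * r\<^sup>2)" by simp
    have "exp (2 * M * s) * u z (x, s) = (norm (x - Y z s))\<^sup>2"
      by (simp add: u_def barrier_radius_def mult.assoc[symmetric] mult_exp_exp)
    then have "(norm (x - Y z s))\<^sup>2 < 2 * (r\<^sup>2 * exp (2 * M * s))" using lt by (simp only: mult_ac)
    also have "\<dots> \<le> (9 / 4) * (r\<^sup>2 * exp (2 * M * s))" by (intro mult_right_mono) auto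
    also have "\<dots> = (3 / 2 * r * exp (M * s))\<^sup>2"
      by (simp add: power2_eq_square exp_add[symmetric] mult_ac)
    finally have "norm (x - Y z s) \<le> 3 / 2 * r * exp (M * s)"
      by (rule power2_le_imp_le[OF less_imp_le]) (use r in auto)
    then show ?thesis using z by blast
  qed
  have near_X: "\<exists>z\<in>Z. norm (x - X s z) \<le> \<rho>" if s: "s \<in> {0..T}" and nz: "\<Theta> (x, s) \<noteq> 0" for x s
  proof -
    obtain z where z: "z \<in> Z" "norm (x - Y z s) \<le> 3 / 2 * r * exp (M * s)" using near[OF nz] by blast
    have "norm (x - X s z) \<le> norm (x - Y z s) + norm (X s z - Y z s)"
      by (rule norm_diff_triangle_le[OF order_refl]) (simp add: norm_minus_commute)
    also have "\<dots> \<le> 3 / 2 * r * exp (M * T) + 1 / 2 * r * exp (M * T)"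
    proof (rule add_mono)
      have "3 / 2 * r * exp (M * s) \<le> 3 / 2 * r * exp (M * T)"
        using s r L by (intro mult_left_mono) (auto simp: M_def)
      then show "norm (x - Y z s) \<le> 3 / 2 * r * exp (M * T)" using z(2) by simp
      have "1 / 2 * r * 1 \<le> 1 / 2 * r * exp (M * T)"
        using r L T by (intro mult_left_mono) (auto simp: M_def)
      then show "norm (X s z - Y z s) \<le> 1 / 2 * r * exp (M * T)" using Y(5)[OF z(1) s] \<kappa>T(1) by simp
    qed
    also have "\<dots> = \<rho>" by (simp add: \<rho>_def)
    finally show ?thesis using z(1) by blast
  qed
  have \<rho>: "\<rho> \<le> 1 / 2" using r(2) by (simp add: \<rho>_def M_def)
  have C: "x \<in> cball x0 (R + 1 / 2)" if s: "s \<in> {0..T}" and nz: "\<Theta> (x, s) \<noteq> 0" for x s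
  proof -
    obtain z where z: "z \<in> Z" "norm (x - X s z) \<le> \<rho>" using near_X[OF s nz] by blast
    then have "dist x0 x \<le> R + \<rho>"
      using XR[OF z(1) s] dist_triangle[of x0 x "X s z"] by (simp add: dist_norm norm_minus_commute)
    then show ?thesis using \<rho> by simp
  qed
  have D: "frechet_derivative \<Theta> (at (x, s)) (v s x, 1) \<ge> 0" if s: "s \<in> {0..T}" for x s
  proof -
    define u' where "u' z = exp (- 2 * M * s) * (2 * ((x - Y z s) \<bullet> (v s x - Y' z s)) - 2 * M * (norm (x - Y z s))\<^sup>2)" for z
    define \<sigma> where "\<sigma> z = smooth_step' (u z (x, s) / r\<^sup>2 - 1)" for z
    have du: "((\<lambda>h. u z (x + h *\<^sub>R v s x, s + h)) has_real_derivative u' z) (at 0)" if "z \<in> Z" for z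
      unfolding u_def u'_def by (rule barrier_radius_deriv[OF Y(3)[OF that]])
    have dg: "((\<lambda>h. g z (x + h *\<^sub>R v s x, s + h)) has_real_derivative - (\<sigma> z * (u' z / r\<^sup>2))) (at 0)" if "z \<in> Z" for z
    proof -
      have "((\<lambda>h. u z (x + h *\<^sub>R v s x, s + h) / r\<^sup>2 - 1) has_real_derivative u' z / r\<^sup>2) (at 0)"
        using DERIV_diff[OF DERIV_cdivide[OF du[OF that]] DERIV_const] by simp
      from DERIV_diff[OF DERIV_const DERIV_chain2[OF smooth_step_DERIV this]]
      show ?thesis by (simp add: g_def \<sigma>_def)
    qed
    have "((\<lambda>h. \<Theta> (x + h *\<^sub>R v s x, s + h)) has_real_derivative
        smooth_step' (\<Sum>z\<in>Z. g z (x, s)) * (\<Sum>z\<in>Z. - (\<sigma> z * (u' z / r\<^sup>2)))) (at 0)"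
      unfolding \<Theta>_def using DERIV_chain2[OF smooth_step_DERIV DERIV_sum[OF dg]] by simp
    then have "frechet_derivative \<Theta> (at (x, s)) (v s x, 1)
        = smooth_step' (\<Sum>z\<in>Z. g z (x, s)) * (\<Sum>z\<in>Z. - (\<sigma> z * (u' z / r\<^sup>2)))"
      by (rule frechet_derivative_along_line[OF smooth_\<Theta>])
    also have "\<dots> \<ge> 0"
    proof (intro mult_nonneg_nonneg sum_nonneg smooth_step'_nonneg)
      fix z assume z: "z \<in> Z"
      define d where "d = norm (x - Y z s)"
      have "\<sigma> z * u' z \<le> 0"
      \<comment> \<open>Either the step is flat, or the distance \<open>d\<close> to \<open>Y\<^sub>z\<close> exceeds \<open>r\<close> and \<open>L d + r \<le> M d\<close>.\<close>
      proof (cases "u z (x, s) / r\<^sup>2 - 1 \<le> 0")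
        case True
        then show ?thesis by (simp add: \<sigma>_def smooth_step'_zero)
      next
        case False
        then have "r\<^sup>2 < exp (- 2 * M * s) * d\<^sup>2" using r by (simp add: u_def barrier_radius_def d_def field_simps)
        also have "\<dots> \<le> 1 * d\<^sup>2"
        proof (rule mult_right_mono)
          have "- 2 * M * s \<le> 0" using s L by (intro mult_nonpos_nonneg) (auto simp: M_def)
          then show "exp (- 2 * M * s) \<le> 1" by simp
        qed simp
        finally have "r < d" using power2_less_imp_less[of r d] by (simp add: d_def)
        have "norm (v s x - Y' z s) \<le> norm (v s x - v s (X s z)) + norm (v s (X s z) - Y' z s)"
          by (rule norm_diff_triangle_le[OF order_refl order_refl])
        also have "\<dots> \<le> L * norm (x - X s z) + \<kappa>" by (intro add_mono lip[OF s] Y(4)[OF z s])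
        also have "L * norm (x - X s z) \<le> L * (d + \<kappa> * T)"
          unfolding d_def using norm_triangle_ineq[of "x - Y z s" "Y z s - X s z"] Y(5)[OF z s] L
          by (intro mult_left_mono) (simp_all add: norm_minus_commute)
        finally have "norm (v s x - Y' z s) \<le> L * d + (L * (\<kappa> * T) + \<kappa>)"
          by (simp add: algebra_simps)
        also have "\<dots> \<le> M * d" using \<kappa>T(2) \<open>r < d\<close> by (simp add: M_def algebra_simps)
        finally have le: "norm (v s x - Y' z s) \<le> M * d" .
        have "(x - Y z s) \<bullet> (v s x - Y' z s) \<le> d * norm (v s x - Y' z s)"
          unfolding d_def by (rule norm_cauchy_schwarz)
        also have "\<dots> \<le> d * (M * d)" using le by (rule mult_left_mono) (simp add: d_def)
        finally have "(x - Y z s) \<bullet> (v s x - Y' z s) \<le> d * (M * d)" .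
        then have "2 * ((x - Y z s) \<bullet> (v s x - Y' z s)) - 2 * M * d\<^sup>2 \<le> 0" by (simp add: power2_eq_square mult_ac)
        then have "u' z \<le> 0" unfolding u'_def d_def by (intro mult_nonneg_nonpos) auto
        then show ?thesis using smooth_step'_nonneg by (intro mult_nonneg_nonpos) (auto simp: \<sigma>_def)
      qed
      then show "- (\<sigma> z * (u' z / r\<^sup>2)) \<ge> 0" using r by (simp add: divide_nonpos_pos)
    qed
    finally show ?thesis .
  qed
  have "\<exists>\<beta>. \<forall>s\<in>{-2..T}. norm (Y z s) \<le> \<beta>" if "z \<in> Z" for z
  proof -
    have "continuous_on {-2..T} (Y z)"
      by (rule continuous_on_vector_derivative[OF has_vector_derivative_at_within[OF Y(3)[OF that]]])
    then have "bounded (Y z ` {-2..T})" by (intro compact_imp_bounded compact_continuous_image) auto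
    then show ?thesis unfolding bounded_iff by blast
  qed
  then obtain \<beta> where \<beta>: "\<And>z s. z \<in> Z \<Longrightarrow> s \<in> {-2..T} \<Longrightarrow> norm (Y z s) \<le> \<beta> z" by metis
  define K :: "'a set" where "K = (\<Union>z\<in>Z. cball 0 (\<beta> z + 3 / 2 * r * exp (M * T)))"
  have K: "compact K" unfolding K_def using Z by (intro compact_UN) auto
  have K0: "\<Theta> (x, s) = 0" if s: "s \<in> {-2..T}" "x \<notin> K" for x s
  proof (rule ccontr)
    assume "\<Theta> (x, s) \<noteq> 0"
    then obtain z where z: "z \<in> Z" "norm (x - Y z s) \<le> 3 / 2 * r * exp (M * s)" using near by blast
    have "3 / 2 * r * exp (M * s) \<le> 3 / 2 * r * exp (M * T)"
      using s r L by (intro mult_left_mono) (auto simp: M_def)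
    then have "norm x \<le> \<beta> z + 3 / 2 * r * exp (M * T)"
      using z \<beta>[OF z(1) s(1)] norm_triangle_sub[of x "Y z s"] by linarith
    then show False using z(1) s(2) by (auto simp: K_def)
  qed
  have H: "(\<integral>x. \<Theta> (x, 0) \<partial>m 0) \<le> (\<integral>x. \<Theta> (x, t) \<partial>m t)"
    by (rule weak_subsolution_mass_nondecreasing[OF m v weak smooth_\<Theta> D K K0 C t])
  have prob: "m s \<in> prob_measures" if "s \<in> {0..T}" for s using m that by (simp add: measure_curve_on_def)
  have int: "integrable (m s) (\<lambda>x. \<Theta> (x, s))" if "s \<in> {0..T}" for s
  proof (rule integrable_bounded_continuous[OF prob[OF that], where B=1])
    show "continuous_on UNIV (\<lambda>x. \<Theta> (x, s))"
      by (rule continuous_on_compose2[OF smooth_continuous_on[OF smooth_\<Theta>, of UNIV]]) (auto intro!: continuous_intros)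
    show "\<bar>\<Theta> (x, s)\<bar> \<le> 1" for x using \<Theta>_range[of "(x, s)"] by simp
  qed
  define A where "A = (\<Union>z\<in>Z. ball z r)"
  define B where "B = (\<Union>z\<in>Z. cball (X t z) \<rho>)"
  have AB: "A \<in> sets (m s)" "B \<in> sets (m s)" if "s \<in> {0..T}" for s
    unfolding prob_measuresD(2)[OF prob[OF that]] A_def B_def
    by (intro borel_open open_UN ballI open_ball, intro borel_closed closed_UN Z ballI closed_cball)
  have ind: "integrable (m s) (indicator S :: 'a \<Rightarrow> real)" "(\<integral>x. indicator S x \<partial>m s) = measure (m s) S"
    if "s \<in> {0..T}" "S \<in> sets (m s)" for s S
  proof -
    interpret prob_space "m s" using prob[OF that(1)] by (rule prob_measuresD)
    show "integrable (m s) (indicator S :: 'a \<Rightarrow> real)" "(\<integral>x. indicator S x \<partial>m s) = measure (m s) S"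
      using that(2) by (auto simp: emeasure_eq_measure)
  qed
  have t0: "0 \<in> {0..T}" "t \<in> {0..T}" using t by auto
  have "measure (m 0) A = (\<integral>x. indicator A x \<partial>m 0)" using ind(2)[OF t0(1) AB(1)[OF t0(1)]] by simp
  also have "\<dots> \<le> (\<integral>x. \<Theta> (x, 0) \<partial>m 0)"
  proof (rule integral_mono[OF ind(1)[OF t0(1) AB(1)[OF t0(1)]] int[OF t0(1)]])
    fix x
    show "indicator A x \<le> \<Theta> (x, 0)"
    proof (cases "x \<in> A")
      case True
      then obtain z where z: "z \<in> Z" "dist z x < r" by (auto simp: A_def)
      have "norm (x - z) \<le> r" using z(2) by (simp add: dist_norm norm_minus_commute)
      then have "u z (x, 0) / r\<^sup>2 - 1 \<le> 0" using r Y(2)[OF z(1)] by (simp add: u_def barrier_radius_def)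
      then have "g z (x, 0) = 1" by (simp add: g_def smooth_step_0)
      moreover have "g z (x, 0) \<le> (\<Sum>z\<in>Z. g z (x, 0))"
        using z(1) Z g_range by (intro member_le_sum) auto
      ultimately show ?thesis by (simp add: \<Theta>_def smooth_step_1)
    qed (use \<Theta>_range in simp)
  qed
  also note H
  also have "(\<integral>x. \<Theta> (x, t) \<partial>m t) \<le> (\<integral>x. indicator B x \<partial>m t)"
  proof (rule integral_mono[OF int[OF t0(2)] ind(1)[OF t0(2) AB(2)[OF t0(2)]]])
    fix x
    show "\<Theta> (x, t) \<le> indicator B x"
    proof (cases "x \<in> B")
      case False
      then have "\<Theta> (x, t) = 0"
        using near_X[OF t0(2), of x] by (auto simp: B_def dist_norm norm_minus_commute)
      then show ?thesis by simp
    qed (use \<Theta>_range in simp)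
  qed
  also have "\<dots> = measure (m t) B" using ind(2)[OF t0(2) AB(2)[OF t0(2)]] by simp
  finally show ?thesis by (simp add: A_def B_def \<rho>_def M_def)
qed

lemma thickening_measure_tendsto:
  fixes \<mu> :: "'a::metric_space measure"
  assumes \<mu>: "\<mu> \<in> prob_measures" and C: "closed C" "C \<noteq> {}"
  shows "(\<lambda>n. measure \<mu> {x. infdist x C \<le> 1 / real (Suc n)}) \<longlonglongrightarrow> measure \<mu> C"
proof -
  interpret prob_space \<mu> using \<mu> by (rule prob_measuresD)
  define A where "A n = {x. infdist x C \<le> 1 / real (Suc n)}" for n
  have "closed (A n)" for n unfolding A_def by (intro closed_Collect_le continuous_intros)
  then have "range A \<subseteq> sets \<mu>" using prob_measuresD(2)[OF \<mu>] by auto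
  moreover have "decseq A"
    unfolding decseq_def A_def by (auto elim!: order_trans intro!: frac_le)
  ultimately have "(\<lambda>n. measure \<mu> (A n)) \<longlonglongrightarrow> measure \<mu> (\<Inter>n. A n)"
    by (rule finite_Lim_measure_decseq)
  moreover have "(\<Inter>n. A n) = C"
  proof safe
    fix x assume x: "x \<in> (\<Inter>n. A n)"
    have "infdist x C \<le> 0"
    proof (rule field_le_epsilon)
      fix e :: real assume "e > 0"
      then obtain n where "1 / real (Suc n) < e" using nat_approx_posE by blast
      then show "infdist x C \<le> 0 + e" using x by (auto simp: A_def dest: spec[of _ n])
    qed
    then show "x \<in> C" using in_closed_iff_infdist_zero[OF C] infdist_nonneg[of x C] by simp
  qed (auto simp: A_def)
  ultimately show ?thesis by (simp add: A_def)
qed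

text \<open>An inequality on closed sets gives the reverse inequality on open sets. Sandwiching an open neighbourhood between
  a closed set and a closed thickening of it, and shrinking the thickening, yields equality on closed sets.\<close>

lemma prob_measures_eqI_closed:
  fixes \<mu> \<nu> :: "'a::metric_space measure"
  assumes \<mu>: "\<mu> \<in> prob_measures" and \<nu>: "\<nu> \<in> prob_measures"
    and le: "\<And>C. closed C \<Longrightarrow> C \<noteq> {} \<Longrightarrow> measure \<nu> C \<le> measure \<mu> C"
  shows "\<nu> = \<mu>"
proof -
  interpret \<mu>: prob_space \<mu> using \<mu> by (rule prob_measuresD)
  interpret \<nu>: prob_space \<nu> using \<nu> by (rule prob_measuresD)
  note sets = prob_measuresD(2)[OF \<mu>] prob_measuresD(2)[OF \<nu>] and space = prob_measuresD(3)[OF \<mu>] prob_measuresD(3)[OF \<nu>]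
  have le': "measure \<nu> C \<le> measure \<mu> C" if "closed C" for C
    using le[OF that] by (cases "C = {}") auto
  have ge: "measure \<mu> C \<le> measure \<nu> C" if C: "closed C" "C \<noteq> {}" for C
  proof (rule LIMSEQ_le_const[OF thickening_measure_tendsto[OF \<nu> C]], intro exI allI impI)
    fix n :: nat
    define U where "U = {x. infdist x C < 1 / real (Suc n)}"
    have U: "open U" unfolding U_def by (intro open_Collect_less continuous_intros)
    have "measure \<mu> C \<le> measure \<mu> U"
      using C U sets by (intro \<mu>.finite_measure_mono) (auto simp: U_def)
    also have "\<dots> \<le> measure \<nu> U"
      using le'[of "- U"] U sets space \<mu>.prob_compl[of U] \<nu>.prob_compl[of U]
      by (simp add: Compl_eq_Diff_UNIV open_closed)
    also have "\<dots> \<le> measure \<nu> {x. infdist x C \<le> 1 / real (Suc n)}"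
      using sets by (intro \<nu>.finite_measure_mono)
        (auto simp: U_def intro!: borel_closed closed_Collect_le continuous_intros)
    finally show "measure \<mu> C \<le> measure \<nu> {x. infdist x C \<le> 1 / real (Suc n)}" .
  qed
  have eq: "measure \<nu> C = measure \<mu> C" if "closed C" for C
    using le'[OF that] ge[OF that] by (cases "C = {}") (auto intro: antisym)
  show ?thesis
  proof (rule measure_eqI_generator_eq[where E="Collect closed" and \<Omega>=UNIV and A="\<lambda>_. UNIV"])
    show "Int_stable (Collect closed :: 'a set set)" by (auto simp: Int_stable_def)
    have "sets borel = sigma_sets UNIV (Collect closed :: 'a set set)"
      unfolding borel_eq_closed by (rule sets_measure_of) auto
    then show "sets \<nu> = sigma_sets UNIV (Collect closed)" "sets \<mu> = sigma_sets UNIV (Collect closed)"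
      using sets by auto
    show "emeasure \<nu> C = emeasure \<mu> C" if "C \<in> Collect closed" for C
      using eq[of C] that by (simp add: \<mu>.emeasure_eq_measure \<nu>.emeasure_eq_measure)
  qed auto
qed

text \<open>Uniqueness for the linear continuity equation with a Lipschitz field, in the form of a representation formula. For a
  closed set \<open>C\<close> the part of the initial mass that the flow carries into \<open>C\<close> sits in a compact set \<open>A\<close>; cover \<open>A\<close> by finitely
  many small balls centred in \<open>A\<close> and apply the transport of balls. Their images lie in a small thickening of \<open>C\<close>, so the
  pushforward gives \<open>C\<close> at most the mass that the solution does, and the two probability measures agree.\<close>

lemma weak_solution_eq_pushforward:
  fixes m :: "real \<Rightarrow> 'a::euclidean_space measure" and v :: "real \<Rightarrow> 'a \<Rightarrow> 'a" and X :: "real \<Rightarrow> 'a \<Rightarrow> 'a"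
  assumes m: "measure_curve_on {0..T} m"
    and v: "continuous_on ({0..T} \<times> UNIV) (\<lambda>(t, x). v t x)"
    and lip: "\<And>t x y. t \<in> {0..T} \<Longrightarrow> norm (v t x - v t y) \<le> L * norm (x - y)" and L: "L \<ge> 0"
    and weak: "weakly_transported T (cball x0 (R + 1 / 2)) v m"
    and X0: "\<And>z. z \<in> cball x0 R \<Longrightarrow> X 0 z = z"
    and X: "\<And>z t. z \<in> cball x0 R \<Longrightarrow> t \<in> {0..T} \<Longrightarrow>
       ((\<lambda>s. X s z) has_vector_derivative v t (X t z)) (at t within {0..T})"
    and XR: "\<And>z t. z \<in> cball x0 R \<Longrightarrow> t \<in> {0..T} \<Longrightarrow> X t z \<in> cball x0 R"
    and conc: "AE x in m 0. x \<in> cball x0 R"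
    and t: "0 \<le> t" "t < T" and cont: "continuous_on UNIV (X t)"
  shows "distr (m 0) borel (X t) = m t"
proof (rule prob_measures_eqI_closed)
  have prob: "m s \<in> prob_measures" if "s \<in> {0..T}" for s using m that by (simp add: measure_curve_on_def)
  have t0: "0 \<in> {0..T}" "t \<in> {0..T}" using t by auto
  show mt: "m t \<in> prob_measures" using prob t0 by blast
  interpret m0: prob_space "m 0" using prob[OF t0(1)] by (rule prob_measuresD)
  interpret mt: prob_space "m t" using mt by (rule prob_measuresD)
  note sets0 = prob_measuresD(2)[OF prob[OF t0(1)]]
  note meas = measurable_continuous[OF prob[OF t0(1)] cont]
  show "distr (m 0) borel (X t) \<in> prob_measures"
    by (simp add: prob_measures_def m0.prob_space_distr[OF meas])
  fix C :: "'a set" assume C: "closed C" "C \<noteq> {}"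
  define A where "A = X t -` C \<inter> cball x0 R"
  have clA: "closed (X t -` C)" using continuous_closed_vimage[OF C(1)] cont continuous_on_eq_continuous_at[OF open_UNIV] by blast
  then have "compact A" unfolding A_def by (intro closed_Int_compact) auto
  have "measure (distr (m 0) borel (X t)) C = measure (m 0) (X t -` C)"
    using meas C prob_measuresD(3)[OF prob[OF t0(1)]] by (subst measure_distr) auto
  also have "\<dots> = measure (m 0) A"
    using conc clA \<open>compact A\<close> sets0 by (intro m0.finite_measure_eq_AE) (auto simp: A_def compact_imp_closed elim: eventually_mono)
  also have "\<dots> \<le> measure (m t) C"
  proof (rule LIMSEQ_le_const[OF thickening_measure_tendsto[OF mt C]], intro exI allI impI)
    fix n :: nat
    define e where "e = exp ((L + 1) * T)"
    define r where "r = min (1 / real (Suc n)) (1 / 2) / (2 * e)"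
    have e: "e > 0" by (simp add: e_def)
    have r: "r > 0" "2 * r * e \<le> 1 / real (Suc n)" "2 * r * e \<le> 1 / 2"
      using e by (auto simp: r_def)
    have "A \<subseteq> (\<Union>z\<in>A. ball z r)" using r(1) by force
    then obtain Z where Z: "Z \<subseteq> A" "finite Z" "A \<subseteq> (\<Union>z\<in>Z. ball z r)"
      by (rule compactE_image[OF \<open>compact A\<close> open_ball])
    have ZR: "z \<in> cball x0 R" "X t z \<in> C" if "z \<in> Z" for z using Z(1) that by (auto simp: A_def)
    have "measure (m 0) A \<le> measure (m 0) (\<Union>z\<in>Z. ball z r)"
    proof (rule m0.finite_measure_mono[OF Z(3)])
      show "(\<Union>z\<in>Z. ball z r) \<in> sets (m 0)" unfolding sets0 by (intro borel_open open_UN) auto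
    qed
    also have "\<dots> \<le> measure (m t) (\<Union>z\<in>Z. cball (X t z) (2 * r * exp ((L + 1) * T)))"
      by (rule transported_balls_mass[OF m v lip L weak X0 X XR Z(2)])
         (use ZR(1) r t in \<open>auto simp: e_def simp del: mem_cball\<close>)
    also have "\<dots> \<le> measure (m t) {x. infdist x C \<le> 1 / real (Suc n)}"
    proof (rule mt.finite_measure_mono)
      show "(\<Union>z\<in>Z. cball (X t z) (2 * r * exp ((L + 1) * T))) \<subseteq> {x. infdist x C \<le> 1 / real (Suc n)}"
      proof safe
        fix z x assume z: "z \<in> Z" "x \<in> cball (X t z) (2 * r * exp ((L + 1) * T))"
        have "infdist x C \<le> dist x (X t z)" by (rule infdist_le[OF ZR(2)[OF z(1)]])
        then show "infdist x C \<le> 1 / real (Suc n)" using z(2) r(2) by (simp add: e_def dist_commute)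
      qed
      show "{x. infdist x C \<le> 1 / real (Suc n)} \<in> sets (m t)"
        using prob_measuresD(2)[OF mt] by (auto intro!: borel_closed closed_Collect_le continuous_intros)
    qed
    finally show "measure (m 0) A \<le> measure (m t) {x. infdist x C \<le> 1 / real (Suc n)}" .
  qed
  finally show "measure (distr (m 0) borel (X t)) C \<le> measure (m t) C" .
qed

section \<open>Velocity fields of averaged attraction\<close>

lemma quotient_difference_bound:
  fixes N N' :: "'a::real_normed_vector" and Q Q' :: real
  assumes "0 < d" "d \<le> Q" "d \<le> Q'" "norm N' \<le> B"
  shows "norm (N /\<^sub>R Q - N' /\<^sub>R Q') \<le> norm (N - N') / d + B / d\<^sup>2 * \<bar>Q - Q'\<bar>"
proof -
  have Q: "Q > 0" "Q' > 0" using assms by auto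
  have eq: "N /\<^sub>R Q - N' /\<^sub>R Q' = (N - N') /\<^sub>R Q + ((Q' - Q) / (Q * Q')) *\<^sub>R N'"
    using Q by (simp add: scaleR_diff_right diff_divide_distrib scaleR_diff_left inverse_eq_divide)
  have "norm ((N - N') /\<^sub>R Q) \<le> norm (N - N') / d"
    using assms Q by (simp add: divide_inverse[symmetric] frac_le mult.commute[of "inverse Q"])
  moreover have "norm (((Q' - Q) / (Q * Q')) *\<^sub>R N') \<le> \<bar>Q - Q'\<bar> / d\<^sup>2 * B"
  proof -
    have "\<bar>Q' - Q\<bar> / (Q * Q') \<le> \<bar>Q - Q'\<bar> / d\<^sup>2"
      unfolding power2_eq_square using assms Q by (intro frac_le mult_mono) auto
    then have "\<bar>Q' - Q\<bar> / (Q * Q') * norm N' \<le> \<bar>Q - Q'\<bar> / d\<^sup>2 * B"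
      using assms by (intro mult_mono) auto
    then show ?thesis using Q by (simp add: abs_mult)
  qed
  ultimately show ?thesis unfolding eq
    using norm_triangle_ineq[of "(N - N') /\<^sub>R Q" "((Q' - Q) / (Q * Q')) *\<^sub>R N'"] by (simp add: mult_ac)
qed

lemma integrable_compactly_concentrated:
  fixes k :: "'a::euclidean_space \<Rightarrow> 'b::euclidean_space"
  assumes \<mu>: "\<mu> \<in> prob_measures" "AE x in \<mu>. x \<in> C" and C: "compact C" and k: "continuous_on UNIV k"
  shows "integrable \<mu> k"
proof -
  interpret prob_space \<mu> using \<mu>(1) by (rule prob_measuresD)
  have "bounded (k ` C)" by (intro compact_imp_bounded compact_continuous_image C continuous_on_subset[OF k]) auto
  then obtain B where B: "\<And>x. x \<in> C \<Longrightarrow> norm (k x) \<le> B" unfolding bounded_iff by blast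
  note measurable_continuous[OF \<mu>(1) k]
  moreover have "AE x in \<mu>. norm (k x) \<le> B" using \<mu>(2) by eventually_elim (rule B)
  ultimately show ?thesis by (intro integrable_const_bound[where B=B])
qed

definition confined :: "'a::euclidean_space \<Rightarrow> real \<Rightarrow> 'a measure \<Rightarrow> bool" where
  "confined x0 R \<mu> \<longleftrightarrow> \<mu> \<in> prob_measures \<and> (AE y in \<mu>. y \<in> cball x0 R)"

lemma confinedD:
  assumes "confined x0 R \<mu>" shows "\<mu> \<in> prob_measures" "prob_space \<mu>" "AE y in \<mu>. y \<in> cball x0 R"
  using assms prob_measuresD(1) by (auto simp: confined_def)

locale influence_function =
  fixes \<psi> :: "real \<Rightarrow> real" and \<Lambda> :: real
  assumes \<psi>_pos: "r \<ge> 0 \<Longrightarrow> \<psi> r > 0"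
    and \<psi>_antimono: "0 \<le> r \<Longrightarrow> r \<le> s \<Longrightarrow> \<psi> s \<le> \<psi> r"
    and \<psi>_lipschitz: "0 \<le> r \<Longrightarrow> 0 \<le> s \<Longrightarrow> \<bar>\<psi> r - \<psi> s\<bar> \<le> \<Lambda> * \<bar>r - s\<bar>"
    and \<psi>_0: "\<psi> 0 = 1" and \<Lambda>_pos: "\<Lambda> > 0"
begin

lemma \<psi>_le_1: "r \<ge> 0 \<Longrightarrow> \<psi> r \<le> 1"
  using \<psi>_antimono[of 0 r] \<psi>_0 by simp

lemma \<psi>_norm_lipschitz: "\<bar>\<psi> (norm x) - \<psi> (norm y)\<bar> \<le> \<Lambda> * norm (x - y)"
  using \<psi>_lipschitz[of "norm x" "norm y"] norm_triangle_ineq3[of x y] \<Lambda>_pos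
  by (smt (verit) mult_left_mono norm_ge_zero)

definition attraction :: "'a::euclidean_space \<Rightarrow> 'a" where
  "attraction z = \<psi> (norm z) *\<^sub>R z"

definition local_lip :: "real \<Rightarrow> real" where
  "local_lip B = \<Lambda> * B + 1"

text \<open>The attraction is only locally Lipschitz: where \<open>\<psi>\<close> is steep, its variation is multiplied by the distance.\<close>

lemma attraction_lipschitz:
  assumes "norm z \<le> B"
  shows "norm (attraction z - attraction z') \<le> local_lip B * norm (z - z')"
proof -
  have "attraction z - attraction z' = (\<psi> (norm z) - \<psi> (norm z')) *\<^sub>R z + \<psi> (norm z') *\<^sub>R (z - z')"
    by (simp add: attraction_def algebra_simps)
  then have "norm (attraction z - attraction z')
      \<le> \<bar>\<psi> (norm z) - \<psi> (norm z')\<bar> * norm z + \<bar>\<psi> (norm z')\<bar> * norm (z - z')"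
    by (metis norm_scaleR norm_triangle_ineq)
  also have "\<dots> \<le> (\<Lambda> * norm (z - z')) * B + 1 * norm (z - z')"
    using \<psi>_norm_lipschitz[of z z'] \<psi>_pos[of "norm z'"] \<psi>_le_1[of "norm z'"] assms \<Lambda>_pos
    by (intro add_mono mult_mono) auto
  finally show ?thesis by (simp add: local_lip_def algebra_simps)
qed

lemma continuous_\<psi>_norm: "continuous_on UNIV (\<lambda>z::'a::euclidean_space. \<psi> (norm z))"
proof (rule lipschitz_on_continuous_on)
  show "\<Lambda>-lipschitz_on UNIV (\<lambda>z::'a. \<psi> (norm z))"
    using \<psi>_norm_lipschitz \<Lambda>_pos by (intro lipschitz_onI) (auto simp: dist_norm)
qed

lemma continuous_attraction: "continuous_on UNIV (attraction :: 'a::euclidean_space \<Rightarrow> 'a)"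
  unfolding attraction_def by (intro continuous_intros continuous_\<psi>_norm)

lemma continuous_shifted:
  "continuous_on UNIV (\<lambda>y::'a::euclidean_space. attraction (y - x))"
  "continuous_on UNIV (\<lambda>y::'a::euclidean_space. \<psi> (norm (y - x)))"
  by (auto intro!: continuous_intros continuous_on_compose2[OF continuous_attraction]
      continuous_on_compose2[OF continuous_\<psi>_norm])

text \<open>Both velocity fields are an averaged attraction divided by a weight, the constant 1 or the total influence. On bounded
  sets the weight is bounded away from zero, so that they can be treated together.\<close>

definition weight :: "bool \<Rightarrow> 'a::euclidean_space measure \<Rightarrow> 'a \<Rightarrow> real" where
  "weight b \<mu> x = (if b then \<integral>y. \<psi> (norm (y - x)) \<partial>\<mu> else 1)"

definition velocity :: "bool \<Rightarrow> 'a::euclidean_space measure \<Rightarrow> 'a \<Rightarrow> 'a" where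
  "velocity b \<mu> x = (\<integral>y. attraction (y - x) \<partial>\<mu>) /\<^sub>R weight b \<mu> x"

lemma velocity_A_eq: "velocity_A \<psi> = velocity False"
  by (auto simp: fun_eq_iff velocity_A_def velocity_def weight_def attraction_def norm_minus_commute)

lemma velocity_B_eq: "velocity_B \<psi> = velocity True"
  by (auto simp: fun_eq_iff velocity_B_def velocity_def weight_def attraction_def norm_minus_commute)

text \<open>The Lipschitz constant that the quotient of an average bounded by \<open>B\<close> and a weight bounded below by \<open>\<psi> B\<close> inherits from
  numerator and denominator.\<close>

definition field_lip :: "real \<Rightarrow> real" where
  "field_lip B = local_lip B / \<psi> B + B / (\<psi> B)\<^sup>2 * \<Lambda>"

lemma field_lip_pos: "B \<ge> 0 \<Longrightarrow> field_lip B > 0"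
  using \<psi>_pos[of B] \<Lambda>_pos unfolding field_lip_def local_lip_def
  by (intro add_pos_nonneg add_nonneg_pos divide_pos_pos) auto

text \<open>Points of the ball of radius \<open>R + 1\<close> and points of the ball of radius \<open>R\<close> are at most \<open>B = 2 R + 1\<close> apart. The margin 1
  leaves room for test functions supported slightly outside the ball that carries the mass.\<close>

context
  fixes x0 :: "'a::euclidean_space" and R B :: real
  assumes R: "R > 0" and B_def: "B = 2 * R + 1"
begin

lemma diff_le_B:
  assumes "x \<in> cball x0 (R + 1)" "y \<in> cball x0 R" shows "norm (y - x) \<le> B"
  using assms norm_triangle_ineq[of "y - x0" "x0 - x"] by (simp add: B_def dist_norm norm_minus_commute)

lemma integrable_shifted:
  assumes "confined x0 R \<mu>"
  shows "integrable \<mu> (\<lambda>y. attraction (y - x))" "integrable \<mu> (\<lambda>y. \<psi> (norm (y - x)))"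
  using confinedD[OF assms] continuous_shifted[of x]
  by (auto intro: integrable_compactly_concentrated[where C="cball x0 R"])

lemma average_bound:
  fixes f :: "'a \<Rightarrow> 'b::euclidean_space"
  assumes "confined x0 R \<mu>" "integrable \<mu> f" "\<And>y. y \<in> cball x0 R \<Longrightarrow> norm (f y) \<le> c"
  shows "norm (\<integral>y. f y \<partial>\<mu>) \<le> c"
proof -
  interpret prob_space \<mu> using confinedD(2)[OF assms(1)] .
  have AE: "AE y in \<mu>. norm (f y) \<le> c" using confinedD(3)[OF assms(1)] by eventually_elim (rule assms(3))
  have "norm (\<integral>y. f y \<partial>\<mu>) \<le> (\<integral>y. norm (f y) \<partial>\<mu>)" by (rule integral_norm_bound)
  also have "\<dots> \<le> (\<integral>y. c \<partial>\<mu>)" using AE assms(2) by (intro integral_mono_AE) auto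
  finally show ?thesis by (simp add: prob_space)
qed

lemma average_attraction_bound:
  assumes "confined x0 R \<mu>" "x \<in> cball x0 (R + 1)"
  shows "norm (\<integral>y. attraction (y - x) \<partial>\<mu>) \<le> B"
proof (rule average_bound[OF assms(1) integrable_shifted(1)[OF assms(1)]])
  fix y assume "y \<in> cball x0 R"
  then have "norm (y - x) \<le> B" by (rule diff_le_B[OF assms(2)])
  then have "\<psi> (norm (y - x)) * norm (y - x) \<le> 1 * B"
    using \<psi>_le_1 \<psi>_pos[of "norm (y - x)"] by (intro mult_mono) auto
  then show "norm (attraction (y - x)) \<le> B" using \<psi>_pos[of "norm (y - x)"] by (simp add: attraction_def)
qed

lemma weight_ge:
  assumes "confined x0 R \<mu>" "x \<in> cball x0 (R + 1)"
  shows "\<psi> B \<le> weight b \<mu> x"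
proof (cases b)
  case True
  interpret prob_space \<mu> using confinedD(2)[OF assms(1)] .
  have "AE y in \<mu>. \<psi> B \<le> \<psi> (norm (y - x))"
    using confinedD(3)[OF assms(1)] by eventually_elim (intro \<psi>_antimono diff_le_B[OF assms(2)], auto)
  then have "(\<integral>y. \<psi> B \<partial>\<mu>) \<le> (\<integral>y. \<psi> (norm (y - x)) \<partial>\<mu>)"
    using integrable_shifted(2)[OF assms(1)] by (intro integral_mono_AE) auto
  then show ?thesis using True by (simp add: weight_def prob_space)
next
  case False
  then show ?thesis using R \<psi>_le_1[of B] by (simp add: weight_def B_def)
qed

lemma \<psi>B_pos: "\<psi> B > 0"
  using R by (intro \<psi>_pos) (simp add: B_def)

lemma velocity_difference:
  assumes "confined x0 R \<mu>" "x \<in> cball x0 (R + 1)" "confined x0 R \<mu>'" "x' \<in> cball x0 (R + 1)"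
  shows "norm (velocity b \<mu> x - velocity b \<mu>' x')
    \<le> norm ((\<integral>y. attraction (y - x) \<partial>\<mu>) - (\<integral>y. attraction (y - x') \<partial>\<mu>')) / \<psi> B
      + B / (\<psi> B)\<^sup>2 * \<bar>weight b \<mu> x - weight b \<mu>' x'\<bar>"
  unfolding velocity_def
  by (rule quotient_difference_bound[OF \<psi>B_pos weight_ge[OF assms(1,2)] weight_ge[OF assms(3,4)]
        average_attraction_bound[OF assms(3,4)]])

lemma velocity_lipschitz:
  assumes "confined x0 R \<mu>" "x \<in> cball x0 (R + 1)" "x' \<in> cball x0 (R + 1)"
  shows "norm (velocity b \<mu> x - velocity b \<mu> x') \<le> field_lip B * norm (x - x')"
proof -
  note int = integrable_shifted[OF assms(1)]
  have "norm ((\<integral>y. attraction (y - x) \<partial>\<mu>) - (\<integral>y. attraction (y - x') \<partial>\<mu>)) \<le> local_lip B * norm (x - x')"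
    unfolding Bochner_Integration.integral_diff[OF int(1) int(1), symmetric]
  proof (rule average_bound[OF assms(1)])
    fix y assume "y \<in> cball x0 R"
    then have "norm (y - x) \<le> B" by (rule diff_le_B[OF assms(2)])
    from attraction_lipschitz[OF this, of "y - x'"]
    show "norm (attraction (y - x) - attraction (y - x')) \<le> local_lip B * norm (x - x')"
      by (simp add: norm_minus_commute)
  qed (intro Bochner_Integration.integrable_diff int)
  moreover have "\<bar>weight b \<mu> x - weight b \<mu> x'\<bar> \<le> \<Lambda> * norm (x - x')"
  proof (cases b)
    case True
    have "norm ((\<integral>y. \<psi> (norm (y - x)) \<partial>\<mu>) - (\<integral>y. \<psi> (norm (y - x')) \<partial>\<mu>)) \<le> \<Lambda> * norm (x - x')"
      unfolding Bochner_Integration.integral_diff[OF int(2) int(2), symmetric]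
    proof (rule average_bound[OF assms(1)])
      fix y
      show "norm (\<psi> (norm (y - x)) - \<psi> (norm (y - x'))) \<le> \<Lambda> * norm (x - x')"
        using \<psi>_norm_lipschitz[of "y - x" "y - x'"] by (simp add: norm_minus_commute)
    qed (intro Bochner_Integration.integrable_diff int)
    then show ?thesis using True by (simp add: weight_def)
  qed (use \<Lambda>_pos in \<open>simp add: weight_def\<close>)
  ultimately have "norm ((\<integral>y. attraction (y - x) \<partial>\<mu>) - (\<integral>y. attraction (y - x') \<partial>\<mu>)) / \<psi> B
      + B / (\<psi> B)\<^sup>2 * \<bar>weight b \<mu> x - weight b \<mu> x'\<bar>
      \<le> local_lip B * norm (x - x') / \<psi> B + B / (\<psi> B)\<^sup>2 * (\<Lambda> * norm (x - x'))"
    using \<psi>B_pos R by (intro add_mono divide_right_mono mult_left_mono) (auto simp: B_def)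
  also have "\<dots> = field_lip B * norm (x - x')" by (simp add: field_lip_def algebra_simps)
  finally show ?thesis using velocity_difference[OF assms(1,2) assms(1,3), of b] by linarith
qed

lemma velocity_wasserstein_stability:
  assumes "confined x0 R \<mu>" "confined x0 R \<nu>" "x \<in> cball x0 (R + 1)" "p \<ge> 1"
  shows "ennreal (norm (velocity b \<mu> x - velocity b \<nu> x)) \<le> ennreal (2 * field_lip B) * wasserstein p \<mu> \<nu>"
proof (cases "wasserstein p \<mu> \<nu> = \<infinity>")
  case True
  have "field_lip B > 0" using R by (intro field_lip_pos) (simp add: B_def)
  then show ?thesis using True by (simp add: ennreal_mult_top)
next
  case False
  then obtain w where w: "wasserstein p \<mu> \<nu> = ennreal w" "w \<ge> 0" by (cases "wasserstein p \<mu> \<nu>") auto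
  note stab = lipschitz_average_stability[OF confinedD(1,3)[OF assms(1)] confinedD(1,3)[OF assms(2)] compact_cball]
  have lip_pos: "local_lip B > 0" using R \<Lambda>_pos by (simp add: local_lip_def B_def add_pos_pos)
  have "ennreal (norm ((\<integral>y. attraction (y - x) \<partial>\<mu>) - (\<integral>y. attraction (y - x) \<partial>\<nu>)))
      \<le> ennreal (2 * local_lip B) * wasserstein p \<mu> \<nu>"
  proof (rule stab[OF continuous_shifted(1) _ lip_pos assms(4)])
    fix y y' assume "y \<in> cball x0 R" "y' \<in> cball x0 R"
    then have "norm (y - x) \<le> B" by (intro diff_le_B[OF assms(3)])
    from attraction_lipschitz[OF this, of "y' - x"]
    show "norm (attraction (y - x) - attraction (y' - x)) \<le> local_lip B * dist y y'"
      by (simp add: dist_norm)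
  qed
  then have 1: "norm ((\<integral>y. attraction (y - x) \<partial>\<mu>) - (\<integral>y. attraction (y - x) \<partial>\<nu>)) \<le> 2 * local_lip B * w"
    using w lip_pos by (simp add: ennreal_mult[symmetric] ennreal_le_iff)
  have 2: "\<bar>weight b \<mu> x - weight b \<nu> x\<bar> \<le> 2 * \<Lambda> * w"
  proof (cases b)
    case True
    have "ennreal (norm ((\<integral>y. \<psi> (norm (y - x)) \<partial>\<mu>) - (\<integral>y. \<psi> (norm (y - x)) \<partial>\<nu>))) \<le> ennreal (2 * \<Lambda>) * wasserstein p \<mu> \<nu>"
    proof (rule stab[OF continuous_shifted(2) _ \<Lambda>_pos assms(4)])
      fix y y'
      show "norm (\<psi> (norm (y - x)) - \<psi> (norm (y' - x))) \<le> \<Lambda> * dist y y'"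
        using \<psi>_norm_lipschitz[of "y - x" "y' - x"] by (simp add: dist_norm)
    qed
    then show ?thesis using w \<Lambda>_pos True by (simp add: weight_def ennreal_mult[symmetric] ennreal_le_iff)
  qed (use \<Lambda>_pos w in \<open>simp add: weight_def\<close>)
  have "norm (velocity b \<mu> x - velocity b \<nu> x) \<le> 2 * local_lip B * w / \<psi> B + B / (\<psi> B)\<^sup>2 * (2 * \<Lambda> * w)"
    using velocity_difference[OF assms(1,3) assms(2,3), of b] 1 2 \<psi>B_pos R
    by (elim order_trans) (intro add_mono divide_right_mono mult_left_mono, auto simp: B_def)
  also have "\<dots> = 2 * field_lip B * w" by (simp add: field_lip_def algebra_simps)
  finally show ?thesis using w R field_lip_pos[of B]
    by (simp add: ennreal_mult[symmetric] ennreal_leI B_def)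
qed

text \<open>For \<open>y\<close> in the ball and \<open>x\<close> outside, \<open>(x - x\<^sub>0) \<bullet> (y - x) \<le> |x - x\<^sub>0| (R - |x - x\<^sub>0|) \<le> 0\<close>.\<close>

lemma velocity_inward:
  assumes "confined x0 R \<mu>" "x \<in> cball x0 (R + 1)" "norm (x - x0) \<ge> R"
  shows "(x - x0) \<bullet> velocity b \<mu> x \<le> 0"
proof -
  have "(x - x0) \<bullet> (\<integral>y. attraction (y - x) \<partial>\<mu>) = (\<integral>y. (x - x0) \<bullet> attraction (y - x) \<partial>\<mu>)"
    using integrable_shifted(1)[OF assms(1)] by simp
  also have "\<dots> \<le> (\<integral>y. 0 \<partial>\<mu>)"
  proof (rule integral_mono_AE)
    show "AE y in \<mu>. (x - x0) \<bullet> attraction (y - x) \<le> 0"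
      using confinedD(3)[OF assms(1)]
    proof eventually_elim
      case (elim y)
      have "(x - x0) \<bullet> (y - x) = (x - x0) \<bullet> (y - x0) - (norm (x - x0))\<^sup>2"
        by (simp add: power2_norm_eq_inner inner_diff_right inner_diff_left algebra_simps)
      also have "(x - x0) \<bullet> (y - x0) \<le> norm (x - x0) * norm (y - x0)" by (rule norm_cauchy_schwarz)
      also have "\<dots> \<le> norm (x - x0) * norm (x - x0)"
        using elim assms(3) by (intro mult_left_mono) (auto simp: dist_norm norm_minus_commute)
      finally have "(x - x0) \<bullet> (y - x) \<le> 0" by (simp add: power2_eq_square)
      then show ?case using \<psi>_pos[of "norm (y - x)"]
        by (simp add: attraction_def mult_nonneg_nonpos)
    qed
  qed (use integrable_shifted(1)[OF assms(1)] in auto)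
  finally show ?thesis using weight_ge[OF assms(1,2), of b] \<psi>B_pos
    by (simp add: velocity_def mult_nonneg_nonpos)
qed

text \<open>Narrow continuity only concerns bounded integrands, whereas the attraction may be unbounded; composing it with the
  projection onto the ball does not change the averages.\<close>

lemma velocity_continuous_in_time:
  assumes "narrowly_continuous_on I m" "\<And>t. t \<in> I \<Longrightarrow> confined x0 R (m t)" "x \<in> cball x0 (R + 1)"
  shows "continuous_on I (\<lambda>t. velocity b (m t) x)"
proof -
  define P where "P = closest_point (cball x0 R)"
  have P: "continuous_on UNIV P" "\<And>y. P y \<in> cball x0 R" "\<And>y. y \<in> cball x0 R \<Longrightarrow> P y = y"
    unfolding P_def using R closest_point_in_set[of "cball x0 R"]
    by (auto intro!: continuous_on_closest_point closest_point_self simp del: mem_cball)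
  have "continuous_on I (\<lambda>t. (\<integral>y. attraction (y - x) \<partial>m t) \<bullet> e)" for e
  proof (rule continuous_on_eq)
    have cont: "continuous_on UNIV (\<lambda>y. attraction (P y - x) \<bullet> e)"
      by (intro continuous_intros continuous_on_compose2[OF continuous_shifted(1) P(1)]) auto
    moreover have "norm (attraction (P y - x) \<bullet> e) \<le> B * norm e" for y
    proof -
      have "norm (P y - x) \<le> B" by (rule diff_le_B[OF assms(3) P(2)])
      moreover have "norm (attraction (P y - x)) \<le> 1 * norm (P y - x)"
        unfolding attraction_def norm_scaleR using \<psi>_le_1 \<psi>_pos[of "norm (P y - x)"]
        by (intro mult_right_mono) auto
      ultimately have "norm (attraction (P y - x)) \<le> B" by simp
      then have "norm (attraction (P y - x)) * norm e \<le> B * norm e" by (intro mult_right_mono) auto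
      then show ?thesis using Cauchy_Schwarz_ineq2[of "attraction (P y - x)" e] by simp
    qed
    ultimately show "continuous_on I (\<lambda>t. \<integral>y. attraction (P y - x) \<bullet> e \<partial>m t)"
      using assms(1) unfolding narrowly_continuous_on_def
      by (auto simp: bounded_iff)
    fix t assume t: "t \<in> I"
    have "(\<integral>y. attraction (P y - x) \<bullet> e \<partial>m t) = (\<integral>y. attraction (y - x) \<bullet> e \<partial>m t)"
    proof (rule integral_cong_AE)
      note meas = measurable_continuous[OF confinedD(1)[OF assms(2)[OF t]]]
      show "(\<lambda>y. attraction (P y - x) \<bullet> e) \<in> borel_measurable (m t)" by (rule meas[OF cont])
      show "(\<lambda>y. attraction (y - x) \<bullet> e) \<in> borel_measurable (m t)"
        by (rule meas) (intro continuous_intros continuous_shifted)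
      show "AE y in m t. attraction (P y - x) \<bullet> e = attraction (y - x) \<bullet> e"
        using confinedD(3)[OF assms(2)[OF t]] by eventually_elim (simp add: P(3))
    qed
    then show "(\<integral>y. attraction (P y - x) \<bullet> e \<partial>m t) = (\<integral>y. attraction (y - x) \<partial>m t) \<bullet> e"
      using integrable_shifted(1)[OF assms(2)[OF t], of x] by simp
  qed
  then have N: "continuous_on I (\<lambda>t. \<integral>y. attraction (y - x) \<partial>m t)"
    by (subst continuous_on_componentwise) auto
  have "bounded (range (\<lambda>y::'a. \<psi> (norm (y - x))))"
    unfolding bounded_iff using \<psi>_le_1 \<psi>_pos by (intro exI[of _ 1]) (auto simp: less_imp_le)
  then have "continuous_on I (\<lambda>t. weight b (m t) x)"
    using assms(1) continuous_shifted(2)[of x] unfolding narrowly_continuous_on_def weight_def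
    by (cases b) auto
  moreover have "weight b (m t) x \<noteq> 0" if "t \<in> I" for t
    using weight_ge[OF assms(2)[OF that] assms(3), of b] \<psi>B_pos by auto
  ultimately show ?thesis unfolding velocity_def by (intro continuous_intros N) auto
qed

end

end

section \<open>Stability of delayed solutions\<close>

lemma INF_add_const_ennreal:
  fixes f :: "'i \<Rightarrow> ennreal"
  assumes "A \<noteq> {}"
  shows "(INF i\<in>A. f i + c) = (INF i\<in>A. f i) + c"
  using continuous_at_Inf_mono[of "\<lambda>x. x + c" "f ` A"] assms
    continuous_add[of "at_right (Inf (f ` A))", of "\<lambda>x. x" "\<lambda>x. c"]
  by (auto simp: mono_def image_comp)

lemma gradient_zero_near:
  fixes f :: "'a::euclidean_space \<Rightarrow> real"
  assumes "open U" "x \<in> U" "\<And>y. y \<in> U \<Longrightarrow> f y = 0"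
  shows "w \<bullet> gradient f x = 0"
proof -
  have "(f has_derivative (\<lambda>h. 0)) (at x)"
    by (rule has_derivative_transform_within_open[of "\<lambda>_. 0" "\<lambda>h. 0" _ _ U]) (use assms in auto)
  from gradient_inner[OF this] show ?thesis .
qed

lemma weak_integrand_zero_near:
  fixes \<phi> :: "'a::euclidean_space \<times> real \<Rightarrow> real"
  assumes "open U" "(x, t) \<in> U" "\<And>y. y \<in> U \<Longrightarrow> \<phi> y = 0"
  shows "weak_integrand w \<phi> x t = 0"
proof -
  have "(\<phi> has_derivative (\<lambda>h. 0)) (at (x, t))"
    by (rule has_derivative_transform_within_open[of "\<lambda>_. 0" "\<lambda>h. 0" _ _ U]) (use assms in auto)
  from deriv_plus_gradient[OF this] show ?thesis .
qed

lemma AE_in_support_superset: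
  fixes \<mu> :: "'a::second_countable_topology measure"
  assumes "\<mu> \<in> prob_measures" "measure_support \<mu> \<subseteq> S"
  shows "AE x in \<mu>. x \<in> S"
  using AE_measure_support[OF assms(1)] by eventually_elim (use assms(2) in auto)

context influence_function
begin

text \<open>As long as the delayed measures are concentrated on the ball, the solution is transported by a flow which stays in the
  ball. The field is first composed with the projection onto the ball of radius \<open>R + 1\<close>: this makes it globally
  Lipschitz, keeps it inward pointing outside the ball of radius \<open>R\<close>, and changes nothing on the supports of the relevant
  test functions. Likewise the initial points are projected onto the ball of radius \<open>R\<close>, so that \<open>X t\<close> is a continuous
  map on the whole space.\<close>

lemma delayed_solution_flow:
  fixes \<mu> g :: "real \<Rightarrow> 'a::euclidean_space measure"
  assumes R: "R > 0"
    and sol: "weak_solution (velocity b) \<tau> T g \<mu>" and \<tau>0: "\<tau> 0 \<ge> 0"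
    and start: "confined x0 R (\<mu> 0)" and T1: "0 < T1" "T1 < T"
    and nc: "narrowly_continuous_on I \<mu>" and \<tau>: "continuous_on {0..T1} \<tau>"
    and delayed: "\<And>t. t \<in> {0..T1} \<Longrightarrow> t - \<tau> t \<in> I" "\<And>t. t \<in> {0..T1} \<Longrightarrow> confined x0 R (\<mu> (t - \<tau> t))"
  obtains X where
    "\<And>z. X 0 z = closest_point (cball x0 R) z"
    "\<And>z t. t \<in> {0..T1} \<Longrightarrow> ((\<lambda>s. X s z) has_vector_derivative velocity b (\<mu> (t - \<tau> t)) (X t z)) (at t within {0..T1})"
    "\<And>z t. t \<in> {0..T1} \<Longrightarrow> X t z \<in> cball x0 R"
    "\<And>t. t \<in> {0..T1} \<Longrightarrow> continuous_on UNIV (X t)"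
    "\<And>t. 0 \<le> t \<Longrightarrow> t < T1 \<Longrightarrow> distr (\<mu> 0) borel (X t) = \<mu> t"
proof -
  define L where "L = field_lip (2 * R + 1)"
  have L: "L > 0" unfolding L_def using R by (intro field_lip_pos) auto
  define P where "P = closest_point (cball x0 (R + 1))"
  define P0 where "P0 = closest_point (cball x0 R)"
  have P: "P x \<in> cball x0 (R + 1)" "P0 x \<in> cball x0 R" for x
    unfolding P_def P0_def using R by (intro closest_point_in_set; auto)+
  have P_lip: "norm (P x - P y) \<le> norm (x - y)" "norm (P0 x - P0 y) \<le> norm (x - y)" for x y
    unfolding P_def P0_def dist_norm[symmetric] using R by (intro closest_point_lipschitz; auto)+
  have P_id: "P x = x" if "x \<in> cball x0 (R + 1)" for x
    unfolding P_def by (rule closest_point_self[OF that])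
  have P0_id: "P0 x = x" if "x \<in> cball x0 R" for x
    unfolding P0_def by (rule closest_point_self[OF that])
  define v where "v t x = velocity b (\<mu> (t - \<tau> t)) (P x)" for t x
  have lip: "norm (v t x - v t y) \<le> L * norm (x - y)" if t: "t \<in> {0..T1}" for t x y
  proof -
    have "norm (v t x - v t y) \<le> L * norm (P x - P y)"
      unfolding v_def L_def by (rule velocity_lipschitz[OF R refl delayed(2)[OF t] P(1) P(1)])
    also have "\<dots> \<le> L * norm (x - y)" using L by (intro mult_left_mono P_lip) auto
    finally show ?thesis .
  qed
  have cont_t: "continuous_on {0..T1} (\<lambda>t. v t x)" for x
  proof -
    have "continuous_on {0..T1} (\<lambda>t. t - \<tau> t)" by (intro continuous_intros \<tau>)
    then have "narrowly_continuous_on {0..T1} (\<lambda>t. \<mu> (t - \<tau> t))"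
      using nc delayed(1) unfolding narrowly_continuous_on_def
      by (auto intro!: continuous_on_compose2[of I "\<lambda>s. \<integral>x. _ x \<partial>\<mu> s" "{0..T1}" "\<lambda>t. t - \<tau> t"])
    then show ?thesis unfolding v_def
      by (rule velocity_continuous_in_time[OF R refl _ delayed(2) P(1)])
  qed
  have cont: "continuous_on ({0..T1} \<times> UNIV) (\<lambda>(t, x). v t x)"
  proof (rule continuous_on_TimesI[OF _ cont_t])
    have "L-lipschitz_on (cball x 1 \<inter> UNIV) (v t)" if "t \<in> {0..T1}" for t x
      using lip[OF that] L by (intro lipschitz_onI) (auto simp: dist_norm)
    then show "local_lipschitz {0..T1} UNIV v"
      by (intro local_lipschitzI exI[of _ 1] exI[of _ L] conjI ballI) auto
  qed
  have inward: "(x - x0) \<bullet> v t x \<le> 0" if t: "t \<in> {0..T1}" and x: "norm (x - x0) \<ge> R" for t x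
  proof (cases "x \<in> cball x0 (R + 1)")
    case True
    then show ?thesis using velocity_inward[OF R refl delayed(2)[OF t] True x, of b] P_id[OF True] by (simp add: v_def)
  next
    case False
    define n where "n = norm (x - x0)"
    have n: "n > R + 1" using False by (simp add: n_def dist_norm norm_minus_commute)
    have Px: "P x - x0 = ((R + 1) / n) *\<^sub>R (x - x0)"
      unfolding P_def n_def using R n by (subst closest_point_cball_radial) (auto simp: n_def)
    have "norm (P x - x0) = R + 1" unfolding Px using R n by (auto simp: n_def)
    then have "(P x - x0) \<bullet> v t x \<le> 0"
      unfolding v_def by (intro velocity_inward[OF R refl delayed(2)[OF t] P(1)]) simp
    then show ?thesis unfolding Px using R n by (simp add: mult_le_0_iff divide_le_0_iff not_le)
  qed
  have "\<exists>Y. Y 0 = P0 z \<and> (\<forall>t\<in>{0..T1}. (Y has_vector_derivative v t (Y t)) (at t within {0..T1}))" for z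
  proof -
    obtain Y where "Y 0 = P0 z" "\<And>t. t \<in> {0..T1} \<Longrightarrow> (Y has_vector_derivative v t (Y t)) (at t within {0..T1})"
      using picard_lindelof[OF less_imp_le[OF T1(1)] cont lip, of "P0 z"] by blast
    then show ?thesis by blast
  qed
  then obtain Y where Y: "\<And>z. Y z 0 = P0 z"
    "\<And>z t. t \<in> {0..T1} \<Longrightarrow> (Y z has_vector_derivative v t (Y z t)) (at t within {0..T1})" by metis
  define X where "X t z = Y z t" for t z
  have X0: "X 0 z = P0 z" for z using Y(1) by (simp add: X_def)
  have X: "((\<lambda>s. X s z) has_vector_derivative v t (X t z)) (at t within {0..T1})" if "t \<in> {0..T1}" for t z
    using Y(2)[OF that] by (simp add: X_def)
  have XR: "X t z \<in> cball x0 R" if "t \<in> {0..T1}" for t z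
    by (rule inward_field_ball_invariant[OF X _ _ that]) (use inward R P(2) X0 in auto)
  have v_eq: "v t (X t z) = velocity b (\<mu> (t - \<tau> t)) (X t z)" if "t \<in> {0..T1}" for t z
    using XR[OF that, of z] unfolding v_def by (subst P_id) auto
  have X_cont: "continuous_on UNIV (X t)" if t: "t \<in> {0..T1}" for t
  proof (rule lipschitz_on_continuous_on)
    define e where "e = exp ((2 * L + 1) * T1)"
    show "e-lipschitz_on UNIV (X t)"
      unfolding e_def
    proof (rule lipschitz_onI)
      fix z z'
      have "norm (X t z - X t z') \<le> exp ((2 * L + 1) * T1) * (norm (X 0 z - X 0 z') + 0)"
        by (rule flow_stability[OF X X _ _ _ t]) (use lip L in auto)
      also have "\<dots> \<le> exp ((2 * L + 1) * T1) * norm (z - z')"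
        unfolding X0 using P_lip(2) by (intro mult_left_mono) auto
      finally show "dist (X t z) (X t z') \<le> exp ((2 * L + 1) * T1) * dist z z'" by (simp add: dist_norm)
    qed simp
  qed
  have curve: "measure_curve_on {0..T1} \<mu>"
  proof -
    have sub: "{0..T1} \<subseteq> {0..<T}" using T1 by auto
    then show ?thesis using sol continuous_on_subset[OF _ sub]
      unfolding weak_solution_def measure_curve_on_def narrowly_continuous_on_def by blast
  qed
  have weak: "weakly_transported T1 (cball x0 (R + 1 / 2)) v \<mu>"
    unfolding weakly_transported_def
  proof (intro allI impI)
    fix \<phi> assume test: "test_function (UNIV \<times> {..<T1}) \<phi>"
      and loc: "\<forall>t\<in>{0..T1}. \<forall>x. \<phi> (x, t) \<noteq> 0 \<longrightarrow> x \<in> cball x0 (R + 1 / 2)"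
    have "test_function (UNIV \<times> {..<T}) \<phi>" using test T1 by (force simp: test_function_def)
    then have "(LINT t:{0..<T}|lborel. \<integral>x. weak_integrand (velocity b (\<mu> (t - \<tau> t)) x) \<phi> x t \<partial>\<mu> t)
        + (\<integral>x. \<phi> (x, 0) \<partial>g 0) = 0"
      using sol by (simp add: weak_solution_def)
    moreover have "g 0 = \<mu> 0" using sol \<tau>0 by (simp add: weak_solution_def)
    moreover have "(LINT t:{0..<T}|lborel. \<integral>x. weak_integrand (velocity b (\<mu> (t - \<tau> t)) x) \<phi> x t \<partial>\<mu> t)
      = (LINT t:{0..T1}|lborel. \<integral>x. weak_integrand (v t x) \<phi> x t \<partial>\<mu> t)"
      unfolding set_lebesgue_integral_def
    proof (rule Bochner_Integration.integral_cong[OF refl])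
      fix t
      consider "t \<in> {0..T1}" | "T1 < t" | "t < 0" by fastforce
      then show "indicator {0..<T} t *\<^sub>R (\<integral>x. weak_integrand (velocity b (\<mu> (t - \<tau> t)) x) \<phi> x t \<partial>\<mu> t)
        = indicator {0..T1} t *\<^sub>R (\<integral>x. weak_integrand (v t x) \<phi> x t \<partial>\<mu> t)"
      proof cases
        case 1
        \<comment> \<open>Either the projection fixes \<open>x\<close>, or the gradient vanishes there.\<close>
        have "velocity b (\<mu> (t - \<tau> t)) x \<bullet> gradient (\<lambda>y. \<phi> (y, t)) x = v t x \<bullet> gradient (\<lambda>y. \<phi> (y, t)) x" for x
        proof (cases "x \<in> cball x0 (R + 1)")
          case True
          then show ?thesis using P_id by (simp add: v_def)
        next
          case False
          have "w \<bullet> gradient (\<lambda>y. \<phi> (y, t)) x = 0" for w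
            by (rule gradient_zero_near[of "- cball x0 (R + 1 / 2)"]) (use False loc 1 in auto)
          then show ?thesis by simp
        qed
        then show ?thesis using 1 T1 by simp
      next
        case 2
        \<comment> \<open>After time \<open>T1\<close> the test function vanishes near \<open>(x, t)\<close>.\<close>
        have "weak_integrand w \<phi> x t = 0" for x w
        proof (rule weak_integrand_zero_near[of "- closure {w. \<phi> w \<noteq> 0}"])
          show "(x, t) \<in> - closure {w. \<phi> w \<noteq> 0}" using test 2 by (auto simp: test_function_def)
          show "\<phi> y = 0" if "y \<in> - closure {w. \<phi> w \<noteq> 0}" for y
            using that closure_subset[of "{w. \<phi> w \<noteq> 0}"] by auto
        qed auto
        then show ?thesis using 2 by simp
      qed simp
    qed
    ultimately show "(LINT t:{0..T1}|lborel. \<integral>x. weak_integrand (v t x) \<phi> x t \<partial>\<mu> t) + (\<integral>x. \<phi> (x, 0) \<partial>\<mu> 0) = 0"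
      by simp
  qed
  show thesis
  proof (rule that[of X])
    show "distr (\<mu> 0) borel (X t) = \<mu> t" if t: "0 \<le> t" "t < T1" for t
    proof (rule weak_solution_eq_pushforward[OF curve cont lip less_imp_le[OF L] weak _ X XR _ t X_cont])
      show "AE x in \<mu> 0. x \<in> cball x0 R" using start by (simp add: confined_def)
      show "X 0 z = z" if "z \<in> cball x0 R" for z using X0 P0_id[OF that] by simp
    qed (use t in auto)
    show "((\<lambda>s. X s z) has_vector_derivative velocity b (\<mu> (t - \<tau> t)) (X t z)) (at t within {0..T1})"
      if "t \<in> {0..T1}" for z t
      using X[OF that] v_eq[OF that] by simp
  qed (use X0 XR X_cont in \<open>simp_all add: P0_def del: mem_cball\<close>)
qed

definition stability_factor :: "real \<Rightarrow> real \<Rightarrow> real" where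
  "stability_factor R T = exp ((2 * field_lip (2 * R + 1) + 1) * T)"

text \<open>If the Wasserstein distance of the delayed measures is at most \<open>S\<close>, the two velocity fields differ by at most a
  multiple of \<open>S\<close>. Two flow lines then drift apart in a controlled way by Gronwall's inequality, and a coupling of the
  initial measures, pushed forward by the pair of flows, is a coupling at time \<open>t\<close> whose cost is controlled.\<close>

lemma one_step_stability:
  fixes \<mu>1 \<mu>2 g1 g2 :: "real \<Rightarrow> 'a::euclidean_space measure"
  assumes R: "R > 0" and \<tau>0: "\<tau> 0 \<ge> 0" and T1: "0 < T1" "T1 < T" and \<tau>: "continuous_on {0..T1} \<tau>"
    and I: "\<And>t. t \<in> {0..T1} \<Longrightarrow> t - \<tau> t \<in> I"
    and sol1: "weak_solution (velocity b) \<tau> T g1 \<mu>1" "confined x0 R (\<mu>1 0)" "narrowly_continuous_on I \<mu>1"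
      "\<And>t. t \<in> {0..T1} \<Longrightarrow> confined x0 R (\<mu>1 (t - \<tau> t))"
    and sol2: "weak_solution (velocity b) \<tau> T g2 \<mu>2" "confined x0 R (\<mu>2 0)" "narrowly_continuous_on I \<mu>2"
      "\<And>t. t \<in> {0..T1} \<Longrightarrow> confined x0 R (\<mu>2 (t - \<tau> t))"
    and t: "0 \<le> t" "t < T1"
  shows "confined x0 R (\<mu>1 t)" "confined x0 R (\<mu>2 t)"
    "p \<ge> 1 \<Longrightarrow> (\<And>s. s \<in> {0..T1} \<Longrightarrow> wasserstein p (\<mu>1 (s - \<tau> s)) (\<mu>2 (s - \<tau> s)) \<le> S) \<Longrightarrow>
      wasserstein p (\<mu>1 t) (\<mu>2 t) \<le> ennreal (2 * stability_factor R T) *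
        (wasserstein p (\<mu>1 0) (\<mu>2 0) + ennreal (2 * field_lip (2 * R + 1)) * S)"
proof -
  define L where "L = field_lip (2 * R + 1)"
  have L: "L > 0" unfolding L_def using R by (intro field_lip_pos) auto
  define E where "E = stability_factor R T"
  have E: "E > 0" by (simp add: E_def stability_factor_def)
  have t': "t \<in> {0..T1}" using t by auto
  obtain X1 where X1: "\<And>z. X1 0 z = closest_point (cball x0 R) z"
    "\<And>z t. t \<in> {0..T1} \<Longrightarrow> ((\<lambda>s. X1 s z) has_vector_derivative velocity b (\<mu>1 (t - \<tau> t)) (X1 t z)) (at t within {0..T1})"
    "\<And>z t. t \<in> {0..T1} \<Longrightarrow> X1 t z \<in> cball x0 R"
    "\<And>t. t \<in> {0..T1} \<Longrightarrow> continuous_on UNIV (X1 t)"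
    "\<And>t. 0 \<le> t \<Longrightarrow> t < T1 \<Longrightarrow> distr (\<mu>1 0) borel (X1 t) = \<mu>1 t"
    using delayed_solution_flow[OF R sol1(1) \<tau>0 sol1(2) T1 sol1(3) \<tau> I sol1(4)] by blast
  obtain X2 where X2: "\<And>z. X2 0 z = closest_point (cball x0 R) z"
    "\<And>z t. t \<in> {0..T1} \<Longrightarrow> ((\<lambda>s. X2 s z) has_vector_derivative velocity b (\<mu>2 (t - \<tau> t)) (X2 t z)) (at t within {0..T1})"
    "\<And>z t. t \<in> {0..T1} \<Longrightarrow> X2 t z \<in> cball x0 R"
    "\<And>t. t \<in> {0..T1} \<Longrightarrow> continuous_on UNIV (X2 t)"
    "\<And>t. 0 \<le> t \<Longrightarrow> t < T1 \<Longrightarrow> distr (\<mu>2 0) borel (X2 t) = \<mu>2 t"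
    using delayed_solution_flow[OF R sol2(1) \<tau>0 sol2(2) T1 sol2(3) \<tau> I sol2(4)] by blast
  have Xm: "X1 t \<in> borel_measurable borel" "X2 t \<in> borel_measurable borel"
    using X1(4)[OF t'] X2(4)[OF t'] by (auto intro: borel_measurable_continuous_onI)
  have pushforward_confined: "confined x0 R (distr \<nu> borel Y)"
    if \<nu>: "confined x0 R \<nu>" and Y: "Y \<in> borel_measurable borel" "\<And>z. Y z \<in> cball x0 R" for \<nu> and Y :: "'a \<Rightarrow> 'a"
  proof -
    interpret prob_space \<nu> using \<nu> by (simp add: confined_def prob_measures_def)
    have Y': "Y \<in> \<nu> \<rightarrow>\<^sub>M borel" using Y(1) \<nu> by (simp add: confined_def prob_measures_def cong: measurable_cong_sets)
    have "AE y in distr \<nu> borel Y. y \<in> cball x0 R" by (subst AE_distr_iff[OF Y']) (use Y(2) in auto)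
    then show ?thesis by (simp add: confined_def prob_measures_def prob_space_distr[OF Y'])
  qed
  show "confined x0 R (\<mu>1 t)" using pushforward_confined[OF sol1(2) Xm(1) X1(3)[OF t']] X1(5)[OF t] by simp
  show "confined x0 R (\<mu>2 t)" using pushforward_confined[OF sol2(2) Xm(2) X2(3)[OF t']] X2(5)[OF t] by simp
  assume p: "p \<ge> 1" and S: "\<And>s. s \<in> {0..T1} \<Longrightarrow> wasserstein p (\<mu>1 (s - \<tau> s)) (\<mu>2 (s - \<tau> s)) \<le> S"
  have "wasserstein p (\<mu>1 t) (\<mu>2 t) \<le> ennreal (2 * E) * (wasserstein p (\<mu>1 0) (\<mu>2 0) + ennreal (2 * L) * S)"
  proof (cases "S = \<infinity> \<or> couplings (\<mu>1 0) (\<mu>2 0) = {}")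
    case True
    then have top: "wasserstein p (\<mu>1 0) (\<mu>2 0) + ennreal (2 * L) * S = \<infinity>"
      using L by (auto simp: ennreal_mult_top wasserstein_eq_INF_cost)
    show ?thesis unfolding top using E by (simp add: ennreal_mult_top)
  next
    case False
    then obtain w where w: "S = ennreal w" "w \<ge> 0" by (cases S) auto
    define \<delta> where "\<delta> = 2 * L * w"
    have \<delta>: "\<delta> \<ge> 0" using L w by (simp add: \<delta>_def)
    have field_diff: "norm (velocity b (\<mu>1 (s - \<tau> s)) x - velocity b (\<mu>2 (s - \<tau> s)) x) \<le> \<delta>"
      if s: "s \<in> {0..T1}" and x: "x \<in> cball x0 R" for s x
    proof -
      have x': "x \<in> cball x0 (R + 1)" using x by simp
      have "ennreal (norm (velocity b (\<mu>1 (s - \<tau> s)) x - velocity b (\<mu>2 (s - \<tau> s)) x))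
          \<le> ennreal (2 * L) * wasserstein p (\<mu>1 (s - \<tau> s)) (\<mu>2 (s - \<tau> s))"
        unfolding L_def by (rule velocity_wasserstein_stability[OF R refl sol1(4)[OF s] sol2(4)[OF s] x' p])
      also have "\<dots> \<le> ennreal (2 * L) * S" by (intro mult_left_mono S s) auto
      also have "\<dots> = ennreal \<delta>" using L w by (simp add: \<delta>_def ennreal_mult)
      finally show ?thesis using \<delta> by simp
    qed
    have flow_diff: "dist (X1 t x) (X2 t y) \<le> E * (dist x y + \<delta>)" for x y
    proof -
      have "norm (X1 t x - X2 t y) \<le> exp ((2 * L + 1) * T1) * (norm (X1 0 x - X2 0 y) + \<delta>)"
      proof (rule flow_stability[OF X1(2) X2(2) _ less_imp_le[OF L] \<delta> t'])
        fix s assume s: "s \<in> {0..T1}"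
        have in1: "z \<in> cball x0 (R + 1)" if "z \<in> cball x0 R" for z using that by simp
        have "norm (velocity b (\<mu>1 (s - \<tau> s)) (X1 s x) - velocity b (\<mu>1 (s - \<tau> s)) (X2 s y)) \<le> L * norm (X1 s x - X2 s y)"
          unfolding L_def by (rule velocity_lipschitz[OF R refl sol1(4)[OF s] in1[OF X1(3)[OF s]] in1[OF X2(3)[OF s]]])
        then show "norm (velocity b (\<mu>1 (s - \<tau> s)) (X1 s x) - velocity b (\<mu>2 (s - \<tau> s)) (X2 s y))
            \<le> L * norm (X1 s x - X2 s y) + \<delta>"
          using field_diff[OF s X2(3)[OF s]] by (rule norm_diff_triangle_le)
      qed
      also have "\<dots> \<le> E * (dist x y + \<delta>)"
      proof (rule mult_mono)
        show "exp ((2 * L + 1) * T1) \<le> E"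
          using T1 L unfolding E_def stability_factor_def L_def[symmetric] by simp
        have "dist (X1 0 x) (X2 0 y) \<le> dist x y"
          unfolding X1(1) X2(1) using R by (intro closest_point_lipschitz) auto
        then show "norm (X1 0 x - X2 0 y) + \<delta> \<le> dist x y + \<delta>" by (simp add: dist_norm)
      qed (use E \<delta> in auto)
      finally show ?thesis by (simp add: dist_norm)
    qed
    have step: "wasserstein p (\<mu>1 t) (\<mu>2 t) \<le> ennreal (2 * E) * (transport_cost p \<pi> + ennreal \<delta>)"
      if \<pi>: "\<pi> \<in> couplings (\<mu>1 0) (\<mu>2 0)" for \<pi>
    proof -
      note C = couplingsD[OF \<pi>]
      interpret prob_space \<pi> using C(1) by (rule prob_measuresD)
      define G where "G w = (X1 t (fst w), X2 t (snd w))" for w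
      have cG: "continuous_on UNIV G" unfolding G_def
        by (intro continuous_on_Pair continuous_on_compose2[OF X1(4)[OF t']] continuous_on_compose2[OF X2(4)[OF t']])
           (auto intro!: continuous_intros)
      then have G: "G \<in> borel_measurable borel" by (rule borel_measurable_continuous_onI)
      note G' = measurable_continuous[OF C(1) cG]
      have fs: "fst \<in> borel_measurable (borel :: ('a \<times> 'a) measure)" "snd \<in> borel_measurable (borel :: ('a \<times> 'a) measure)"
        by (intro borel_measurable_continuous_onI continuous_intros)+
      have "distr (distr \<pi> borel G) borel fst = distr (distr \<pi> borel fst) borel (X1 t)"
        by (simp add: distr_distr[OF fs(1) G'] distr_distr[OF Xm(1) C(4)] o_def G_def)
      also have "\<dots> = \<mu>1 t" by (simp add: C(2) X1(5)[OF t])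
      finally have m1: "distr (distr \<pi> borel G) borel fst = \<mu>1 t" .
      have "distr (distr \<pi> borel G) borel snd = distr (distr \<pi> borel snd) borel (X2 t)"
        by (simp add: distr_distr[OF fs(2) G'] distr_distr[OF Xm(2) C(5)] o_def G_def)
      also have "\<dots> = \<mu>2 t" by (simp add: C(3) X2(5)[OF t])
      finally have m2: "distr (distr \<pi> borel G) borel snd = \<mu>2 t" .
      have "distr \<pi> borel G \<in> couplings (\<mu>1 t) (\<mu>2 t)"
        using m1 m2 by (simp add: couplings_def prob_measures_def prob_space_distr[OF G'])
      then have "wasserstein p (\<mu>1 t) (\<mu>2 t) \<le> transport_cost p (distr \<pi> borel G)"
        unfolding wasserstein_eq_INF_cost by (rule INF_lower)
      also have "\<dots> \<le> ennreal (2 * E) * (transport_cost p \<pi> + ennreal \<delta>)"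
        by (rule cost_of_pushforward[OF C(1) p G E \<delta>]) (use flow_diff in \<open>simp add: G_def\<close>)
      finally show ?thesis .
    qed
    have "wasserstein p (\<mu>1 t) (\<mu>2 t) \<le> ennreal (2 * E) * (INF \<pi>\<in>couplings (\<mu>1 0) (\<mu>2 0). transport_cost p \<pi> + ennreal \<delta>)"
      by (rule le_mult_INF_ennreal[OF _ step]) (use E in auto)
    also have "\<dots> = ennreal (2 * E) * (wasserstein p (\<mu>1 0) (\<mu>2 0) + ennreal (2 * L) * S)"
      using False L w by (simp add: INF_add_const_ennreal wasserstein_eq_INF_cost \<delta>_def ennreal_mult)
    finally show ?thesis .
  qed
  then show "wasserstein p (\<mu>1 t) (\<mu>2 t) \<le> ennreal (2 * stability_factor R T) *
        (wasserstein p (\<mu>1 0) (\<mu>2 0) + ennreal (2 * field_lip (2 * R + 1)) * S)"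
    by (simp add: E_def L_def)
qed

lemma solution_narrowly_continuous_from_initial_time:
  assumes sol: "weak_solution F \<tau> T g \<mu>" and g: "measure_curve_on {-\<tau> 0..0} g" and \<tau>0: "\<tau> 0 \<ge> 0" and T1: "0 < T1" "T1 < T"
  shows "narrowly_continuous_on {-\<tau> 0..T1} \<mu>"
  unfolding narrowly_continuous_on_def
proof (intro allI impI)
  fix f :: "'a::euclidean_space \<Rightarrow> real"
  assume f: "continuous_on UNIV f \<and> bounded (range f)"
  have eq: "{-\<tau> 0..T1} = {-\<tau> 0..0} \<union> {0..T1}" using \<tau>0 T1 by auto
  have "continuous_on {-\<tau> 0..0} (\<lambda>t. \<integral>x. f x \<partial>g t)"
    using g f by (simp add: measure_curve_on_def narrowly_continuous_on_def)
  then have 1: "continuous_on {-\<tau> 0..0} (\<lambda>t. \<integral>x. f x \<partial>\<mu> t)"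
    by (rule continuous_on_eq) (use sol in \<open>simp add: weak_solution_def\<close>)
  have "continuous_on {0..<T} (\<lambda>t. \<integral>x. f x \<partial>\<mu> t)"
    using sol f by (simp add: weak_solution_def measure_curve_on_def narrowly_continuous_on_def)
  then have 2: "continuous_on {0..T1} (\<lambda>t. \<integral>x. f x \<partial>\<mu> t)"
    by (rule continuous_on_subset) (use T1 in auto)
  show "continuous_on {-\<tau> 0..T1} (\<lambda>t. \<integral>x. f x \<partial>\<mu> t)"
    unfolding eq by (rule continuous_on_closed_Un[OF _ _ 1 2]) auto
qed

text \<open>The delay is at least \<open>\<tau>min\<close>, so that for \<open>t < (k + 1) \<tau>min\<close> the delayed times lie in the range covered by the induction
  hypothesis for \<open>k\<close>. Each step restarts from time 0 and costs a factor \<open>K\<close>.\<close>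

lemma stability_by_delay_steps:
  fixes \<mu>1 \<mu>2 g1 g2 :: "real \<Rightarrow> 'a::euclidean_space measure"
  assumes R: "R > 0" and T: "T > 0" and \<tau>min: "\<tau>min > 0" and \<tau>_ge: "\<And>t. t \<ge> 0 \<Longrightarrow> \<tau>min \<le> \<tau> t"
    and \<tau>: "continuous_on {0..} \<tau>" and past: "\<And>t. t \<ge> 0 \<Longrightarrow> t - \<tau> t \<ge> - \<tau> 0"
    and g: "measure_curve_on {-\<tau> 0..0} g1" "measure_curve_on {-\<tau> 0..0} g2"
    and conf: "\<And>s. s \<in> {-\<tau> 0..0} \<Longrightarrow> confined x0 R (g1 s)" "\<And>s. s \<in> {-\<tau> 0..0} \<Longrightarrow> confined x0 R (g2 s)"
    and sol: "weak_solution (velocity b) \<tau> T g1 \<mu>1" "weak_solution (velocity b) \<tau> T g2 \<mu>2"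
    and p: "p \<ge> 1"
    and K: "K = 2 * stability_factor R T * (1 + 2 * field_lip (2 * R + 1))"
  shows "t \<in> {-\<tau> 0..<T} \<Longrightarrow> t \<le> 0 \<or> t < real k * \<tau>min \<Longrightarrow>
    confined x0 R (\<mu>1 t) \<and> confined x0 R (\<mu>2 t) \<and>
    wasserstein p (\<mu>1 t) (\<mu>2 t) \<le> ennreal (K ^ k) * (SUP s\<in>{-\<tau> 0..0}. wasserstein p (g1 s) (g2 s))"
proof (induction k arbitrary: t)
  have \<tau>0: "\<tau> 0 \<ge> 0" using \<tau>_ge[of 0] \<tau>min by simp
  have L: "field_lip (2 * R + 1) > 0" using R by (intro field_lip_pos) auto
  have E: "stability_factor R T \<ge> 1" using L T by (simp add: stability_factor_def)
  have "1 * 1 \<le> 2 * stability_factor R T * (1 + 2 * field_lip (2 * R + 1))"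
    using E L by (intro mult_mono) auto
  then have K1: "K \<ge> 1" by (simp add: K)
  define S where "S = (SUP s\<in>{-\<tau> 0..0}. wasserstein p (g1 s) (g2 s))"
  have init: "confined x0 R (\<mu>1 s) \<and> confined x0 R (\<mu>2 s) \<and> wasserstein p (\<mu>1 s) (\<mu>2 s) \<le> S" if "s \<in> {-\<tau> 0..0}" for s
  proof -
    have "\<mu>1 s = g1 s" "\<mu>2 s = g2 s" using sol that by (auto simp: weak_solution_def)
    then show ?thesis using conf that by (auto simp: S_def intro!: SUP_upper)
  qed
  have S_le: "S \<le> ennreal (K ^ k) * S" for k
  proof -
    have "1 \<le> ennreal (K ^ k)" using K1 by (simp add: one_le_power)
    from mult_right_mono[OF this, of S] show ?thesis by simp
  qed
  {
    case 0
    then have "t \<in> {-\<tau> 0..0}" by auto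
    from init[OF this] show ?case by (simp add: S_def)
  next
    case (Suc k)
    show ?case
    proof (cases "t \<le> 0")
      case True
      then have "t \<in> {-\<tau> 0..0}" using Suc.prems by auto
      from init[OF this] S_le[of "Suc k"] show ?thesis unfolding S_def[symmetric] by (meson order_trans)
    next
      case False
      then have t: "0 < t" "t < T" "t < real (Suc k) * \<tau>min" using Suc.prems by auto
      then obtain T1 where T1: "t < T1" "T1 < T" "T1 < real (Suc k) * \<tau>min"
        using dense[of t "min T (real (Suc k) * \<tau>min)"] by auto
      have T1': "0 < T1" using t T1 by simp
      have delay: "s - \<tau> s \<in> {-\<tau> 0..<T}" "s - \<tau> s \<in> {-\<tau> 0..T1}" "s - \<tau> s < real k * \<tau>min" if s: "s \<in> {0..T1}" for s
        using s past[of s] \<tau>_ge[of s] \<tau>min T1 by (auto simp: algebra_simps)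
      have IH: "confined x0 R (\<mu>1 (s - \<tau> s))" "confined x0 R (\<mu>2 (s - \<tau> s))"
        "wasserstein p (\<mu>1 (s - \<tau> s)) (\<mu>2 (s - \<tau> s)) \<le> ennreal (K ^ k) * S" if s: "s \<in> {0..T1}" for s
        using Suc.IH[OF delay(1)[OF s]] delay(3)[OF s] by (auto simp: S_def)
      have i0: "confined x0 R (\<mu>1 0)" "confined x0 R (\<mu>2 0)" "wasserstein p (\<mu>1 0) (\<mu>2 0) \<le> S"
        using init[of 0] \<tau>0 by auto
      note step = one_step_stability[OF R \<tau>0 T1' T1(2) continuous_on_subset[OF \<tau>, of "{0..T1}"] delay(2)
          sol(1) i0(1) solution_narrowly_continuous_from_initial_time[OF sol(1) g(1) \<tau>0 T1' T1(2)] IH(1)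
          sol(2) i0(2) solution_narrowly_continuous_from_initial_time[OF sol(2) g(2) \<tau>0 T1' T1(2)] IH(2)
          less_imp_le[OF t(1)] T1(1)]
      have "wasserstein p (\<mu>1 t) (\<mu>2 t) \<le> ennreal (2 * stability_factor R T) *
          (wasserstein p (\<mu>1 0) (\<mu>2 0) + ennreal (2 * field_lip (2 * R + 1)) * (ennreal (K ^ k) * S))"
        by (rule step(3)) (use p IH(3) in auto)
      also have "\<dots> \<le> ennreal (2 * stability_factor R T) *
          (ennreal (K ^ k) * S + ennreal (2 * field_lip (2 * R + 1)) * (ennreal (K ^ k) * S))"
        using order_trans[OF i0(3) S_le[of k]] by (intro mult_left_mono add_right_mono) auto
      also have "\<dots> = ennreal (K ^ Suc k) * S"
      proof -
        have "ennreal (K ^ Suc k) = ennreal (2 * stability_factor R T) * ((1 + ennreal (2 * field_lip (2 * R + 1))) * ennreal (K ^ k))"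
        proof -
          have "K ^ Suc k = 2 * stability_factor R T * ((1 + 2 * field_lip (2 * R + 1)) * K ^ k)"
            by (simp only: power_Suc K[symmetric] mult.assoc[symmetric])
          moreover have "ennreal (1 + 2 * field_lip (2 * R + 1)) = 1 + ennreal (2 * field_lip (2 * R + 1))"
            using L by (subst ennreal_plus) auto
          ultimately show ?thesis using E L K1 by (simp only: ennreal_mult) (subst ennreal_mult; simp)+
        qed
        then show ?thesis by (simp add: distrib_right mult.assoc)
      qed
      finally have "wasserstein p (\<mu>1 t) (\<mu>2 t) \<le> ennreal (K ^ Suc k) * S" .
      moreover have "confined x0 R (\<mu>1 t)" by (rule step(1)) auto
      moreover have "confined x0 R (\<mu>2 t)" by (rule step(2)) auto
      ultimately show ?thesis by (simp add: S_def)
    qed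
  }
qed

end

theorem theorem3p6:
  fixes \<psi> \<tau> \<tau>' :: "real \<Rightarrow> real"
    and \<tau>min \<tau>max c T R :: real
    and x0 :: "real ^ 'd"
    and F :: "(real ^ 'd) measure \<Rightarrow> real ^ 'd \<Rightarrow> real ^ 'd"
  assumes psi_pos: "\<forall>r\<ge>0. \<psi> r > 0"
    and psi_noninc: "antimono_on {0..} \<psi>"
    and psi_Lipschitz: "\<exists>L. L-lipschitz_on {0..} \<psi>"
    and psi_0: "\<psi> 0 = 1"
    and F: "F = velocity_A \<psi> \<or> F = velocity_B \<psi>"
    and tau_W1inf: "W1inf_loc {0<..} \<tau> \<tau>'"
    and tau_cont: "continuous_on {0..} \<tau>"
    and tau_bounds: "0 < \<tau>min" "0 < \<tau>max" "\<forall>t\<ge>0. \<tau>min \<le> \<tau> t \<and> \<tau> t \<le> \<tau>max"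
    and c: "0 < c" "c < 1"
    and tau_deriv: "AE t in lebesgue_on {0<..}. \<tau>' t \<le> c"
    and T: "T > 0"
  shows "\<exists>C>0. \<forall>g1 g2 \<mu>1 \<mu>2.
           measure_curve_on {-\<tau> 0..0} g1 \<and> measure_curve_on {-\<tau> 0..0} g2 \<and>
           (\<forall>s\<in>{-\<tau> 0..0}. measure_support (g1 s) \<subseteq> cball x0 R) \<and>
           (\<forall>s\<in>{-\<tau> 0..0}. measure_support (g2 s) \<subseteq> cball x0 R) \<and>
           weak_solution F \<tau> T g1 \<mu>1 \<and> weak_solution F \<tau> T g2 \<mu>2 \<longrightarrow>
           (\<forall>p\<ge>1. \<forall>t\<in>{0..<T}.
              wasserstein p (\<mu>1 t) (\<mu>2 t)
                \<le> ennreal C * (SUP s\<in>{-\<tau> 0..0}. wasserstein p (g1 s) (g2 s)))"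
proof -
  obtain L0 where L0: "L0-lipschitz_on {0..} \<psi>" using psi_Lipschitz by blast
  define \<Lambda> where "\<Lambda> = L0 + 1"
  interpret influence_function \<psi> \<Lambda>
  proof
    show "\<psi> r > 0" if "r \<ge> 0" for r using psi_pos that by blast
    show "\<psi> s \<le> \<psi> r" if "0 \<le> r" "r \<le> s" for r s
      using psi_noninc that by (auto simp: monotone_on_def)
    show "\<bar>\<psi> r - \<psi> s\<bar> \<le> \<Lambda> * \<bar>r - s\<bar>" if "0 \<le> r" "0 \<le> s" for r s
    proof -
      have "\<bar>\<psi> r - \<psi> s\<bar> \<le> L0 * \<bar>r - s\<bar>"
        using lipschitz_onD[OF L0, of r s] that by (simp add: dist_real_def)
      then show ?thesis by (simp add: \<Lambda>_def algebra_simps)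
    qed
    show "\<psi> 0 = 1" by (rule psi_0)
    show "\<Lambda> > 0" using lipschitz_on_nonneg[OF L0] by (simp add: \<Lambda>_def)
  qed
  obtain b where b: "F = velocity b" using F velocity_A_eq velocity_B_eq by metis
  \<comment> \<open>Enlarging the ball makes its radius positive.\<close>
  define R' where "R' = \<bar>R\<bar> + 1"
  have R': "R' > 0" "cball x0 R \<subseteq> cball x0 R'" by (auto simp: R'_def)
  have past: "t - \<tau> t \<ge> - \<tau> 0" if "t \<ge> 0" for t
    by (rule delayed_time_ge[OF tau_W1inf tau_cont tau_deriv c(2) that])
  obtain N :: nat where N: "T < real N * \<tau>min" using reals_Archimedean3[OF tau_bounds(1)] by blast
  define K where "K = 2 * stability_factor R' T * (1 + 2 * field_lip (2 * R' + 1))"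
  have "field_lip (2 * R' + 1) > 0" using R'(1) by (intro field_lip_pos) auto
  then have K: "K > 0" by (auto simp: K_def stability_factor_def intro!: mult_pos_pos add_pos_pos)
  show ?thesis
  proof (intro exI[of _ "K ^ N"] conjI allI impI ballI; (elim conjE)?)
    show "K ^ N > 0" using K by simp
    fix g1 g2 \<mu>1 \<mu>2 :: "real \<Rightarrow> (real ^ 'd) measure" and p :: ennreal and t :: real
    assume g: "measure_curve_on {-\<tau> 0..0} g1" "measure_curve_on {-\<tau> 0..0} g2"
      and supp: "\<forall>s\<in>{-\<tau> 0..0}. measure_support (g1 s) \<subseteq> cball x0 R" "\<forall>s\<in>{-\<tau> 0..0}. measure_support (g2 s) \<subseteq> cball x0 R"
      and sol: "weak_solution F \<tau> T g1 \<mu>1" "weak_solution F \<tau> T g2 \<mu>2"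
      and p: "p \<ge> 1" and t: "t \<in> {0..<T}"
    have conf: "confined x0 R' (g s)"
      if "measure_curve_on {-\<tau> 0..0} g" "\<forall>s\<in>{-\<tau> 0..0}. measure_support (g s) \<subseteq> cball x0 R" "s \<in> {-\<tau> 0..0}"
      for g :: "real \<Rightarrow> (real ^ 'd) measure" and s
    proof -
      have "g s \<in> prob_measures" using that by (simp add: measure_curve_on_def)
      moreover have "measure_support (g s) \<subseteq> cball x0 R'" using that R'(2) by blast
      ultimately show ?thesis unfolding confined_def using AE_in_support_superset by blast
    qed
    have "\<tau> 0 \<ge> 0" using tau_bounds(1,3) by force
    then have "t \<in> {-\<tau> 0..<T}" "t < real N * \<tau>min" using t N by auto
    then show "wasserstein p (\<mu>1 t) (\<mu>2 t) \<le> ennreal (K ^ N) * (SUP s\<in>{-\<tau> 0..0}. wasserstein p (g1 s) (g2 s))"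
      using stability_by_delay_steps[OF R'(1) T tau_bounds(1) _ tau_cont past g conf[OF g(1) supp(1)] conf[OF g(2) supp(2)]
          sol[unfolded b] p K_def, of t N] tau_bounds(3) by auto
  qed
qed

end
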